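(* Let $(\mathcal{T}_M,h,\Phi,\kappa,\mathcal{U},\mathcal{Q})$ be a tt*-bundle on a complex manifold $M$ with $\dim M=2$, with $h$ positive definite and $D'(\mathcal{U})=0$, where $D'+\overline\partial$ is the Chern connection of $h$. Let $p\in M$ be any point. (1) If $\pm\frac12$ is not an eigenvalue of $\mathcal{Q}(p)$, then there is an open neighborhood $U_p$ of $p$ such that $\Phi|_{U_p}=0$ and the connection $D'|_{U_p}$ is holomorphic. (2) If $\frac12$ is an eigenvalue of $\mathcal{Q}(p)$, and if $D'$ is a holomorphic connection, then there is a $D'$-flat holomorphic local frame $X_1,X_2$ of $\mathcal{T}_M$ near $p$ such that the matrix $\mathbb{Q}$ of $\mathcal{Q}$ in this frame is $$\mathbb{Q}=\begin{pmatrix}\frac12&0\\0&-\frac12\end{pmatrix},$$ and locally $\Phi=0$ holds.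
   Context: Let $E$ be a holomorphic vector bundle (here $E=\mathcal{T}_M$, the holomorphic tangent bundle) on a complex manifold $M$ with Hermitian metric $h$ (positive definite throughout). Let $H$ be the underlying $C^\infty$ bundle and $D=D'+\overline\partial$ the Chern connection of $h$. $P^\dagger$ denotes the $h$-adjoint of $P$, and $D'(P)=[D',P]$. $D'$ is called holomorphic if $D'\overline\partial+\overline\partial D'=0$. A Higgs field is an $\mathcal{O}_M$-linear morphism $\Phi:E\to\Omega^1_M\otimes E$ with $\Phi\wedge\Phi=0$. $(E,h,\Phi)$ is a harmonic Higgs bundle if $D'+\overline\partial+\Phi+\Phi^\dagger$ is an integrable (flat) connection on $H$; in particular $D'\overline\partial+\overline\partial D'=-(\Phi\Phi^\dagger+\Phi^\dagger\Phi)$. An integrable harmonic Higgs bundle $(E,h,\Phi,\mathcal{U},\mathcal{Q})$ is a harmonic Higgs bundle with two $C^\infty$ endomorphisms $\mathcal{U},\mathcal{Q}$ of $H$ such that $$\overline\partial(\mathcal{U})=0,\quad \mathcal{Q}^\dagger=\mathcal{Q},\quad [\Phi,\mathcal{U}]=0,\quad D'(\mathcal{U})-[\Phi,\mathcal{Q}]+\Phi=0,\quad D'(\mathcal{Q})+[\Phi,\mathcal{U}^\dagger]=0.$$ A real structure is an antilinear isomorphism $\kappa:H\to H$ with $\kappa^2=\mathrm{Id}$, $h(\kappa\cdot,\kappa\cdot)=\overline{h(\cdot,\cdot)}$ and $D(\kappa)=0$. Put $g(X,Y)=h(X,\kappa Y)$, a symmetric nondegenerate bilinear form, and let ${}^*$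 denote the adjoint with respect to $g$. A tt*-bundle (CV-structure) is an integrable harmonic Higgs bundle together with a real structure $\kappa$ such that $\mathcal{U}^*=\mathcal{U}$ and $\mathcal{Q}^*+\mathcal{Q}=0$; the latter is equivalent to $\mathcal{Q}=-\kappa\mathcal{Q}\kappa$. *)

theory Defs
  imports "HOL-Analysis.Analysis"
begin

section \<open>Smooth and holomorphic maps between open subsets of vector spaces\<close>

text \<open>All sets of definition are meant to be open, so that \<open>at z\<close> is unambiguous.\<close>

primrec Ck_on :: "nat \<Rightarrow> ('a::real_normed_vector \<Rightarrow> 'b::real_normed_vector) \<Rightarrow> 'a set \<Rightarrow> bool"
  where
    "Ck_on 0 f S \<longleftrightarrow> continuous_on S f"
  | "Ck_on (Suc k) f S \<longleftrightarrow>
       (\<forall>z\<in>S. f differentiable (at z)) \<and> (\<forall>v. Ck_on k (\<lambda>z. frechet_derivative f (at z) v) S)"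

definition smooth_on :: "('a::real_normed_vector \<Rightarrow> 'b::real_normed_vector) \<Rightarrow> 'a set \<Rightarrow> bool"
  where "smooth_on f S \<longleftrightarrow> (\<forall>k. Ck_on k f S)"

abbreviation complex_linear :: "(complex ^ 'n \<Rightarrow> complex ^ 'k) \<Rightarrow> bool"
  where "complex_linear \<equiv> Vector_Spaces.linear (*s) (*s)"

definition complex_antilinear :: "(complex ^ 'n \<Rightarrow> complex ^ 'k) \<Rightarrow> bool"
  where "complex_antilinear f \<longleftrightarrow>
    (\<forall>x y. f (x + y) = f x + f y) \<and> (\<forall>a x. f (a *s x) = cnj a *s f x)"

definition holomorphic_map_on :: "(complex ^ 'n \<Rightarrow> complex ^ 'k) \<Rightarrow> (complex ^ 'n) set \<Rightarrow> bool"
  where "holomorphic_map_on f S \<longleftrightarrow>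
    smooth_on f S \<and> (\<forall>z\<in>S. complex_linear (frechet_derivative f (at z)))"


section \<open>Complex manifolds and their holomorphic tangent bundle\<close>

type_synonym ('m, 'n) chart = "'m set \<times> ('m \<Rightarrow> complex ^ 'n)"

definition chart_inv :: "('m, 'n) chart \<Rightarrow> complex ^ 'n \<Rightarrow> 'm"
  where "chart_inv c = inv_into (fst c) (snd c)"

definition complex_manifold ::
    "('m::{t2_space, second_countable_topology}, 'n::finite) chart set \<Rightarrow> bool"
  where "complex_manifold A \<longleftrightarrow>
    (\<Union>c\<in>A. fst c) = UNIV \<and>
    (\<forall>c\<in>A. open (fst c) \<and> open (snd c ` fst c) \<and>
       homeomorphism (fst c) (snd c ` fst c) (snd c) (chart_inv c)) \<and>
    (\<forall>c\<in>A. \<forall>c'\<in>A. holomorphic_map_on (snd c' \<circ> chart_inv c) (snd c ` (fst c \<inter> fst c')))"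

text \<open>
  The fibre of the holomorphic tangent bundle at \<open>q\<close> is modelled by \<open>complex ^ 'n\<close>: a vector is
  represented by its components in one chart \<open>chart_at A q\<close> chosen at \<open>q\<close>. Its components in any
  other chart \<open>c\<close> around \<open>q\<close> are given by \<open>tangent_coord A c q\<close>, the Jacobian of the coordinate
  change. The choice of \<open>chart_at A q\<close> need not depend continuously on \<open>q\<close>, so
  smoothness of a section is always read off from its components in a fixed chart.
\<close>

definition chart_at :: "('m, 'n) chart set \<Rightarrow> 'm \<Rightarrow> ('m, 'n) chart"
  where "chart_at A q = (SOME c. c \<in> A \<and> q \<in> fst c)"

definition tangent_coord ::
    "('m, 'n::finite) chart set \<Rightarrow> ('m, 'n) chart \<Rightarrow> 'm \<Rightarrow> complex ^ 'n \<Rightarrow> complex ^ 'n"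
  where "tangent_coord A c q v =
    frechet_derivative (snd c \<circ> chart_inv (chart_at A q)) (at (snd (chart_at A q) q)) v"

type_synonym ('m, 'n) tsection = "'m \<Rightarrow> complex ^ 'n"
type_synonym ('m, 'n) end_field = "'m \<Rightarrow> complex ^ 'n \<Rightarrow> complex ^ 'n"

text \<open>A differential operator from sections to bundle-valued one-forms: \<open>D X q v\<close> is the value of
  \<open>D X\<close> at the point \<open>q\<close> in the direction \<open>v\<close>.\<close>

type_synonym ('m, 'n) operator = "('m, 'n) tsection \<Rightarrow> 'm \<Rightarrow> complex ^ 'n \<Rightarrow> complex ^ 'n"

definition section_rep ::
    "('m, 'n::finite) chart set \<Rightarrow> ('m, 'n) chart \<Rightarrow> ('m, 'n) tsection \<Rightarrow> complex ^ 'n \<Rightarrow> complex ^ 'n"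
  where "section_rep A c X z = tangent_coord A c (chart_inv c z) (X (chart_inv c z))"

definition smooth_fun ::
    "('m, 'n::finite) chart set \<Rightarrow> 'm set \<Rightarrow> ('m \<Rightarrow> complex) \<Rightarrow> bool"
  where "smooth_fun A V f \<longleftrightarrow> (\<forall>c\<in>A. smooth_on (f \<circ> chart_inv c) (snd c ` (V \<inter> fst c)))"

definition smooth_section ::
    "('m, 'n::finite) chart set \<Rightarrow> 'm set \<Rightarrow> ('m, 'n) tsection \<Rightarrow> bool"
  where "smooth_section A V X \<longleftrightarrow>
    (\<forall>c\<in>A. smooth_on (section_rep A c X) (snd c ` (V \<inter> fst c)))"

definition smooth_section_near ::
    "('m::topological_space, 'n::finite) chart set \<Rightarrow> 'm \<Rightarrow> ('m, 'n) tsection \<Rightarrow> bool"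
  where "smooth_section_near A q X \<longleftrightarrow> (\<exists>V. open V \<and> q \<in> V \<and> smooth_section A V X)"

definition smooth_fun_near ::
    "('m::topological_space, 'n::finite) chart set \<Rightarrow> 'm \<Rightarrow> ('m \<Rightarrow> complex) \<Rightarrow> bool"
  where "smooth_fun_near A q f \<longleftrightarrow> (\<exists>V. open V \<and> q \<in> V \<and> smooth_fun A V f)"

text \<open>
  Derivatives in the coordinates of \<open>chart_at A q\<close>, in which \<open>v\<close> is given by its components. Here
  \<open>v\<close> stands for the real tangent vector whose (1,0)-part is the holomorphic tangent vector \<open>v\<close>;
  thus the full derivative along \<open>v\<close> is the sum of the (1,0)-derivative along \<open>v\<close>, which is
  complex linear in \<open>v\<close>, and the (0,1)-derivative along the conjugate of \<open>v\<close>, which is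
  antilinear in \<open>v\<close>. Throughout, (0,1)-directions are parametrised by their conjugates \<open>v\<close>.
\<close>

definition fun_deriv ::
    "('m, 'n::finite) chart set \<Rightarrow> ('m \<Rightarrow> complex) \<Rightarrow> 'm \<Rightarrow> complex ^ 'n \<Rightarrow> complex"
  where "fun_deriv A f q v =
    frechet_derivative (f \<circ> chart_inv (chart_at A q)) (at (snd (chart_at A q) q)) v"

definition fun_del ::
    "('m, 'n::finite) chart set \<Rightarrow> ('m \<Rightarrow> complex) \<Rightarrow> 'm \<Rightarrow> complex ^ 'n \<Rightarrow> complex"
  where "fun_del A f q v = (fun_deriv A f q v - \<i> * fun_deriv A f q (\<i> *s v)) / 2"

definition fun_delbar ::
    "('m, 'n::finite) chart set \<Rightarrow> ('m \<Rightarrow> complex) \<Rightarrow> 'm \<Rightarrow> complex ^ 'n \<Rightarrow> complex"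
  where "fun_delbar A f q v = (fun_deriv A f q v + \<i> * fun_deriv A f q (\<i> *s v)) / 2"

definition section_deriv :: "('m, 'n::finite) chart set \<Rightarrow> ('m, 'n) operator"
  where "section_deriv A X q v =
    frechet_derivative (section_rep A (chart_at A q) X) (at (snd (chart_at A q) q)) v"

text \<open>The holomorphic structure of the tangent bundle.\<close>

definition delbar :: "('m, 'n::finite) chart set \<Rightarrow> ('m, 'n) operator"
  where "delbar A X q v =
    (1 / 2) *s (section_deriv A X q v + \<i> *s section_deriv A X q (\<i> *s v))"

definition holomorphic_section ::
    "('m, 'n::finite) chart set \<Rightarrow> 'm set \<Rightarrow> ('m, 'n) tsection \<Rightarrow> bool"
  where "holomorphic_section A V X \<longleftrightarrow>
    smooth_section A V X \<and> (\<forall>q\<in>V. \<forall>v. delbar A X q v = 0)"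

text \<open>Lie bracket of real vector fields.\<close>

definition lie_bracket ::
    "('m, 'n::finite) chart set \<Rightarrow> ('m, 'n) tsection \<Rightarrow> ('m, 'n) tsection \<Rightarrow> ('m, 'n) tsection"
  where "lie_bracket A \<xi> \<eta> q = section_deriv A \<eta> q (\<xi> q) - section_deriv A \<xi> q (\<eta> q)"

definition maps_smooth_sections ::
    "('m::topological_space, 'n::finite) chart set \<Rightarrow> ('m, 'n) end_field \<Rightarrow> bool"
  where "maps_smooth_sections A P \<longleftrightarrow>
    (\<forall>V X. open V \<longrightarrow> smooth_section A V X \<longrightarrow> smooth_section A V (\<lambda>q. P q (X q)))"

definition smooth_endomorphism ::
    "('m::topological_space, 'n::finite) chart set \<Rightarrow> ('m, 'n) end_field \<Rightarrow> bool"
  where "smooth_endomorphism A P \<longleftrightarrow> (\<forall>q. complex_linear (P q)) \<and> maps_smooth_sections A P"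


section \<open>Hermitian metrics, adjoints and the Chern connection\<close>

type_synonym ('m, 'n) form_field = "'m \<Rightarrow> complex ^ 'n \<Rightarrow> complex ^ 'n \<Rightarrow> complex"

text \<open>Hermitian metrics are linear in the first and antilinear in the second argument.\<close>

definition hermitian_metric ::
    "('m::topological_space, 'n::finite) chart set \<Rightarrow> ('m, 'n) form_field \<Rightarrow> bool"
  where "hermitian_metric A h \<longleftrightarrow>
    (\<forall>q y. Vector_Spaces.linear (*s) (*) (\<lambda>x. h q x y)) \<and>
    (\<forall>q x y. h q y x = cnj (h q x y)) \<and>
    (\<forall>q x. x \<noteq> 0 \<longrightarrow> Re (h q x x) > 0) \<and>
    (\<forall>V X Y. open V \<longrightarrow> smooth_section A V X \<longrightarrow> smooth_section A V Y \<longrightarrow>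
       smooth_fun A V (\<lambda>q. h q (X q) (Y q)))"

text \<open>For a nondegenerate form \<open>b\<close> on a fibre and a linear \<open>P\<close> this is well defined.\<close>

definition adjoint_wrt ::
    "(complex ^ 'n \<Rightarrow> complex ^ 'n \<Rightarrow> complex) \<Rightarrow> (complex ^ 'n \<Rightarrow> complex ^ 'n)
      \<Rightarrow> complex ^ 'n \<Rightarrow> complex ^ 'n"
  where "adjoint_wrt b P = (THE R. \<forall>x y. b (P x) y = b x (R y))"

text \<open>Connections of type (1,0), acting on germs of smooth sections.\<close>

definition connection_10 ::
    "('m::topological_space, 'n::finite) chart set \<Rightarrow> ('m, 'n) operator \<Rightarrow> bool"
  where "connection_10 A D' \<longleftrightarrow>
    (\<forall>q X. smooth_section_near A q X \<longrightarrow> complex_linear (D' X q)) \<and>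
    (\<forall>q X Y. smooth_section_near A q X \<longrightarrow> smooth_section_near A q Y \<longrightarrow>
       (\<forall>\<^sub>F r in nhds q. X r = Y r) \<longrightarrow> D' X q = D' Y q) \<and>
    (\<forall>q X Y v. smooth_section_near A q X \<longrightarrow> smooth_section_near A q Y \<longrightarrow>
       D' (\<lambda>r. X r + Y r) q v = D' X q v + D' Y q v) \<and>
    (\<forall>q f X v. smooth_fun_near A q f \<longrightarrow> smooth_section_near A q X \<longrightarrow>
       D' (\<lambda>r. f r *s X r) q v = fun_del A f q v *s X q + f q *s D' X q v) \<and>
    (\<forall>V X \<xi>. open V \<longrightarrow> smooth_section A V X \<longrightarrow> smooth_section A V \<xi> \<longrightarrow>
       smooth_section A V (\<lambda>q. D' X q (\<xi> q)))"

text \<open>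
  \<open>D'\<close> is the (1,0)-part of the Chern connection of \<open>h\<close>: the connection \<open>D' + delbar A\<close> is metric.
  The last two clauses are the (1,0)- and the (0,1)-part of \<open>d h(X,Y) = h(DX,Y) + h(X,DY)\<close>; in the
  second argument of \<open>h\<close> the conjugate direction occurs.
\<close>

definition chern_connection ::
    "('m::topological_space, 'n::finite) chart set \<Rightarrow> ('m, 'n) form_field \<Rightarrow> ('m, 'n) operator \<Rightarrow> bool"
  where "chern_connection A h D' \<longleftrightarrow>
    connection_10 A D' \<and>
    (\<forall>q X Y v. smooth_section_near A q X \<longrightarrow> smooth_section_near A q Y \<longrightarrow>
       fun_del A (\<lambda>r. h r (X r) (Y r)) q v = h q (D' X q v) (Y q) + h q (X q) (delbar A Y q v) \<and>
       fun_delbar A (\<lambda>r. h r (X r) (Y r)) q v = h q (delbar A X q v) (Y q) + h q (X q) (D' Y q v))"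

text \<open>\<open>D'(P) = [D', P]\<close>, and likewise for other operators \<open>D\<close>.\<close>

definition deriv_end :: "('m, 'n::finite) operator \<Rightarrow> ('m, 'n) end_field \<Rightarrow> ('m, 'n) operator"
  where "deriv_end D P X q v = D (\<lambda>r. P r (X r)) q v - P q (D X q v)"

definition parallel_end ::
    "('m::topological_space, 'n::finite) chart set \<Rightarrow> ('m, 'n) operator \<Rightarrow> ('m, 'n) end_field \<Rightarrow> bool"
  where "parallel_end A D P \<longleftrightarrow>
    (\<forall>q X v. smooth_section_near A q X \<longrightarrow> deriv_end D P X q v = 0)"

text \<open>
  \<open>D' \<circ> delbar + delbar \<circ> D' = 0\<close> over \<open>W\<close>. The left-hand side applied to \<open>X\<close> is a (1,1)-form; the
  formula is its value on \<open>\<xi>\<close> and the conjugate of \<open>\<eta>\<close>. For holomorphic vector fields, which span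
  the tangent spaces locally, \<open>\<xi>\<close> and the conjugate of \<open>\<eta>\<close> commute, so there is no bracket term.
\<close>

definition holomorphic_connection_on ::
    "('m::topological_space, 'n::finite) chart set \<Rightarrow> 'm set \<Rightarrow> ('m, 'n) operator \<Rightarrow> bool"
  where "holomorphic_connection_on A W D' \<longleftrightarrow>
    (\<forall>V \<xi> \<eta> X. open V \<longrightarrow> V \<subseteq> W \<longrightarrow> holomorphic_section A V \<xi> \<longrightarrow> holomorphic_section A V \<eta> \<longrightarrow>
       smooth_section A V X \<longrightarrow>
       (\<forall>q\<in>V. D' (\<lambda>r. delbar A X r (\<eta> r)) q (\<xi> q) - delbar A (\<lambda>r. D' X r (\<xi> r)) q (\<eta> q) = 0))"

text \<open>Integrability of a connection \<open>T\<close>, where \<open>T X q v\<close> is the derivative along the real tangent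
  vector \<open>v\<close>.\<close>

definition flat_connection ::
    "('m::topological_space, 'n::finite) chart set \<Rightarrow> ('m, 'n) operator \<Rightarrow> bool"
  where "flat_connection A T \<longleftrightarrow>
    (\<forall>V \<xi> \<eta> X. open V \<longrightarrow> smooth_section A V \<xi> \<longrightarrow> smooth_section A V \<eta> \<longrightarrow> smooth_section A V X \<longrightarrow>
       (\<forall>q\<in>V. T (\<lambda>r. T X r (\<eta> r)) q (\<xi> q) - T (\<lambda>r. T X r (\<xi> r)) q (\<eta> q)
                - T X q (lie_bracket A \<xi> \<eta> q) = 0))"


section \<open>Harmonic Higgs bundles and tt*-bundles on the tangent bundle\<close>

text \<open>\<open>\<Phi> q v\<close> is the endomorphism of the fibre at \<open>q\<close> obtained by inserting the vector \<open>v\<close>.\<close>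

type_synonym ('m, 'n) end_form = "'m \<Rightarrow> complex ^ 'n \<Rightarrow> complex ^ 'n \<Rightarrow> complex ^ 'n"

definition higgs_field ::
    "('m::topological_space, 'n::finite) chart set \<Rightarrow> ('m, 'n) end_form \<Rightarrow> bool"
  where "higgs_field A \<Phi> \<longleftrightarrow>
    (\<forall>q v. complex_linear (\<Phi> q v)) \<and> (\<forall>q x. complex_linear (\<lambda>v. \<Phi> q v x)) \<and>
    (\<forall>V \<xi> X. open V \<longrightarrow> holomorphic_section A V \<xi> \<longrightarrow> holomorphic_section A V X \<longrightarrow>
       holomorphic_section A V (\<lambda>q. \<Phi> q (\<xi> q) (X q))) \<and>
    (\<forall>q v w x. \<Phi> q v (\<Phi> q w x) - \<Phi> q w (\<Phi> q v x) = 0)"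

text \<open>The value of the (0,1)-form adjoint to \<open>\<Phi>\<close> on the conjugate of \<open>v\<close> is the adjoint of
  \<open>\<Phi> q v\<close>.\<close>

definition harmonic_higgs_bundle ::
    "('m::topological_space, 'n::finite) chart set \<Rightarrow> ('m, 'n) form_field \<Rightarrow> ('m, 'n) operator
      \<Rightarrow> ('m, 'n) end_form \<Rightarrow> bool"
  where "harmonic_higgs_bundle A h D' \<Phi> \<longleftrightarrow>
    hermitian_metric A h \<and> chern_connection A h D' \<and> higgs_field A \<Phi> \<and>
    flat_connection A (\<lambda>X q v. D' X q v + delbar A X q v
                               + \<Phi> q v (X q) + adjoint_wrt (h q) (\<Phi> q v) (X q))"

definition integrable_harmonic_higgs_bundle ::
    "('m::topological_space, 'n::finite) chart set \<Rightarrow> ('m, 'n) form_field \<Rightarrow> ('m, 'n) operator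
      \<Rightarrow> ('m, 'n) end_form \<Rightarrow> ('m, 'n) end_field \<Rightarrow> ('m, 'n) end_field \<Rightarrow> bool"
  where "integrable_harmonic_higgs_bundle A h D' \<Phi> U Q \<longleftrightarrow>
    harmonic_higgs_bundle A h D' \<Phi> \<and> smooth_endomorphism A U \<and> smooth_endomorphism A Q \<and>
    parallel_end A (delbar A) U \<and>
    (\<forall>q. adjoint_wrt (h q) (Q q) = Q q) \<and>
    (\<forall>q v x. \<Phi> q v (U q x) - U q (\<Phi> q v x) = 0) \<and>
    (\<forall>q X v. smooth_section_near A q X \<longrightarrow>
       deriv_end D' U X q v - (\<Phi> q v (Q q (X q)) - Q q (\<Phi> q v (X q))) + \<Phi> q v (X q) = 0) \<and>
    (\<forall>q X v. smooth_section_near A q X \<longrightarrow>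
       deriv_end D' Q X q v
         + (\<Phi> q v (adjoint_wrt (h q) (U q) (X q)) - adjoint_wrt (h q) (U q) (\<Phi> q v (X q))) = 0)"

text \<open>In \<open>D(\<kappa>) = 0\<close> the derivative is taken along real tangent vectors, as \<open>\<kappa>\<close> is antilinear and
  exchanges \<open>D'\<close> and \<open>delbar\<close>.\<close>

definition real_structure ::
    "('m::topological_space, 'n::finite) chart set \<Rightarrow> ('m, 'n) form_field \<Rightarrow> ('m, 'n) operator
      \<Rightarrow> ('m, 'n) end_field \<Rightarrow> bool"
  where "real_structure A h D' \<kappa> \<longleftrightarrow>
    (\<forall>q. complex_antilinear (\<kappa> q)) \<and> maps_smooth_sections A \<kappa> \<and>
    (\<forall>q x. \<kappa> q (\<kappa> q x) = x) \<and>
    (\<forall>q x y. h q (\<kappa> q x) (\<kappa> q y) = cnj (h q x y)) \<and>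
    parallel_end A (\<lambda>X q v. D' X q v + delbar A X q v) \<kappa>"

definition real_pairing ::
    "('m, 'n::finite) form_field \<Rightarrow> ('m, 'n) end_field \<Rightarrow> ('m, 'n) form_field"
  where "real_pairing h \<kappa> q x y = h q x (\<kappa> q y)"

definition tt_star_bundle ::
    "('m::topological_space, 'n::finite) chart set \<Rightarrow> ('m, 'n) form_field \<Rightarrow> ('m, 'n) operator
      \<Rightarrow> ('m, 'n) end_form \<Rightarrow> ('m, 'n) end_field \<Rightarrow> ('m, 'n) end_field \<Rightarrow> ('m, 'n) end_field \<Rightarrow> bool"
  where "tt_star_bundle A h D' \<Phi> \<kappa> U Q \<longleftrightarrow>
    integrable_harmonic_higgs_bundle A h D' \<Phi> U Q \<and> real_structure A h D' \<kappa> \<and>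
    (\<forall>q. adjoint_wrt (real_pairing h \<kappa> q) (U q) = U q) \<and>
    (\<forall>q x. adjoint_wrt (real_pairing h \<kappa> q) (Q q) x + Q q x = 0)"


section \<open>Eigenvalues and local frames\<close>

definition is_eigenvalue :: "(complex ^ 'n \<Rightarrow> complex ^ 'n) \<Rightarrow> complex \<Rightarrow> bool"
  where "is_eigenvalue P a \<longleftrightarrow> (\<exists>x. x \<noteq> 0 \<and> P x = a *s x)"

definition holomorphic_frame ::
    "('m, 'n::finite) chart set \<Rightarrow> 'm set \<Rightarrow> ('n \<Rightarrow> ('m, 'n) tsection) \<Rightarrow> bool"
  where "holomorphic_frame A V X \<longleftrightarrow>
    (\<forall>j. holomorphic_section A V (X j)) \<and>
    (\<forall>q\<in>V. inj (\<lambda>j. X j q) \<and> vec.independent (range (\<lambda>j. X j q)) \<and>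
            vec.span (range (\<lambda>j. X j q)) = UNIV)"

definition flat_section_on ::
    "('m, 'n::finite) operator \<Rightarrow> 'm set \<Rightarrow> ('m, 'n) tsection \<Rightarrow> bool"
  where "flat_section_on D V X \<longleftrightarrow> (\<forall>q\<in>V. \<forall>v. D X q v = 0)"

text \<open>The columns of \<open>B\<close> are the components of the images of the frame vectors.\<close>

definition has_matrix_in_frame ::
    "(complex ^ 'n \<Rightarrow> complex ^ 'n) \<Rightarrow> ('n::finite \<Rightarrow> complex ^ 'n) \<Rightarrow> complex ^ 'n ^ 'n \<Rightarrow> bool"
  where "has_matrix_in_frame P e B \<longleftrightarrow> (\<forall>j. P (e j) = (\<Sum>i\<in>UNIV. B $ i $ j *s e i))"

definition higgs_vanishes_on :: "('m, 'n::finite) end_form \<Rightarrow> 'm set \<Rightarrow> bool"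
  where "higgs_vanishes_on \<Phi> V \<longleftrightarrow> (\<forall>q\<in>V. \<forall>v x. \<Phi> q v x = 0)"

end

theory Submission
  imports Defs
begin

text \<open>
  Since \<open>Q\<close> is self-adjoint and \<open>Q \<kappa> = - \<kappa> Q\<close>, it is skew for the symmetric form
  \<open>h x (\<kappa> y)\<close>; in rank two this forces \<open>Q\<^sup>2 = \<mu> Id\<close> for a smooth function \<open>\<mu>\<close>. As \<open>D'(U) = 0\<close>, the
  integrability equation becomes \<open>[\<Phi>, Q] = \<Phi>\<close>, so \<open>\<Phi>\<close> lowers eigenvalues of \<open>Q\<close> by one; it can only be
  nonzero where \<open>\<mu> = 1/4\<close>, and there its values have square zero. Hence \<open>\<Phi> = 0\<close> near \<open>p\<close> in part (1), and the
  (1,1)-part of flatness says that \<open>D'\<close> is holomorphic. If \<open>D'\<close> is holomorphic, the (1,1)-part of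
  flatness says that the endomorphisms \<open>\<Phi> q v\<close> are normal; being of square zero they vanish. Then
  \<open>D' + delbar\<close> is flat and \<open>Q\<close> is parallel, so \<open>\<mu> = 1/4\<close> near \<open>p\<close> and the eigenline bundle of \<open>1/2\<close> is
  flat. A flat section \<open>X\<close> of it, given by the Poincare lemma, and \<open>\<kappa> X\<close> form the required frame.
\<close>

section \<open>Calculus of C^k maps\<close>

text \<open>Harmonicity is flatness of a single connection tested on real vector fields, so its part
  of type (1,1) has to be extracted. Holomorphic fields make this possible: their derivatives are
  complex linear, so when two of them are scaled by complex constants, each type of curvature scales
  by its own character. A second obstacle is the model of the bundle. Derivatives at q are taken in
  a chart that jumps with q, so claims about smoothness pass through change-of-chart formulas, and
  the complex linearity of second derivatives of coordinate changes is obtained from their symmetry.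
  The constant 1/4 arises because Q squared, being scalar, commutes with \<Phi>; this leaves
  [\<Phi>, Q] = \<Phi> no room except for a step from the eigenvalue 1/2 to -1/2. Restricting to one
  eigenline makes the flat frame a scalar problem: the curvature of a line bundle is the exterior
  derivative of its connection form, and a closed form is integrated by one exponential.\<close>

lemma frechet_derivative_cong_open:
  assumes "open S" "z \<in> S" "\<And>w. w \<in> S \<Longrightarrow> f w = g w"
  shows "frechet_derivative f (at z) = frechet_derivative g (at z)"
proof -
  have "(f has_derivative d) (at z) \<longleftrightarrow> (g has_derivative d) (at z)" for d
    using has_derivative_transform_within_open[of f d z UNIV S g]
      has_derivative_transform_within_open[of g d z UNIV S f] assms by auto
  then show ?thesis unfolding frechet_derivative_def by simp
qed

lemma differentiable_cong_open:
  assumes "open S" "z \<in> S" "\<And>w. w \<in> S \<Longrightarrow> f w = g w" "f differentiable (at z)"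
  shows "g differentiable (at z)"
  using has_derivative_transform_within_open[of f _ z UNIV S g] assms
  unfolding differentiable_def by auto

lemma frechet_derivativeI:
  "(f has_derivative d) (at z) \<Longrightarrow> frechet_derivative f (at z) = d"
  using frechet_derivative_at by metis

lemma Ck_on_cong_imp:
  assumes "open S" "\<And>z. z \<in> S \<Longrightarrow> f z = g z" "Ck_on k f S"
  shows "Ck_on k g S"
  using assms(2,3)
proof (induction k arbitrary: f g)
  case 0
  then show ?case using continuous_on_cong[of S S f g] by simp
next
  case (Suc k)
  have "frechet_derivative f (at z) = frechet_derivative g (at z)" if "z \<in> S" for z
    using frechet_derivative_cong_open[OF assms(1) that Suc.prems(1)] .
  moreover have "g differentiable (at z)" if "z \<in> S" for z
    using differentiable_cong_open[OF assms(1) that Suc.prems(1)] Suc.prems(2) that by auto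
  ultimately show ?case
    using Suc.IH[of "\<lambda>z. frechet_derivative f (at z) v" "\<lambda>z. frechet_derivative g (at z) v" for v]
      Suc.prems by auto
qed

lemma Ck_on_SucD: "Ck_on (Suc k) f S \<Longrightarrow> Ck_on k f S"
proof (induction k arbitrary: f)
  case 0
  then show ?case
    by (auto intro!: differentiable_imp_continuous_on simp: differentiable_on_def
        intro: differentiable_at_imp_differentiable_on)
next
  case (Suc k)
  then show ?case by (metis Ck_on.simps(2))
qed

text \<open>Derivatives are unique, so any explicit formula may stand for the chosen
  \<open>frechet_derivative\<close>. The differentiation rules below enter the induction on the
  order in this way.\<close>

lemma Ck_on_SucI:
  assumes "open S" "\<And>z. z \<in> S \<Longrightarrow> (f has_derivative d z) (at z)" "\<And>v. Ck_on k (\<lambda>z. d z v) S"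
  shows "Ck_on (Suc k) f S"
proof -
  have "Ck_on k (\<lambda>z. frechet_derivative f (at z) v) S" for v
    by (rule Ck_on_cong_imp[OF assms(1) _ assms(3)[of v]])
      (use assms(2) frechet_derivativeI in metis)
  then show ?thesis using assms(2) by (auto simp: differentiable_def)
qed

lemma Ck_on_has_derivative:
  "Ck_on (Suc k) f S \<Longrightarrow> z \<in> S \<Longrightarrow> (f has_derivative frechet_derivative f (at z)) (at z)"
  by (auto simp: frechet_derivative_works)

lemma Ck_on_subset: "Ck_on k f S \<Longrightarrow> T \<subseteq> S \<Longrightarrow> Ck_on k f T"
  by (induction k arbitrary: f) (auto intro: continuous_on_subset)

lemma Ck_on_const: "Ck_on k (\<lambda>z. c) S"
  by (induction k arbitrary: c) auto

lemma Ck_on_bounded_linear: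
  assumes "bounded_linear L" "open S" "Ck_on k f S"
  shows "Ck_on k (\<lambda>z. L (f z)) S"
  using assms(3)
proof (induction k arbitrary: f)
  case 0
  then show ?case using bounded_linear.continuous_on[OF assms(1)] by auto
next
  case (Suc k)
  show ?case
  proof (rule Ck_on_SucI[OF assms(2)])
    show "((\<lambda>z. L (f z)) has_derivative (\<lambda>v. L (frechet_derivative f (at z) v))) (at z)" if "z \<in> S" for z
      using bounded_linear.has_derivative[OF assms(1) Ck_on_has_derivative[OF Suc.prems that]] .
    show "Ck_on k (\<lambda>z. L (frechet_derivative f (at z) v)) S" for v
      using Suc.IH[of "\<lambda>z. frechet_derivative f (at z) v"] Suc.prems by simp
  qed
qed

lemma Ck_on_add:
  assumes "open S" "Ck_on k f S" "Ck_on k g S"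
  shows "Ck_on k (\<lambda>z. f z + g z) S"
  using assms(2,3)
proof (induction k arbitrary: f g)
  case 0
  then show ?case by (auto intro: continuous_on_add)
next
  case (Suc k)
  show ?case
  proof (rule Ck_on_SucI[OF assms(1)])
    show "((\<lambda>z. f z + g z) has_derivative
        (\<lambda>v. frechet_derivative f (at z) v + frechet_derivative g (at z) v)) (at z)" if "z \<in> S" for z
      using has_derivative_add[OF Ck_on_has_derivative[OF Suc.prems(1) that]
          Ck_on_has_derivative[OF Suc.prems(2) that]] .
    show "Ck_on k (\<lambda>z. frechet_derivative f (at z) v + frechet_derivative g (at z) v) S" for v
      using Suc.IH[of "\<lambda>z. frechet_derivative f (at z) v" "\<lambda>z. frechet_derivative g (at z) v"]
        Suc.prems by simp
  qed
qed

lemma Ck_on_sum: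
  assumes "open S" "finite I" "\<And>i. i \<in> I \<Longrightarrow> Ck_on k (f i) S"
  shows "Ck_on k (\<lambda>z. \<Sum>i\<in>I. f i z) S"
  using assms(2,3)
  by (induction I rule: finite_induct) (auto intro: Ck_on_const Ck_on_add[OF assms(1)])

lemma Ck_on_bounded_bilinear:
  assumes "bounded_bilinear B" "open S" "Ck_on k f S" "Ck_on k g S"
  shows "Ck_on k (\<lambda>z. B (f z) (g z)) S"
  using assms(3,4)
proof (induction k arbitrary: f g)
  case 0
  then show ?case using bounded_bilinear.continuous_on[OF assms(1)] by auto
next
  case (Suc k)
  show ?case
  proof (rule Ck_on_SucI[OF assms(2)])
    show "((\<lambda>z. B (f z) (g z)) has_derivative
        (\<lambda>v. B (f z) (frechet_derivative g (at z) v) + B (frechet_derivative f (at z) v) (g z))) (at z)"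
      if "z \<in> S" for z
      using bounded_bilinear.FDERIV[OF assms(1) Ck_on_has_derivative[OF Suc.prems(1) that]
          Ck_on_has_derivative[OF Suc.prems(2) that]] .
    show "Ck_on k (\<lambda>z. B (f z) (frechet_derivative g (at z) v) + B (frechet_derivative f (at z) v) (g z)) S" for v
      using Suc.prems Ck_on_SucD[OF Suc.prems(1)] Ck_on_SucD[OF Suc.prems(2)]
      by (intro Ck_on_add[OF assms(2)] Suc.IH) auto
  qed
qed

text \<open>The derivative of 1/f is built from 1/f itself and the derivative of f, so the induction
  keeps f fixed. \<open>Ck_on_exp\<close> works the same way.\<close>

lemma Ck_on_inverse:
  fixes f :: "'a::real_normed_vector \<Rightarrow> complex"
  assumes "open S" "Ck_on k f S" "\<And>z. z \<in> S \<Longrightarrow> f z \<noteq> 0"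
  shows "Ck_on k (\<lambda>z. inverse (f z)) S"
  using assms(2)
proof (induction k)
  case 0
  then show ?case using assms(3) by (auto intro: continuous_on_inverse)
next
  case (Suc k)
  show ?case
  proof (rule Ck_on_SucI[OF assms(1)])
    show "((\<lambda>z. inverse (f z)) has_derivative
        (\<lambda>v. - (inverse (f z) * frechet_derivative f (at z) v * inverse (f z)))) (at z)" if "z \<in> S" for z
      using Deriv.has_derivative_inverse[OF assms(3)[OF that] Ck_on_has_derivative[OF Suc.prems that]] by simp
    have "Ck_on k (\<lambda>z. inverse (f z)) S" using Suc.IH Ck_on_SucD[OF Suc.prems] by simp
    then show "Ck_on k (\<lambda>z. - (inverse (f z) * frechet_derivative f (at z) v * inverse (f z))) S" for v
      using Suc.prems
      by (intro Ck_on_bounded_linear[OF bounded_linear_minus[OF bounded_linear_ident] assms(1)]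
          Ck_on_bounded_bilinear[OF bounded_bilinear_mult assms(1)]) auto
  qed
qed

lemma Ck_on_exp:
  fixes f :: "'a::real_normed_vector \<Rightarrow> complex"
  assumes "open S" "Ck_on k f S"
  shows "Ck_on k (\<lambda>z. exp (f z)) S"
  using assms(2)
proof (induction k)
  case 0
  then show ?case by (auto intro: continuous_on_exp)
next
  case (Suc k)
  show ?case
  proof (rule Ck_on_SucI[OF assms(1)])
    show "((\<lambda>z. exp (f z)) has_derivative (\<lambda>v. exp (f z) * frechet_derivative f (at z) v)) (at z)"
      if "z \<in> S" for z
      using has_derivative_compose[OF Ck_on_has_derivative[OF Suc.prems that]
          DERIV_exp[of "f z", unfolded has_field_derivative_def]] .
    have "Ck_on k (\<lambda>z. exp (f z)) S" using Suc.IH Ck_on_SucD[OF Suc.prems] by simp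
    then show "Ck_on k (\<lambda>z. exp (f z) * frechet_derivative f (at z) v) S" for v
      using Suc.prems
      by (intro Ck_on_bounded_bilinear[OF bounded_bilinear_mult assms(1)]) auto
  qed
qed

lemma linear_euclidean_expand:
  fixes L :: "'b::euclidean_space \<Rightarrow> 'c::real_normed_vector"
  assumes "linear L"
  shows "L w = (\<Sum>b\<in>Basis. (w \<bullet> b) *\<^sub>R L b)"
proof -
  have "L w = L (\<Sum>b\<in>Basis. (w \<bullet> b) *\<^sub>R b)" by (simp add: euclidean_representation)
  also have "\<dots> = (\<Sum>b\<in>Basis. (w \<bullet> b) *\<^sub>R L b)"
    by (simp add: linear_sum[OF assms] linear_cmul[OF assms])
  finally show ?thesis .
qed

text \<open>\<open>Ck_on\<close> controls a derivative along one fixed direction at a time. Here the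
  direction w moves with the point; expanding it in a basis leaves finitely many fixed
  directions.\<close>

lemma Ck_on_linear_apply:
  fixes w :: "'a::real_normed_vector \<Rightarrow> 'b::euclidean_space" and L :: "'a \<Rightarrow> 'b \<Rightarrow> 'c::real_normed_vector"
  assumes "open S" "Ck_on k w S" "\<And>z. z \<in> S \<Longrightarrow> linear (L z)" "\<And>b. b \<in> Basis \<Longrightarrow> Ck_on k (\<lambda>z. L z b) S"
  shows "Ck_on k (\<lambda>z. L z (w z)) S"
proof (rule Ck_on_cong_imp[OF assms(1)])
  show "(\<Sum>b\<in>Basis. (w z \<bullet> b) *\<^sub>R L z b) = L z (w z)" if "z \<in> S" for z
    using linear_euclidean_expand[OF assms(3)[OF that]] by metis
  show "Ck_on k (\<lambda>z. \<Sum>b\<in>Basis. (w z \<bullet> b) *\<^sub>R L z b) S"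
    using assms(4)
    by (intro Ck_on_sum[OF assms(1)] Ck_on_bounded_bilinear[OF bounded_bilinear_scaleR assms(1)]
        Ck_on_bounded_linear[OF bounded_linear_inner_left assms(1) assms(2)]) auto
qed

text \<open>The chain rule gives the derivative of f, composed with g and applied to a moving
  direction. The induction therefore varies f and keeps g.\<close>

lemma Ck_on_compose:
  fixes g :: "'a::real_normed_vector \<Rightarrow> 'b::euclidean_space"
  assumes "open S" "open T" "g ` S \<subseteq> T" "Ck_on k f T" "Ck_on k g S"
  shows "Ck_on k (\<lambda>z. f (g z)) S"
  using assms(4,5)
proof (induction k arbitrary: f)
  case 0
  then show ?case using continuous_on_compose2[of T f S g] assms(3) by auto
next
  case (Suc k)
  show ?case
  proof (rule Ck_on_SucI[OF assms(1)])
    show "((\<lambda>z. f (g z)) has_derivative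
        (\<lambda>v. frechet_derivative f (at (g z)) (frechet_derivative g (at z) v))) (at z)" if "z \<in> S" for z
    proof -
      have "g z \<in> T" using assms(3) that by auto
      from has_derivative_compose[OF Ck_on_has_derivative[OF Suc.prems(2) that]
          Ck_on_has_derivative[OF Suc.prems(1) this]] show ?thesis .
    qed
    show "Ck_on k (\<lambda>z. frechet_derivative f (at (g z)) (frechet_derivative g (at z) v)) S" for v
    proof (rule Ck_on_linear_apply[OF assms(1)])
      show "Ck_on k (\<lambda>z. frechet_derivative g (at z) v) S" using Suc.prems by simp
      show "linear (frechet_derivative f (at (g z)))" if "z \<in> S" for z
        using that assms(3) Suc.prems(1) by (auto intro!: linear_frechet_derivative)
      show "Ck_on k (\<lambda>z. frechet_derivative f (at (g z)) b) S" for b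
        using Suc.IH[of "\<lambda>w. frechet_derivative f (at w) b"] Suc.prems Ck_on_SucD by auto
    qed
  qed
qed

text \<open>All orders are demanded at once, so one derivative costs nothing. Read from right to
  left, this upgrades a merely differentiable function whose derivatives are smooth.\<close>

lemma smooth_on_iff_deriv:
  "smooth_on f S \<longleftrightarrow>
    (\<forall>z\<in>S. f differentiable (at z)) \<and> (\<forall>v. smooth_on (\<lambda>z. frechet_derivative f (at z) v) S)"
proof
  assume *: "smooth_on f S"
  then show "(\<forall>z\<in>S. f differentiable (at z)) \<and> (\<forall>v. smooth_on (\<lambda>z. frechet_derivative f (at z) v) S)"
    unfolding smooth_on_def by (metis Ck_on.simps(2))
next
  assume *: "(\<forall>z\<in>S. f differentiable (at z)) \<and> (\<forall>v. smooth_on (\<lambda>z. frechet_derivative f (at z) v) S)"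
  then have "Ck_on (Suc k) f S" for k unfolding smooth_on_def by auto
  then show "smooth_on f S" unfolding smooth_on_def using Ck_on_SucD by blast
qed

lemma smooth_on_deriv: "smooth_on f S \<Longrightarrow> smooth_on (\<lambda>z. frechet_derivative f (at z) v) S"
  using smooth_on_iff_deriv by blast

lemma smooth_on_differentiable: "smooth_on f S \<Longrightarrow> z \<in> S \<Longrightarrow> f differentiable (at z)"
  using smooth_on_iff_deriv by blast

lemma smooth_on_has_derivative:
  "smooth_on f S \<Longrightarrow> z \<in> S \<Longrightarrow> (f has_derivative frechet_derivative f (at z)) (at z)"
  using smooth_on_differentiable frechet_derivative_works by blast

lemma smooth_on_linear_deriv:
  "smooth_on f S \<Longrightarrow> z \<in> S \<Longrightarrow> linear (frechet_derivative f (at z))"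
  using smooth_on_differentiable linear_frechet_derivative by blast

lemma smooth_on_continuous: "smooth_on f S \<Longrightarrow> continuous_on S f"
  unfolding smooth_on_def by (metis Ck_on.simps(1))

lemma smooth_on_cong:
  "open S \<Longrightarrow> smooth_on f S \<Longrightarrow> (\<And>z. z \<in> S \<Longrightarrow> f z = g z) \<Longrightarrow> smooth_on g S"
  unfolding smooth_on_def using Ck_on_cong_imp by blast

lemma smooth_on_subset: "smooth_on f S \<Longrightarrow> T \<subseteq> S \<Longrightarrow> smooth_on f T"
  unfolding smooth_on_def using Ck_on_subset by blast

lemma smooth_on_const: "smooth_on (\<lambda>z. c) S"
  unfolding smooth_on_def using Ck_on_const by blast

lemma smooth_on_bounded_linear:
  "bounded_linear L \<Longrightarrow> open S \<Longrightarrow> smooth_on f S \<Longrightarrow> smooth_on (\<lambda>z. L (f z)) S"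
  unfolding smooth_on_def using Ck_on_bounded_linear by blast

lemma smooth_on_add:
  "open S \<Longrightarrow> smooth_on f S \<Longrightarrow> smooth_on g S \<Longrightarrow> smooth_on (\<lambda>z. f z + g z) S"
  unfolding smooth_on_def using Ck_on_add by blast

lemma smooth_on_bounded_bilinear:
  "bounded_bilinear B \<Longrightarrow> open S \<Longrightarrow> smooth_on f S \<Longrightarrow> smooth_on g S \<Longrightarrow> smooth_on (\<lambda>z. B (f z) (g z)) S"
  unfolding smooth_on_def using Ck_on_bounded_bilinear by blast

lemma smooth_on_inverse:
  fixes f :: "'a::real_normed_vector \<Rightarrow> complex"
  shows "open S \<Longrightarrow> smooth_on f S \<Longrightarrow> (\<And>z. z \<in> S \<Longrightarrow> f z \<noteq> 0) \<Longrightarrow> smooth_on (\<lambda>z. inverse (f z)) S"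
  unfolding smooth_on_def using Ck_on_inverse by blast

lemma smooth_on_exp:
  fixes f :: "'a::real_normed_vector \<Rightarrow> complex"
  shows "open S \<Longrightarrow> smooth_on f S \<Longrightarrow> smooth_on (\<lambda>z. exp (f z)) S"
  unfolding smooth_on_def using Ck_on_exp by blast

lemma smooth_on_compose:
  fixes g :: "'a::real_normed_vector \<Rightarrow> 'b::euclidean_space"
  shows "open S \<Longrightarrow> open T \<Longrightarrow> g ` S \<subseteq> T \<Longrightarrow> smooth_on f T \<Longrightarrow> smooth_on g S
    \<Longrightarrow> smooth_on (\<lambda>z. f (g z)) S"
  unfolding smooth_on_def using Ck_on_compose by blast

lemma smooth_on_linear_apply:
  fixes w :: "'a::real_normed_vector \<Rightarrow> 'b::euclidean_space" and L :: "'a \<Rightarrow> 'b \<Rightarrow> 'c::real_normed_vector"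
  assumes "open S" "smooth_on w S" "\<And>z. z \<in> S \<Longrightarrow> linear (L z)" "\<And>b. smooth_on (\<lambda>z. L z b) S"
  shows "smooth_on (\<lambda>z. L z (w z)) S"
  using assms unfolding smooth_on_def by (auto intro: Ck_on_linear_apply)

lemma smooth_on_deriv_apply:
  fixes w f :: "'a::euclidean_space \<Rightarrow> _"
  assumes "open S" "smooth_on f S" "smooth_on w S"
  shows "smooth_on (\<lambda>z. frechet_derivative f (at z) (w z)) S"
  by (rule smooth_on_linear_apply[OF assms(1,3)])
    (use smooth_on_linear_deriv[OF assms(2)] smooth_on_deriv[OF assms(2)] in auto)

section \<open>Symmetry of second derivatives and the Poincare lemma\<close>

lemma has_derivative_along_line:
  assumes "(f has_derivative d) (at (a + s *\<^sub>R u))"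
  shows "((\<lambda>s. f (a + s *\<^sub>R u)) has_derivative (\<lambda>x. x *\<^sub>R d u)) (at s within T)"
proof -
  have "((\<lambda>s. a + s *\<^sub>R u) has_derivative (\<lambda>x. x *\<^sub>R u)) (at s within T)"
    by (auto intro!: derivative_eq_intros)
  from has_derivative_compose[OF this assms]
  show ?thesis using linear_cmul[OF has_derivative_linear[OF assms]] by simp
qed

text \<open>Two mean value arguments over a parallelogram: in direction u for the difference of f
  along v, then in direction v for the derivative along u. The point is that the second difference
  is symmetric in u and v.\<close>

lemma mixed_difference_mean_value:
  fixes f :: "'a::real_normed_vector \<Rightarrow> real"
  assumes f: "\<And>w. w \<in> S \<Longrightarrow> (f has_derivative d w) (at w)"
    and d: "\<And>w. w \<in> S \<Longrightarrow> ((\<lambda>w. d w u) has_derivative dd w) (at w)"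
    and h: "0 < h" "\<And>s t. s \<in> {0..h} \<Longrightarrow> t \<in> {0..h} \<Longrightarrow> z + s *\<^sub>R u + t *\<^sub>R v \<in> S"
  obtains s t where "s \<in> {0..h}" "t \<in> {0..h}"
    "f (z + h *\<^sub>R u + h *\<^sub>R v) - f (z + h *\<^sub>R u) - f (z + h *\<^sub>R v) + f z
      = h * h * dd (z + s *\<^sub>R u + t *\<^sub>R v) v"
proof -
  define \<psi> where "\<psi> s = f (z + h *\<^sub>R v + s *\<^sub>R u) - f (z + s *\<^sub>R u)" for s
  have "(\<psi> has_derivative (\<lambda>x. x *\<^sub>R d (z + h *\<^sub>R v + s *\<^sub>R u) u - x *\<^sub>R d (z + s *\<^sub>R u) u)) (at s within {0..h})"
    if "0 \<le> s" "s \<le> h" for s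
  proof -
    have "z + h *\<^sub>R v + s *\<^sub>R u \<in> S" using h(2)[of s h] that h(1) by (simp add: algebra_simps)
    moreover have "z + s *\<^sub>R u \<in> S" using h(2)[of s 0] that h(1) by simp
    ultimately show ?thesis unfolding \<psi>_def
      by (intro has_derivative_diff has_derivative_along_line f)
  qed
  from mvt_simple[OF h(1), of \<psi>, OF this]
  obtain s where s: "s \<in> {0<..<h}"
    "\<psi> h - \<psi> 0 = h * (d (z + h *\<^sub>R v + s *\<^sub>R u) u - d (z + s *\<^sub>R u) u)"
    by (auto simp: algebra_simps)
  define \<phi> where "\<phi> t = d (z + s *\<^sub>R u + t *\<^sub>R v) u" for t
  have "(\<phi> has_derivative (\<lambda>x. x *\<^sub>R dd (z + s *\<^sub>R u + t *\<^sub>R v) v)) (at t within {0..h})"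
    if "0 \<le> t" "t \<le> h" for t
    unfolding \<phi>_def using h(2)[of s t] that s(1)
    by (intro has_derivative_along_line[where f = "\<lambda>w. d w u"] d) auto
  from mvt_simple[OF h(1), of \<phi>, OF this]
  obtain t where t: "t \<in> {0<..<h}" "\<phi> h - \<phi> 0 = h * dd (z + s *\<^sub>R u + t *\<^sub>R v) v"
    by auto
  have "\<psi> h - \<psi> 0 = h * (\<phi> h - \<phi> 0)" using s(2) by (simp add: \<phi>_def add_ac)
  then have "f (z + h *\<^sub>R u + h *\<^sub>R v) - f (z + h *\<^sub>R u) - f (z + h *\<^sub>R v) + f z
      = h * h * dd (z + s *\<^sub>R u + t *\<^sub>R v) v"
    unfolding t(2) by (simp add: \<psi>_def add_ac mult.assoc)
  then show thesis using that[of s t] s(1) t(1) by auto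
qed

text \<open>The second difference is h * h times either mixed derivative, each at some nearby point.
  If the two differed at z, continuity would keep these values apart for small h.\<close>

lemma real_symmetric_second_derivative:
  fixes f :: "'a::real_normed_vector \<Rightarrow> real"
  assumes S: "open S" "z \<in> S" and f: "smooth_on f S"
  shows "frechet_derivative (\<lambda>w. frechet_derivative f (at w) u) (at z) v
    = frechet_derivative (\<lambda>w. frechet_derivative f (at w) v) (at z) u"
proof (rule ccontr)
  define P where "P w = frechet_derivative (\<lambda>w. frechet_derivative f (at w) u) (at w) v" for w
  define R where "R w = frechet_derivative (\<lambda>w. frechet_derivative f (at w) v) (at w) u" for w
  assume "\<not> ?thesis"
  then have ne: "P z \<noteq> R z" by (simp add: P_def R_def)
  have "continuous_on S P" "continuous_on S R" unfolding P_def R_def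
    using smooth_on_continuous smooth_on_deriv f by blast+
  then have "isCont P z" "isCont R z" using S continuous_on_eq_continuous_at by blast+
  then have "\<forall>\<^sub>F w in nhds z. dist (P w) (P z) < dist (P z) (R z) / 2 \<and> dist (R w) (R z) < dist (P z) (R z) / 2"
    using ne unfolding continuous_at tendsto_at_iff_tendsto_nhds
    by (intro eventually_conj tendstoD) auto
  moreover have "\<forall>\<^sub>F w in nhds z. w \<in> S" using S eventually_nhds by blast
  ultimately have "\<forall>\<^sub>F w in nhds z. w \<in> S \<and> dist (P w) (P z) < dist (P z) (R z) / 2
      \<and> dist (R w) (R z) < dist (P z) (R z) / 2"
    by (auto elim: eventually_elim2)
  then obtain r where r: "r > 0" "\<And>w. dist w z < r \<Longrightarrow> w \<in> S"
    "\<And>w. dist w z < r \<Longrightarrow> dist (P w) (P z) < dist (P z) (R z) / 2"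
    "\<And>w. dist w z < r \<Longrightarrow> dist (R w) (R z) < dist (P z) (R z) / 2"
    unfolding eventually_nhds_metric by auto
  \<comment> \<open>Keeps the parallelogram within distance r / 2 of z; the summand 1 covers u = v =
    0.\<close>
  define h where "h = r / 2 / (1 + norm u + norm v)"
  have pos: "1 + norm u + norm v > 0" by (simp add: add_pos_nonneg)
  have h: "h > 0" "h * (norm u + norm v) < r"
  proof -
    show "h > 0" unfolding h_def using pos r(1) by simp
    then have "h * (norm u + norm v) \<le> h * (1 + norm u + norm v)" by simp
    also have "\<dots> = r / 2" unfolding h_def
      by (rule nonzero_eq_divide_eq[THEN iffD1]) (use pos in simp_all)
    finally show "h * (norm u + norm v) < r" using r(1) by simp
  qed
  have near: "dist (z + s *\<^sub>R u + t *\<^sub>R v) z < r" if "s \<in> {0..h}" "t \<in> {0..h}" for s t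
  proof -
    have "dist (z + s *\<^sub>R u + t *\<^sub>R v) z \<le> \<bar>s\<bar> * norm u + \<bar>t\<bar> * norm v"
      using norm_triangle_ineq[of "s *\<^sub>R u" "t *\<^sub>R v"] by (simp add: dist_norm algebra_simps)
    also have "\<dots> \<le> h * norm u + h * norm v" using that by (intro add_mono mult_right_mono) auto
    finally show ?thesis using h(2) by (simp add: algebra_simps)
  qed
  define B where "B = {w. dist w z < r}"
  have BS: "w \<in> S" if "w \<in> B" for w using that r(2) B_def by auto
  have fd: "(f has_derivative frechet_derivative f (at w)) (at w)" if "w \<in> B" for w
    using smooth_on_has_derivative[OF f BS[OF that]] .
  have sd: "((\<lambda>w. frechet_derivative f (at w) x) has_derivative
      frechet_derivative (\<lambda>w. frechet_derivative f (at w) x) (at w)) (at w)" if "w \<in> B" for w x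
    using smooth_on_has_derivative[OF smooth_on_deriv[OF f] BS[OF that]] .
  obtain s t where 1: "s \<in> {0..h}" "t \<in> {0..h}"
    "f (z + h *\<^sub>R u + h *\<^sub>R v) - f (z + h *\<^sub>R u) - f (z + h *\<^sub>R v) + f z
      = h * h * P (z + s *\<^sub>R u + t *\<^sub>R v)"
    using mixed_difference_mean_value[where S = B and z = z and u = u and v = v, OF fd sd h(1)] near unfolding P_def B_def by auto
  have near': "dist (z + s *\<^sub>R v + t *\<^sub>R u) z < r" if "s \<in> {0..h}" "t \<in> {0..h}" for s t
    using near[OF that(2,1)] by (simp add: add_ac)
  obtain s' t' where 2: "s' \<in> {0..h}" "t' \<in> {0..h}"
    "f (z + h *\<^sub>R v + h *\<^sub>R u) - f (z + h *\<^sub>R v) - f (z + h *\<^sub>R u) + f z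
      = h * h * R (z + s' *\<^sub>R v + t' *\<^sub>R u)"
    using mixed_difference_mean_value[where S = B and z = z and u = v and v = u, OF fd sd h(1)] near' unfolding R_def B_def by auto
  have "h * h * P (z + s *\<^sub>R u + t *\<^sub>R v) = h * h * R (z + s' *\<^sub>R v + t' *\<^sub>R u)"
    unfolding 1(3)[symmetric] 2(3)[symmetric] by (simp add: add_ac)
  then have "P (z + s *\<^sub>R u + t *\<^sub>R v) = R (z + s' *\<^sub>R v + t' *\<^sub>R u)" using h(1) by simp
  moreover have "dist (P (z + s *\<^sub>R u + t *\<^sub>R v)) (P z) < dist (P z) (R z) / 2"
    using r(3) near 1 by blast
  moreover have "dist (R (z + s' *\<^sub>R v + t' *\<^sub>R u)) (R z) < dist (P z) (R z) / 2"
    using r(4) near' 2 by blast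
  ultimately show False
    using dist_triangle[of "P z" "R z" "R (z + s' *\<^sub>R v + t' *\<^sub>R u)"]
    by (simp add: dist_commute)
qed

text \<open>The mean value argument is about real functions, so the claim is tested against basis
  vectors; the inner product commutes with differentiation.\<close>

lemma symmetric_second_derivative:
  fixes f :: "'a::real_normed_vector \<Rightarrow> 'b::euclidean_space"
  assumes S: "open S" "z \<in> S" and f: "smooth_on f S"
  shows "frechet_derivative (\<lambda>w. frechet_derivative f (at w) u) (at z) v
    = frechet_derivative (\<lambda>w. frechet_derivative f (at w) v) (at z) u"
proof (rule euclidean_eqI)
  fix b :: 'b assume "b \<in> Basis"
  have inner: "frechet_derivative (\<lambda>w. g w \<bullet> b) (at w) = (\<lambda>x. frechet_derivative g (at w) x \<bullet> b)"
    if "smooth_on g S" "w \<in> S" for g :: "'a \<Rightarrow> 'b" and w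
    using bounded_linear.has_derivative[OF bounded_linear_inner_left smooth_on_has_derivative[OF that]]
    by (rule frechet_derivativeI)
  have fb: "smooth_on (\<lambda>w. f w \<bullet> b) S"
    by (rule smooth_on_bounded_linear[OF bounded_linear_inner_left S(1) f])
  have *: "frechet_derivative (\<lambda>w. frechet_derivative f (at w) u) (at z) v \<bullet> b
    = frechet_derivative (\<lambda>w. frechet_derivative (\<lambda>w. f w \<bullet> b) (at w) u) (at z) v" for u v
  proof -
    have "frechet_derivative (\<lambda>w. frechet_derivative (\<lambda>w. f w \<bullet> b) (at w) u) (at z)
      = frechet_derivative (\<lambda>w. frechet_derivative f (at w) u \<bullet> b) (at z)"
      by (rule frechet_derivative_cong_open[OF S]) (simp add: inner[OF f])
    then show ?thesis using inner[OF smooth_on_deriv[OF f] S(2)] by simp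
  qed
  show "frechet_derivative (\<lambda>w. frechet_derivative f (at w) u) (at z) v \<bullet> b
    = frechet_derivative (\<lambda>w. frechet_derivative f (at w) v) (at z) u \<bullet> b"
    unfolding * by (rule real_symmetric_second_derivative[OF S fb])
qed

text \<open>F z is the integral of \<omega> along the segment from z0 to z. After differentiation
  under the integral sign, closedness turns the integrand into the t-derivative of t times \<omega>
  at z0 + t (z - z0), applied to v; its integral is \<omega> z v.\<close>

lemma closed_form_primitive:
  fixes \<omega> :: "'a::euclidean_space \<Rightarrow> 'a \<Rightarrow> 'b::euclidean_space"
  assumes S: "open S" "convex S" "z0 \<in> S"
    and lin: "\<And>z. z \<in> S \<Longrightarrow> linear (\<omega> z)"
    and smooth: "\<And>v. smooth_on (\<lambda>z. \<omega> z v) S"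
    and closed: "\<And>z u v. z \<in> S \<Longrightarrow>
      frechet_derivative (\<lambda>z. \<omega> z u) (at z) v = frechet_derivative (\<lambda>z. \<omega> z v) (at z) u"
  shows "\<exists>F. \<forall>z\<in>S. (F has_derivative \<omega> z) (at z)"
proof -
  define \<gamma> where "\<gamma> z t = z0 + t *\<^sub>R (z - z0)" for z t
  define W where "W y u v = frechet_derivative (\<lambda>z. \<omega> z u) (at y) v" for y u v
  have \<gamma>: "\<gamma> z t \<in> S" if "z \<in> S" "t \<in> {0..1}" for z t
    using convexD_alt[OF S(2,3) that(1), of t] that(2) by (simp add: \<gamma>_def algebra_simps)
  have \<gamma>_cont: "continuous_on (S \<times> {0..1}) (\<lambda>(z, t). \<gamma> z t)"
    unfolding \<gamma>_def split_beta by (intro continuous_intros)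
  have W: "((\<lambda>z. \<omega> z u) has_derivative W y u) (at y)" if "y \<in> S" for y u
    unfolding W_def using smooth_on_has_derivative[OF smooth that] .
  have W_lin: "W y u v = (\<Sum>b\<in>Basis. (v \<bullet> b) *\<^sub>R W y u b)" if "y \<in> S" for y u v
    by (rule linear_euclidean_expand[OF has_derivative_linear[OF W[OF that]]])
  have W_sym: "W y u v = W y v u" if "y \<in> S" for y u v
    unfolding W_def by (rule closed[OF that])
  \<comment> \<open>The derivative of the integrand along b, with closedness already used to
    exchange b and z - z0; in this form it is a total derivative in t.\<close>
  define g where "g z t b = \<omega> (\<gamma> z t) b + t *\<^sub>R W (\<gamma> z t) b (z - z0)" for z t b
  have g_cont: "continuous_on (S \<times> {0..1}) (\<lambda>x. g (fst x) (snd x) b)" for b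
  proof -
    have c: "continuous_on (S \<times> {0..1}) (\<lambda>x. f (\<gamma> (fst x) (snd x)))" if "continuous_on S f" for f :: "'a \<Rightarrow> 'b"
      using continuous_on_compose2[OF that \<gamma>_cont] \<gamma> by (fastforce simp: split_beta)
    have "continuous_on (S \<times> {0..1}) (\<lambda>x. \<omega> (\<gamma> (fst x) (snd x)) b
        + snd x *\<^sub>R (\<Sum>c\<in>Basis. ((fst x - z0) \<bullet> c) *\<^sub>R W (\<gamma> (fst x) (snd x)) b c))"
      unfolding W_def
      by (intro continuous_intros c smooth_on_continuous smooth smooth_on_deriv)
    then show ?thesis
      by (rule continuous_on_cong[THEN iffD1, OF refl, rotated])
        (use W_lin \<gamma> in \<open>auto simp: g_def\<close>)
  qed
  \<comment> \<open>\<open>leibniz_rule\<close> takes the derivative as a continuous family of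
    bounded operators. A sum of rank-one operators reduces its continuity to that of the vectors
    \<open>g z t b\<close>.\<close>
  define fx where "fx z t = (\<Sum>b\<in>Basis. blinfun_scaleR_left (g z t b) o\<^sub>L blinfun_inner_left b)" for z t
  have fx_cont: "continuous_on (S \<times> cbox 0 1) (\<lambda>(z, t). fx z t)"
    unfolding fx_def split_beta cbox_interval
    by (intro continuous_on_sum bounded_bilinear.continuous_on[OF bounded_bilinear_blinfun_compose]
        bounded_linear.continuous_on[OF bounded_linear_blinfun_scaleR_left] g_cont continuous_on_const)
  have fx: "fx z t v = \<omega> (\<gamma> z t) v + t *\<^sub>R W (\<gamma> z t) v (z - z0)" if "z \<in> S" "t \<in> {0..1}" for z t v
  proof -
    note y = \<gamma>[OF that]
    have "fx z t v = (\<Sum>b\<in>Basis. (v \<bullet> b) *\<^sub>R \<omega> (\<gamma> z t) b) + t *\<^sub>R (\<Sum>b\<in>Basis. (v \<bullet> b) *\<^sub>R W (\<gamma> z t) (z - z0) b)"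
      unfolding fx_def g_def W_sym[OF y, of _ "z - z0"]
      by (simp add: blinfun.sum_left sum.distrib scaleR_sum_right scaleR_add_right inner_commute mult.commute)
    then show ?thesis
      using linear_euclidean_expand[OF lin[OF y], of v] W_lin[OF y, of "z - z0" v] W_sym[OF y, of v "z - z0"]
      by simp
  qed
  define f where "f z t = \<omega> (\<gamma> z t) (z - z0)" for z t
  have f_deriv: "((\<lambda>z. f z t) has_derivative fx z t) (at z within S)" if "z \<in> S" "t \<in> cbox 0 1" for z t
  proof -
    have t: "t \<in> {0..1}" using that(2) by simp
    note y = \<gamma>[OF that(1) t]
    have "((\<lambda>z. \<gamma> z t) has_derivative (\<lambda>v. t *\<^sub>R v)) (at z within S)"
      unfolding \<gamma>_def by (auto intro!: derivative_eq_intros)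
    then have d: "((\<lambda>z. \<omega> (\<gamma> z t) b) has_derivative (\<lambda>v. W (\<gamma> z t) b (t *\<^sub>R v))) (at z within S)" for b
      by (rule has_derivative_compose[where f = "\<lambda>z. \<gamma> z t" and g = "\<lambda>z. \<omega> z b", OF _ W[OF y, of b]])
    have "((\<lambda>z. \<Sum>b\<in>Basis. ((z - z0) \<bullet> b) *\<^sub>R \<omega> (\<gamma> z t) b) has_derivative
        (\<lambda>v. \<Sum>b\<in>Basis. ((z - z0) \<bullet> b) *\<^sub>R W (\<gamma> z t) b (t *\<^sub>R v) + (v \<bullet> b) *\<^sub>R \<omega> (\<gamma> z t) b)) (at z within S)"
      by (intro has_derivative_sum has_derivative_scaleR d has_derivative_inner_left)
        (auto intro!: derivative_eq_intros)
    moreover have "(\<Sum>b\<in>Basis. ((z - z0) \<bullet> b) *\<^sub>R W (\<gamma> z t) b (t *\<^sub>R v) + (v \<bullet> b) *\<^sub>R \<omega> (\<gamma> z t) b) = fx z t v" for v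
    proof -
      have "W (\<gamma> z t) b (t *\<^sub>R v) = t *\<^sub>R W (\<gamma> z t) v b" for b
        using linear_cmul[OF has_derivative_linear[OF W[OF y]]] W_sym[OF y, of b v] by simp
      then have "(\<Sum>b\<in>Basis. ((z - z0) \<bullet> b) *\<^sub>R W (\<gamma> z t) b (t *\<^sub>R v) + (v \<bullet> b) *\<^sub>R \<omega> (\<gamma> z t) b)
        = t *\<^sub>R (\<Sum>b\<in>Basis. ((z - z0) \<bullet> b) *\<^sub>R W (\<gamma> z t) v b) + (\<Sum>b\<in>Basis. (v \<bullet> b) *\<^sub>R \<omega> (\<gamma> z t) b)"
        by (simp add: sum.distrib scaleR_sum_right mult.commute)
      also have "\<dots> = fx z t v"
        unfolding W_lin[OF y, symmetric] linear_euclidean_expand[OF lin[OF y], symmetric] fx[OF that(1) t]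
        by simp
      finally show ?thesis .
    qed
    moreover have "f z' t = (\<Sum>b\<in>Basis. ((z' - z0) \<bullet> b) *\<^sub>R \<omega> (\<gamma> z' t) b)" if "z' \<in> S" for z'
      unfolding f_def using linear_euclidean_expand[OF lin[OF \<gamma>[OF that t]]] .
    ultimately show ?thesis
      using has_derivative_transform[OF that(1), of "\<lambda>z. f z t" "\<lambda>z. \<Sum>b\<in>Basis. ((z - z0) \<bullet> b) *\<^sub>R \<omega> (\<gamma> z t) b"]
      by simp
  qed
  have fx_int: "(\<lambda>t. fx z t) integrable_on cbox 0 1" if "z \<in> S" for z
  proof (rule integrable_continuous)
    show "continuous_on (cbox 0 1) (fx z)"
      using continuous_on_compose2[OF fx_cont, of "cbox 0 1" "\<lambda>t. (z, t)"] that
        continuous_on_Pair[OF continuous_on_const continuous_on_id, of "{0..1::real}" z]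
      by auto
  qed
  have f_int: "f z integrable_on cbox 0 1" if "z \<in> S" for z
  proof (rule integrable_continuous)
    have "continuous_on (cbox 0 (1::real)) (\<gamma> z)"
      unfolding \<gamma>_def by (intro continuous_intros)
    from continuous_on_compose2[OF smooth_on_continuous[OF smooth] this]
    have "continuous_on (cbox 0 1) (\<lambda>t. \<omega> (\<gamma> z t) (z - z0))" using \<gamma>[OF that] by (simp add: image_subset_iff)
    then show "continuous_on (cbox 0 1) (f z)" unfolding f_def .
  qed
  have int: "integral (cbox 0 1) (fx z) v = \<omega> z v" if "z \<in> S" for z v
  proof -
    have "((\<lambda>t. t *\<^sub>R \<omega> (\<gamma> z t) v) has_vector_derivative fx z t v) (at t within {0..1})" if t: "t \<in> {0..1}" for t
    proof -
      have "((\<lambda>t. \<gamma> z t) has_derivative (\<lambda>s. s *\<^sub>R (z - z0))) (at t within {0..1})"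
        unfolding \<gamma>_def by (auto intro!: derivative_eq_intros)
      from has_derivative_compose[OF this W[OF \<gamma>[OF \<open>z \<in> S\<close> t]]]
      have "((\<lambda>t. \<omega> (\<gamma> z t) v) has_derivative (\<lambda>s. s *\<^sub>R W (\<gamma> z t) v (z - z0))) (at t within {0..1})"
        by (simp only: linear_cmul[OF has_derivative_linear[OF W[OF \<gamma>[OF \<open>z \<in> S\<close> t]]]])
      from has_derivative_scaleR[OF has_derivative_ident this]
      show ?thesis
        unfolding has_vector_derivative_def fx[OF \<open>z \<in> S\<close> t]
        by (rule has_derivative_eq_rhs) (simp add: fun_eq_iff scaleR_add_right mult.commute add.commute)
    qed
    from fundamental_theorem_of_calculus[OF _ this]
    have "((\<lambda>t. fx z t v) has_integral (\<omega> (\<gamma> z 1) v)) {0..1}" by simp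
    moreover have "integral (cbox 0 1) (\<lambda>t. fx z t v) = integral (cbox 0 1) (fx z) v"
      using integral_linear[OF fx_int[OF that] blinfun.bounded_linear_left[of v]]
      by (simp add: o_def)
    ultimately show ?thesis by (simp add: \<gamma>_def integral_unique)
  qed
  have "((\<lambda>z. integral (cbox 0 1) (f z)) has_derivative \<omega> z) (at z)" if "z \<in> S" for z
  proof -
    have "((\<lambda>z. integral (cbox 0 1) (f z)) has_derivative integral (cbox 0 1) (fx z)) (at z within S)"
      by (rule leibniz_rule[OF f_deriv f_int fx_cont that S(2)])
    moreover have "blinfun_apply (integral (cbox 0 1) (fx z)) = \<omega> z" using int[OF that] by auto
    ultimately show ?thesis using at_within_open[OF that S(1)] by simp
  qed
  then show ?thesis by blast
qed

lemma has_derivative_linear_apply: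
  fixes L :: "'a::real_normed_vector \<Rightarrow> 'b::euclidean_space \<Rightarrow> 'c::real_normed_vector"
  assumes "open S" "z \<in> S" "\<And>y. y \<in> S \<Longrightarrow> linear (L y)"
    and L: "\<And>x. (\<lambda>y. L y x) differentiable (at z)"
    and w: "(w has_derivative w') (at z)"
  shows "((\<lambda>y. L y (w y)) has_derivative
    (\<lambda>v. frechet_derivative (\<lambda>y. L y (w z)) (at z) v + L z (w' v))) (at z)"
proof -
  define L' where "L' b = frechet_derivative (\<lambda>y. L y b) (at z)" for b
  have L': "((\<lambda>y. L y b) has_derivative L' b) (at z)" for b
    unfolding L'_def using L frechet_derivative_works by blast
  have expand: "L y x = (\<Sum>b\<in>Basis. (x \<bullet> b) *\<^sub>R L y b)" if "y \<in> S" for y x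
    by (rule linear_euclidean_expand[OF assms(3)[OF that]])
  have "((\<lambda>y. \<Sum>b\<in>Basis. (w z \<bullet> b) *\<^sub>R L y b) has_derivative (\<lambda>v. \<Sum>b\<in>Basis. (w z \<bullet> b) *\<^sub>R L' b v)) (at z)"
    by (intro has_derivative_sum has_derivative_scaleR_right L')
  then have "((\<lambda>y. L y (w z)) has_derivative (\<lambda>v. \<Sum>b\<in>Basis. (w z \<bullet> b) *\<^sub>R L' b v)) (at z)"
    by (rule has_derivative_transform_within_open[OF _ assms(1,2)]) (rule expand[symmetric])
  then have first: "frechet_derivative (\<lambda>y. L y (w z)) (at z) = (\<lambda>v. \<Sum>b\<in>Basis. (w z \<bullet> b) *\<^sub>R L' b v)"
    by (rule frechet_derivativeI)
  have "((\<lambda>y. \<Sum>b\<in>Basis. (w y \<bullet> b) *\<^sub>R L y b) has_derivative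
      (\<lambda>v. \<Sum>b\<in>Basis. (w z \<bullet> b) *\<^sub>R L' b v + (w' v \<bullet> b) *\<^sub>R L z b)) (at z)"
    by (intro has_derivative_sum has_derivative_scaleR L' has_derivative_inner_left w)
  then have "((\<lambda>y. L y (w y)) has_derivative
      (\<lambda>v. \<Sum>b\<in>Basis. (w z \<bullet> b) *\<^sub>R L' b v + (w' v \<bullet> b) *\<^sub>R L z b)) (at z)"
    by (rule has_derivative_transform_within_open[OF _ assms(1,2)]) (rule expand[symmetric])
  then show ?thesis
    unfolding first by (simp add: sum.distrib flip: expand[OF assms(2)])
qed

section \<open>Complex vectors\<close>

lemma bounded_bilinear_vector_scalar:
  "bounded_bilinear ((*s) :: complex \<Rightarrow> complex ^ 'n::finite \<Rightarrow> complex ^ 'n)"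
proof (rule bounded_bilinear.intro)
  show "\<exists>K. \<forall>a (b :: complex ^ 'n). norm (a *s b) \<le> norm a * norm b * K"
    by (intro exI[of _ 1]) (simp add: norm_vec_def L2_set_def norm_mult power_mult_distrib
        flip: sum_distrib_left add: real_sqrt_mult)
qed (simp_all add: vec_eq_iff algebra_simps)

lemma scaleR_eq_vector_scalar: "r *\<^sub>R (x :: complex ^ 'n) = complex_of_real r *s x"
  by (simp add: vec_eq_iff scaleR_conv_of_real[where 'a = complex])

lemma complex_linearI:
  "(\<And>x y. f (x + y) = f x + f y) \<Longrightarrow> (\<And>a x. f (a *s x) = a *s f x) \<Longrightarrow> complex_linear f"
  by (simp add: Vector_Spaces.linear_iff vec.vector_space_axioms)

lemma complex_linear_add: "complex_linear f \<Longrightarrow> f (x + y) = f x + f y"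
  and complex_linear_scale: "complex_linear f \<Longrightarrow> f (a *s x) = a *s f x"
  by (simp_all add: Vector_Spaces.linear_iff)

lemma complex_linear_zero: "complex_linear f \<Longrightarrow> f 0 = 0"
  by (metis complex_linear_scale vector_smult_lzero)

lemma complex_linear_diff: "complex_linear f \<Longrightarrow> f (x - y) = f x - f y"
  by (metis complex_linear_add diff_add_cancel eq_diff_eq)

lemma complex_linear_imp_linear:
  fixes f :: "complex ^ 'n \<Rightarrow> complex ^ 'k"
  shows "complex_linear f \<Longrightarrow> linear f"
  by (intro linearI) (simp_all add: complex_linear_add complex_linear_scale scaleR_eq_vector_scalar)

lemma imaginary_scale [simp]:
  "\<i> *s (\<i> *s x) = - (x :: complex ^ 'n)" "\<i> * (\<i> * a) = - a"
  by (simp_all add: vec_eq_iff flip: mult.assoc)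

section \<open>Hermitian linear algebra\<close>

lemma complex_antilinear_add: "complex_antilinear f \<Longrightarrow> f (x + y) = f x + f y"
  and complex_antilinear_scale: "complex_antilinear f \<Longrightarrow> f (a *s x) = cnj a *s f x"
  by (simp_all add: complex_antilinear_def)

lemma complex_antilinear_zero: "complex_antilinear f \<Longrightarrow> f 0 = 0"
  by (metis complex_antilinear_scale vector_smult_lzero complex_cnj_zero)

lemma complex_vec2_expand: "x = x $ 1 *s axis 1 1 + x $ 2 *s axis 2 (1::complex)" for x :: "complex ^ 2"
  by (simp add: vec_eq_iff forall_2 axis_def)

locale hermitian_form =
  fixes b :: "complex ^ 'n::finite \<Rightarrow> complex ^ 'n \<Rightarrow> complex"
  assumes linear_left: "Vector_Spaces.linear (*s) (*) (\<lambda>x. b x y)"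
    and hermitian: "b y x = cnj (b x y)"
    and positive: "x \<noteq> 0 \<Longrightarrow> Re (b x x) > 0"
begin

lemma add_left: "b (x + y) z = b x z + b y z"
  and scale_left: "b (a *s x) z = a * b x z"
  using linear_left[of z] by (simp_all add: Vector_Spaces.linear_iff)

lemma add_right: "b z (x + y) = b z x + b z y"
  and scale_right: "b z (a *s x) = cnj a * b z x"
  by (simp_all only: hermitian[of z] add_left scale_left complex_cnj_add complex_cnj_mult)

lemma zero_left: "b 0 z = 0"
  using scale_left[of 0 0 z] by simp

lemma zero_right: "b z 0 = 0"
  using scale_right[of z 0 0] by simp

lemma diff_left: "b (x - y) z = b x z - b y z"
  by (metis add_left add_diff_cancel_right' diff_add_cancel)

lemma diff_right: "b z (x - y) = b z x - b z y"
  by (metis add_right add_diff_cancel_right' diff_add_cancel)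

lemma self_eq_zero: "b x x = 0 \<longleftrightarrow> x = 0"
  using positive[of x] zero_left by fastforce

lemma eq_rightI: "(\<And>x. b x y = b x z) \<Longrightarrow> y = z"
  using self_eq_zero[of "y - z"] diff_right[of "y - z" y z] by simp

lemma eq_leftI: "(\<And>x. b y x = b z x) \<Longrightarrow> y = z"
  by (metis eq_rightI hermitian)

text \<open>The map T is complex linear because b is linear on the left, and injective because b is
  positive, hence onto in finite dimension. The target is conjugated because r is wanted in the
  antilinear slot.\<close>

lemma representation:
  assumes "Vector_Spaces.linear (*s) (*) \<phi>"
  shows "\<exists>r. \<forall>x. \<phi> x = b x r"
proof -
  define T where "T y = (\<chi> j. b y (axis j 1))" for y
  have T: "complex_linear T"
    by (rule complex_linearI) (simp_all add: T_def vec_eq_iff add_left scale_left)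
  have sum: "\<psi> x = (\<Sum>j\<in>UNIV. x $ j * \<psi> (axis j 1))" if "Vector_Spaces.linear (*s) (*) \<psi>"
    for \<psi> :: "complex ^ 'n \<Rightarrow> complex" and x
  proof -
    interpret \<psi>: Vector_Spaces.linear "(*s)" "(*)" \<psi> by (rule that)
    have "\<psi> x = \<psi> (\<Sum>j\<in>UNIV. x $ j *s axis j 1)" by (simp add: basis_expansion)
    then show ?thesis by (simp add: \<psi>.sum \<psi>.scale)
  qed
  have "inj T"
  proof (rule injI)
    fix y z assume "T y = T z"
    then have "b y (axis j 1) = b z (axis j 1)" for j by (simp add: T_def vec_eq_iff)
    then have *: "b (axis j 1) y = b (axis j 1) z" for j by (metis hermitian)
    show "y = z"
    proof (rule eq_rightI)
      fix x show "b x y = b x z"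
        using sum[OF linear_left[of y], of x] sum[OF linear_left[of z], of x] unfolding * by simp
    qed
  qed
  then have "surj T" using vec.linear_inj_imp_surj[OF T] by blast
  then obtain r where "T r = (\<chi> j. cnj (\<phi> (axis j 1)))" by (metis surjD)
  then have "b r (axis j 1) = cnj (\<phi> (axis j 1))" for j by (simp add: T_def vec_eq_iff)
  then have *: "\<phi> (axis j 1) = b (axis j 1) r" for j by (metis hermitian complex_cnj_cnj)
  have "\<phi> x = b x r" for x
    using sum[OF assms, of x] sum[OF linear_left[of r], of x] unfolding * by simp
  then show ?thesis by blast
qed

text \<open>\<open>adjoint_wrt\<close> is a definite description and says nothing before existence
  and uniqueness are known: the former is \<open>representation\<close> for each y, the latter
  nondegeneracy.\<close>

lemma adjoint:
  assumes "complex_linear P"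
  shows "b (P x) y = b x (adjoint_wrt b P y)"
proof -
  have "Vector_Spaces.linear (*s) (*) (\<lambda>x. b (P x) y)" for y
    using linear_left[of y] assms by (simp add: Vector_Spaces.linear_iff)
  then have "\<forall>y. \<exists>r. \<forall>x. b (P x) y = b x r" using representation by blast
  then obtain R where R: "\<forall>x y. b (P x) y = b x (R y)" by metis
  have "\<forall>x y. b (P x) y = b x (adjoint_wrt b P y)"
    unfolding adjoint_wrt_def
  proof (rule theI[where P = "\<lambda>R. \<forall>x y. b (P x) y = b x (R y)", OF R])
    show "R' = R" if "\<forall>x y. b (P x) y = b x (R' y)" for R'
    proof
      fix y show "R' y = R y" by (rule eq_rightI) (metis R that)
    qed
  qed
  then show ?thesis by blast
qed

lemma adjoint_right:
  assumes "complex_linear P"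
  shows "b (adjoint_wrt b P x) y = b x (P y)"
  by (metis adjoint[OF assms] hermitian)

lemma adjoint_linear:
  assumes "complex_linear P"
  shows "complex_linear (adjoint_wrt b P)"
  by (rule complex_linearI; rule eq_rightI)
    (simp_all add: add_right scale_right flip: adjoint[OF assms])

text \<open>Inserting \<kappa> \<kappa> = Id in front of the b-adjoint of P shows what the adjoint
  must be. This is the bridge from skewness of Q for the bilinear pairing to anticommutation with
  \<kappa>.\<close>

lemma adjoint_real_pairing:
  assumes P: "complex_linear P" and \<kappa>: "\<And>x. \<kappa> (\<kappa> x) = x"
    and iso: "\<And>x y. b (\<kappa> x) (\<kappa> y) = cnj (b x y)"
  shows "adjoint_wrt (\<lambda>x y. b x (\<kappa> y)) P y = \<kappa> (adjoint_wrt b P (\<kappa> y))"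
proof -
  define R where "R = (\<lambda>y. \<kappa> (adjoint_wrt b P (\<kappa> y)))"
  have R: "\<forall>x y. b (P x) (\<kappa> y) = b x (\<kappa> (R y))" unfolding R_def by (simp add: \<kappa> adjoint[OF P])
  have "adjoint_wrt (\<lambda>x y. b x (\<kappa> y)) P = R"
    unfolding adjoint_wrt_def
  proof (rule the_equality[where P = "\<lambda>R. \<forall>x y. b (P x) (\<kappa> y) = b x (\<kappa> (R y))", OF R])
    show "R' = R" if "\<forall>x y. b (P x) (\<kappa> y) = b x (\<kappa> (R' y))" for R'
    proof
      fix y
      have "\<kappa> (R' y) = \<kappa> (R y)" by (rule eq_rightI) (metis R that)
      then show "R' y = R y" by (metis \<kappa>)
    qed
  qed
  then show ?thesis by (simp add: R_def)
qed

text \<open>Normality brings P (P x) = 0 into the norm of the adjoint applied to P x, so that vector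
  vanishes, and then P x is orthogonal to itself. Everything happens at the single vector x.\<close>

lemma normal_square_zero:
  assumes P: "complex_linear P" and normal: "P (adjoint_wrt b P (P x)) = adjoint_wrt b P (P (P x))"
    and sq: "P (P x) = 0"
  shows "P x = 0"
proof -
  let ?y = "adjoint_wrt b P (P x)"
  have "b ?y ?y = b (P x) (P ?y)" by (rule adjoint_right[OF P])
  also have "\<dots> = 0" unfolding normal sq complex_linear_zero[OF adjoint_linear[OF P]] by (rule zero_right)
  finally have "?y = 0" using self_eq_zero by blast
  then have "b (P x) (P x) = 0" by (simp add: adjoint[OF P] zero_right)
  then show ?thesis using self_eq_zero by blast
qed

end

text \<open>The form \<open>g x y = b x (\<kappa> y)\<close> is symmetric and \<open>Q\<close> is skew for it, hence trace free.\<close>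

lemma skew_square_scalar:
  fixes b :: "complex ^ 2 \<Rightarrow> complex ^ 2 \<Rightarrow> complex"
  assumes "hermitian_form b" and Q: "complex_linear Q" and \<kappa>: "complex_antilinear \<kappa>" "\<And>x. \<kappa> (\<kappa> x) = x"
    and iso: "\<And>x y. b (\<kappa> x) (\<kappa> y) = cnj (b x y)"
    and sa: "\<And>x y. b (Q x) y = b x (Q y)" and anti: "\<And>x. Q (\<kappa> x) = - \<kappa> (Q x)"
  shows "\<exists>\<mu>. \<forall>x. Q (Q x) = \<mu> *s x"
proof -
  interpret hermitian_form b by fact
  define g where "g x y = b x (\<kappa> y)" for x y
  have g_sym: "g x y = g y x" for x y
    unfolding g_def by (metis \<kappa>(2) iso hermitian)
  have g_add: "g (x + y) z = g x z + g y z" "g z (x + y) = g z x + g z y"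
    and g_scale: "g (a *s x) z = a * g x z" "g z (a *s x) = a * g z x" for a x y z
    by (simp_all add: g_def add_left add_right scale_left scale_right complex_antilinear_add[OF \<kappa>(1)]
        complex_antilinear_scale[OF \<kappa>(1)])
  have neg: "b x (- y) = - b x y" for x y using scale_right[of x "-1" y] by simp
  have g_skew: "g (Q x) y = - g x (Q y)" for x y
    unfolding g_def sa anti neg ..
  have g_isotropic: "g (Q x) x = 0" for x
    using g_skew[of x x] g_sym[of x "Q x"] by simp
  have g_nondeg: "x = 0" if "\<And>y. g x y = 0" for x
    by (rule eq_leftI) (metis that g_def \<kappa>(2) zero_left)
  define e1 e2 :: "complex ^ 2" where "e1 = axis 1 1" and "e2 = axis 2 1"
  have ex: "x = x $ 1 *s e1 + x $ 2 *s e2" for x :: "complex ^ 2"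
    unfolding e1_def e2_def by (rule complex_vec2_expand)
  define p q r where "p = g e1 e1" and "q = g e1 e2" and "r = g e2 e2"
  have q': "g e2 e1 = q" unfolding q_def by (rule g_sym)
  have comb: "x *s e1 + y *s e2 = 0 \<longleftrightarrow> x = 0 \<and> y = 0" for x y
    by (auto simp: e1_def e2_def vec_eq_iff forall_2 axis_def)
  have nd: "x = 0" if "g x e1 = 0" "g x e2 = 0" for x
  proof (rule g_nondeg)
    fix y show "g x y = 0" using that by (subst ex[of y]) (simp add: g_add g_scale)
  qed
  have det: "p * r - q * q \<noteq> 0"
  proof
    assume *: "p * r - q * q = 0"
    \<comment> \<open>If the Gram determinant vanished, the columns of the adjugate of the Gram
      matrix would, up to sign, be orthogonal to everything, hence zero.\<close>
    have "r *s e1 + (- q) *s e2 = 0"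
      by (rule nd; simp only: g_add g_scale q' p_def[symmetric] q_def[symmetric] r_def[symmetric])
        (use * in \<open>simp_all add: algebra_simps\<close>)
    moreover have "q *s e1 + (- p) *s e2 = 0"
      by (rule nd; simp only: g_add g_scale q' p_def[symmetric] q_def[symmetric] r_def[symmetric])
        (use * in \<open>simp_all add: algebra_simps\<close>)
    ultimately
    have "p = 0" "q = 0" "r = 0" using comb by (metis neg_equal_0_iff_equal)+
    then have "e1 = 0" by (intro nd) (simp_all add: p_def q_def)
    then show False by (simp add: e1_def axis_eq_0_iff)
  qed
  define a c d e where "a = Q e1 $ 1" and "c = Q e1 $ 2" and "d = Q e2 $ 1" and "e = Q e2 $ 2"
  have Q1: "Q e1 = a *s e1 + c *s e2" and Q2: "Q e2 = d *s e1 + e *s e2"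
    unfolding a_def c_def d_def e_def by (rule ex)+
  have 1: "a * p + c * q = 0" and 2: "d * q + e * r = 0" and 3: "a * q + c * r + d * p + e * q = 0"
    using g_isotropic[of e1] g_isotropic[of e2] g_skew[of e1 e2]
    by (simp_all add: Q1 Q2 g_add g_scale q' flip: p_def q_def r_def)
  \<comment> \<open>Trace times Gram determinant: weighting the three skewness equations by r, p and
    - q eliminates the off-diagonal entries c and d.\<close>
  have "(a + e) * (p * r - q * q) = (a * p + c * q) * r + (d * q + e * r) * p - (a * q + c * r + d * p + e * q) * q"
    by (simp add: algebra_simps)
  also have "\<dots> = 0" unfolding 1 2 3 by simp
  finally have e: "e = - a" using det by (simp add: add_eq_0_iff)
  \<comment> \<open>Cayley-Hamilton for a trace free matrix of size two; the scalar is minus its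
    determinant.\<close>
  have "Q (Q x) = (a * a + c * d) *s x" for x
  proof -
    have "Q (Q e1) = (a * a + c * d) *s e1" "Q (Q e2) = (a * a + c * d) *s e2"
      by (simp_all add: Q1 Q2 e complex_linear_add[OF Q] complex_linear_diff[OF Q] complex_linear_scale[OF Q])
        (simp_all add: vec_eq_iff algebra_simps)
    note sq = this
    have "Q (Q x) = x $ 1 *s Q (Q e1) + x $ 2 *s Q (Q e2)"
      by (subst ex[of x]) (simp only: complex_linear_add[OF Q] complex_linear_scale[OF Q])
    also have "\<dots> = (a * a + c * d) *s (x $ 1 *s e1 + x $ 2 *s e2)"
      unfolding sq by (simp add: vec_eq_iff algebra_simps)
    finally show ?thesis by (simp only: ex[of x, symmetric])
  qed
  then show ?thesis by blast
qed

text \<open>Q squared is scalar, so moving Q twice past P gives \<mu> P = \<mu> P - 2 P Q + P, that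
  is P Q = P / 2 and Q P = - P / 2. A nonzero value of P is thus an eigenvector for -1/2, which
  forces \<mu> = 1/4, and computing P Q P both ways gives P P = - P P.\<close>

lemma lowering_operator:
  fixes P Q :: "complex ^ 'n \<Rightarrow> complex ^ 'n"
  assumes P: "complex_linear P" and Q: "complex_linear Q"
    and comm: "\<And>x. P (Q x) - Q (P x) = P x" and sq: "\<And>x. Q (Q x) = \<mu> *s x" and ne: "P x \<noteq> 0"
  shows "\<mu> = 1 / 4" "Q (P x) = - (1 / 2) *s P x" "P (P x) = 0"
proof -
  have QP: "Q (P x) = P (Q x) - P x" for x using comm[of x] by (simp add: algebra_simps)
  have PQ: "P (Q x) = (1 / 2) *s P x" for x
  proof -
    have "Q (Q (P x)) = \<mu> *s P x - 2 *s P (Q x) + P x"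
      unfolding QP complex_linear_diff[OF Q] sq complex_linear_scale[OF P]
      by (simp add: vec_eq_iff)
    then have "2 *s P (Q x) = P x" unfolding sq by (simp add: algebra_simps)
    then show ?thesis by (metis (no_types) vector_smult_assoc divide_self_if mult.commute times_divide_eq_right
          vector_smult_lid zero_neq_numeral mult_1)
  qed
  have QP': "Q (P x) = - (1 / 2) *s P x" for x unfolding QP PQ by (simp add: vec_eq_iff)
  then show "Q (P x) = - (1 / 2) *s P x" .
  have "\<mu> *s P x = (1 / 4) *s P x"
    unfolding sq[symmetric] QP' complex_linear_scale[OF Q] by (simp add: vector_smult_assoc)
  then show "\<mu> = 1 / 4" using ne by (metis vec.scale_right_imp_eq)
  have "(1 / 2) *s P (P x) = - (1 / 2) *s P (P x)"
    using PQ[of "P x"] unfolding QP' complex_linear_scale[OF P] by simp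
  then show "P (P x) = 0" by (simp add: vec_eq_iff)
qed

section \<open>Coordinate changes\<close>

definition jacobi :: "('m, 'n::finite) chart \<Rightarrow> ('m, 'n) chart \<Rightarrow> 'm \<Rightarrow> complex ^ 'n \<Rightarrow> complex ^ 'n"
  where "jacobi c c' q = frechet_derivative (snd c' \<circ> chart_inv c) (at (snd c q))"

text \<open>The section with constant components \<open>v\<close> in the chart \<open>c\<close>.\<close>

definition coord_field :: "('m, 'n::finite) chart set \<Rightarrow> ('m, 'n) chart \<Rightarrow> complex ^ 'n \<Rightarrow> ('m, 'n) tsection"
  where "coord_field A c v q = jacobi c (chart_at A q) q v"

locale complex_atlas =
  fixes A :: "('m::{t2_space, second_countable_topology}, 'n::finite) chart set"
  assumes atlas: "complex_manifold A"
begin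

lemma chart_at: "chart_at A q \<in> A" "q \<in> fst (chart_at A q)"
proof -
  have "\<exists>c. c \<in> A \<and> q \<in> fst c" using atlas unfolding complex_manifold_def by blast
  from someI_ex[OF this] show "chart_at A q \<in> A" "q \<in> fst (chart_at A q)"
    unfolding chart_at_def by auto
qed

lemma chart_homeomorphism:
  assumes "c \<in> A"
  shows "open (fst c)" "open (snd c ` fst c)"
    "homeomorphism (fst c) (snd c ` fst c) (snd c) (chart_inv c)"
  using assms atlas unfolding complex_manifold_def by blast+

lemma chart_inv_left: "c \<in> A \<Longrightarrow> q \<in> fst c \<Longrightarrow> chart_inv c (snd c q) = q"
  using chart_homeomorphism(3)[of c] unfolding homeomorphism_def by auto

lemma open_chart_image:
  assumes "c \<in> A" "open V"
  shows "open (snd c ` (V \<inter> fst c))"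
proof -
  have "openin (top_of_set (fst c)) (V \<inter> fst c)" using assms(2) by (auto simp: openin_open)
  from homeomorphism_imp_open_map[OF chart_homeomorphism(3)[OF assms(1)] this]
  show ?thesis using chart_homeomorphism(2)[OF assms(1)] by (metis openin_open_eq)
qed

lemma open_chart_preimage:
  assumes "c \<in> A" "open Z"
  shows "open {q \<in> fst c. snd c q \<in> Z}"
proof -
  have "continuous_on (fst c) (snd c)"
    using chart_homeomorphism(3)[OF assms(1)] unfolding homeomorphism_def by auto
  from continuous_open_preimage[OF this chart_homeomorphism(1)[OF assms(1)] assms(2)]
  show ?thesis by (simp add: vimage_def Int_def)
qed

lemma transition_smooth:
  assumes "c \<in> A" "c' \<in> A"
  shows "smooth_on (snd c' \<circ> chart_inv c) (snd c ` (fst c \<inter> fst c'))"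
  using atlas assms unfolding complex_manifold_def holomorphic_map_on_def by blast

lemma transition_open: "c \<in> A \<Longrightarrow> c' \<in> A \<Longrightarrow> open (snd c ` (fst c \<inter> fst c'))"
  using open_chart_image[of c "fst c'"] chart_homeomorphism(1) by (simp add: Int_commute)

lemma transition_has_derivative:
  assumes "c \<in> A" "c' \<in> A" "q \<in> fst c" "q \<in> fst c'"
  shows "((snd c' \<circ> chart_inv c) has_derivative jacobi c c' q) (at (snd c q))"
  unfolding jacobi_def using assms by (intro smooth_on_has_derivative[OF transition_smooth]) auto

lemma jacobi_complex_linear:
  assumes "c \<in> A" "c' \<in> A" "q \<in> fst c" "q \<in> fst c'"
  shows "complex_linear (jacobi c c' q)"
  using assms atlas unfolding complex_manifold_def holomorphic_map_on_def jacobi_def by blast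

lemma jacobi_same:
  assumes "c \<in> A" "q \<in> fst c"
  shows "jacobi c c q = (\<lambda>v. v)"
proof -
  have "frechet_derivative (snd c \<circ> chart_inv c) (at (snd c q)) = frechet_derivative (\<lambda>z. z) (at (snd c q))"
    using assms chart_inv_left[OF assms(1)]
    by (intro frechet_derivative_cong_open[OF chart_homeomorphism(2)[OF assms(1)]]) auto
  then show ?thesis by (simp add: jacobi_def)
qed

text \<open>Chain rule on a common overlap. Together with \<open>jacobi_same\<close> it makes
  Jacobians invertible, which is why \<open>tangent_coord\<close> and \<open>coord_field\<close>
  undo each other.\<close>

lemma jacobi_cocycle:
  assumes "c \<in> A" "c' \<in> A" "c'' \<in> A" "q \<in> fst c" "q \<in> fst c'" "q \<in> fst c''"
  shows "jacobi c' c'' q (jacobi c c' q v) = jacobi c c'' q v"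
proof -
  have "((\<lambda>z. (snd c'' \<circ> chart_inv c') ((snd c' \<circ> chart_inv c) z)) has_derivative
      (\<lambda>v. jacobi c' c'' q (jacobi c c' q v))) (at (snd c q))"
    using transition_has_derivative[of c' c'' q] assms chart_inv_left
    by (intro has_derivative_compose[OF transition_has_derivative[of c c' q]]) (auto simp: comp_def)
  then have "((snd c'' \<circ> chart_inv c) has_derivative
      (\<lambda>v. jacobi c' c'' q (jacobi c c' q v))) (at (snd c q))"
    by (rule has_derivative_transform_within_open[OF _ transition_open[OF assms(1,2)]])
      (use assms(4,5) chart_inv_left[OF assms(1)] chart_inv_left[OF assms(2)] in auto)
  from has_derivative_unique[OF this transition_has_derivative[of c c'' q]] assms
  show ?thesis by metis
qed

lemma tangent_coord_eq: "tangent_coord A c q v = jacobi (chart_at A q) c q v"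
  by (simp add: tangent_coord_def jacobi_def)

lemma tangent_coord_complex_linear:
  "c \<in> A \<Longrightarrow> q \<in> fst c \<Longrightarrow> complex_linear (tangent_coord A c q)"
  unfolding tangent_coord_eq[abs_def] by (rule jacobi_complex_linear) (use chart_at in auto)

lemma tangent_coord_chart_at [simp]: "tangent_coord A (chart_at A q) q v = v"
  using jacobi_same[OF chart_at] by (simp add: tangent_coord_eq)

lemma jacobi_tangent_coord:
  assumes "c \<in> A" "c' \<in> A" "q \<in> fst c" "q \<in> fst c'"
  shows "jacobi c c' q (tangent_coord A c q v) = tangent_coord A c' q v"
  unfolding tangent_coord_eq using jacobi_cocycle chart_at assms by simp

lemma tangent_coord_coord_field:
  assumes "c \<in> A" "q \<in> fst c"
  shows "tangent_coord A c q (coord_field A c v q) = v"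
  using jacobi_cocycle[of c "chart_at A q" c q v] jacobi_same[of c q] chart_at assms
  by (simp add: tangent_coord_eq coord_field_def)

lemma coord_field_tangent_coord:
  assumes "c \<in> A" "q \<in> fst c"
  shows "coord_field A c (tangent_coord A c q v) q = v"
  using jacobi_cocycle[of "chart_at A q" c "chart_at A q" q v] jacobi_same[of "chart_at A q" q] chart_at assms
  by (simp add: tangent_coord_eq coord_field_def)

lemma coord_field_chart_at [simp]: "coord_field A (chart_at A q) v q = v"
  using jacobi_same[OF chart_at] by (simp add: coord_field_def)

lemma tangent_coord_inject:
  "c \<in> A \<Longrightarrow> q \<in> fst c \<Longrightarrow> tangent_coord A c q x = tangent_coord A c q y \<longleftrightarrow> x = y"
  using coord_field_tangent_coord by metis

lemma section_rep_chart: "c \<in> A \<Longrightarrow> q \<in> fst c \<Longrightarrow> section_rep A c X (snd c q) = tangent_coord A c q (X q)"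
  by (simp add: section_rep_def chart_inv_left)

lemma section_rep_change:
  assumes "c \<in> A" "c' \<in> A" "q \<in> fst c" "q \<in> fst c'"
  shows "section_rep A c' X (snd c' q) = jacobi c c' q (section_rep A c X (snd c q))"
  using assms by (simp add: section_rep_chart jacobi_tangent_coord)

section \<open>Smooth functions and sections\<close>

lemma transition_image:
  assumes "c \<in> A" "c' \<in> A" "V \<subseteq> fst c"
  shows "(\<lambda>z. (snd c \<circ> chart_inv c') z) ` (snd c' ` (V \<inter> fst c')) \<subseteq> snd c ` (V \<inter> fst c')"
  using chart_inv_left[OF assms(2)] by auto

lemma transition_smooth_on:
  assumes "c \<in> A" "c' \<in> A" "V \<subseteq> fst c"
  shows "smooth_on (\<lambda>z. (snd c \<circ> chart_inv c') z) (snd c' ` (V \<inter> fst c'))"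
  using smooth_on_subset[OF transition_smooth[OF assms(2,1)], of "snd c' ` (V \<inter> fst c')"] assms(3)
  by (auto simp: comp_def)

text \<open>\<open>smooth_section\<close> speaks of every chart, but one chart covering V decides:
  the components in another are the Jacobian of the transition map applied to the given ones,
  precomposed with the inverse transition.\<close>

lemma smooth_section_chartI:
  assumes "open V" "c \<in> A" "V \<subseteq> fst c" "smooth_on (section_rep A c X) (snd c ` V)"
  shows "smooth_section A V X"
  unfolding smooth_section_def
proof (intro ballI)
  fix c' assume c': "c' \<in> A"
  define T where "T = snd c' \<circ> chart_inv c"
  define Z where "Z = snd c ` (V \<inter> fst c')"
  have Z: "open Z" unfolding Z_def
    using open_chart_image[OF assms(2), of "V \<inter> fst c'"] assms(1,3) chart_homeomorphism(1)[OF c']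
    by (simp add: Int_absorb2 le_infI1 open_Int)
  have "smooth_on (\<lambda>y. frechet_derivative T (at y) (section_rep A c X y)) Z"
    unfolding T_def
    by (intro smooth_on_deriv_apply Z smooth_on_subset[OF transition_smooth[OF assms(2) c']]
        smooth_on_subset[OF assms(4)]) (use assms(3) Z_def in auto)
  then have "smooth_on (\<lambda>z. frechet_derivative T (at ((snd c \<circ> chart_inv c') z))
      (section_rep A c X ((snd c \<circ> chart_inv c') z))) (snd c' ` (V \<inter> fst c'))"
    by (rule smooth_on_compose[OF open_chart_image[OF c' assms(1)] Z, rotated])
      (use transition_image[OF assms(2) c' assms(3)] transition_smooth_on[OF assms(2) c' assms(3)] Z_def in auto)
  then show "smooth_on (section_rep A c' X) (snd c' ` (V \<inter> fst c'))"
  proof (rule smooth_on_cong[OF open_chart_image[OF c' assms(1)]])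
    fix z assume "z \<in> snd c' ` (V \<inter> fst c')"
    then obtain q where "q \<in> V" "q \<in> fst c'" "z = snd c' q" by auto
    then show "frechet_derivative T (at ((snd c \<circ> chart_inv c') z))
      (section_rep A c X ((snd c \<circ> chart_inv c') z)) = section_rep A c' X z"
      using section_rep_change[of c c' q X] assms(2,3) c' chart_inv_left[OF c', of q]
      by (auto simp: jacobi_def T_def)
  qed
qed

lemma smooth_fun_chartI:
  assumes "open V" "c \<in> A" "V \<subseteq> fst c" "smooth_on (f \<circ> chart_inv c) (snd c ` V)"
  shows "smooth_fun A V f"
  unfolding smooth_fun_def
proof (intro ballI)
  fix c' assume c': "c' \<in> A"
  define Z where "Z = snd c ` (V \<inter> fst c')"
  have Z: "open Z" unfolding Z_def
    using open_chart_image[OF assms(2), of "V \<inter> fst c'"] assms(1,3) chart_homeomorphism(1)[OF c']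
    by (simp add: Int_absorb2 le_infI1 open_Int)
  have "smooth_on (\<lambda>z. (f \<circ> chart_inv c) ((snd c \<circ> chart_inv c') z)) (snd c' ` (V \<inter> fst c'))"
    by (rule smooth_on_compose[OF open_chart_image[OF c' assms(1)] Z])
      (use transition_image[OF assms(2) c' assms(3)] transition_smooth_on[OF assms(2) c' assms(3)]
        smooth_on_subset[OF assms(4) image_mono[OF Int_lower1]] Z_def in \<open>auto simp: comp_def\<close>)
  then show "smooth_on (f \<circ> chart_inv c') (snd c' ` (V \<inter> fst c'))"
    by (rule smooth_on_cong[OF open_chart_image[OF c' assms(1)]])
      (use assms(3) chart_inv_left[OF c'] chart_inv_left[OF assms(2)] in auto)
qed

lemma smooth_sectionD: "smooth_section A V X \<Longrightarrow> c \<in> A \<Longrightarrow> smooth_on (section_rep A c X) (snd c ` (V \<inter> fst c))"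
  by (simp add: smooth_section_def)

lemma smooth_funD: "smooth_fun A V f \<Longrightarrow> c \<in> A \<Longrightarrow> smooth_on (f \<circ> chart_inv c) (snd c ` (V \<inter> fst c))"
  by (simp add: smooth_fun_def)

lemma smooth_section_subset: "smooth_section A V X \<Longrightarrow> W \<subseteq> V \<Longrightarrow> smooth_section A W X"
  unfolding smooth_section_def by (meson Int_mono image_mono smooth_on_subset subset_refl)

lemma smooth_section_cong:
  assumes "open V" "smooth_section A V X" "\<And>q. q \<in> V \<Longrightarrow> X q = Y q"
  shows "smooth_section A V Y"
  unfolding smooth_section_def
proof (intro ballI)
  fix c assume c: "c \<in> A"
  show "smooth_on (section_rep A c Y) (snd c ` (V \<inter> fst c))"
    by (rule smooth_on_cong[OF open_chart_image[OF c assms(1)] smooth_sectionD[OF assms(2) c]])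
      (use c assms(3) section_rep_chart[OF c] in auto)
qed

lemma smooth_fun_cong:
  assumes "open V" "smooth_fun A V f" "\<And>q. q \<in> V \<Longrightarrow> f q = g q"
  shows "smooth_fun A V g"
  unfolding smooth_fun_def
proof (intro ballI)
  fix c assume c: "c \<in> A"
  show "smooth_on (g \<circ> chart_inv c) (snd c ` (V \<inter> fst c))"
    by (rule smooth_on_cong[OF open_chart_image[OF c assms(1)] smooth_funD[OF assms(2) c]])
      (use c assms(3) chart_inv_left[OF c] in auto)
qed

lemma smooth_section_nearI: "open V \<Longrightarrow> q \<in> V \<Longrightarrow> smooth_section A V X \<Longrightarrow> smooth_section_near A q X"
  unfolding smooth_section_near_def by blast

lemma smooth_fun_nearI: "open V \<Longrightarrow> q \<in> V \<Longrightarrow> smooth_fun A V f \<Longrightarrow> smooth_fun_near A q f"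
  unfolding smooth_fun_near_def by blast

lemma smooth_fun_const: "smooth_fun A V (\<lambda>q. a)"
  unfolding smooth_fun_def comp_def by (simp add: smooth_on_const)

lemma smooth_fun_add: "open V \<Longrightarrow> smooth_fun A V f \<Longrightarrow> smooth_fun A V g \<Longrightarrow> smooth_fun A V (\<lambda>q. f q + g q)"
  unfolding smooth_fun_def comp_def by (auto intro!: smooth_on_add open_chart_image)

lemma smooth_fun_mult: "open V \<Longrightarrow> smooth_fun A V f \<Longrightarrow> smooth_fun A V g \<Longrightarrow> smooth_fun A V (\<lambda>q. f q * g q)"
  unfolding smooth_fun_def comp_def
  by (auto intro!: smooth_on_bounded_bilinear[OF bounded_bilinear_mult] open_chart_image)

lemma smooth_fun_diff: "open V \<Longrightarrow> smooth_fun A V f \<Longrightarrow> smooth_fun A V g \<Longrightarrow> smooth_fun A V (\<lambda>q. f q - g q)"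
  using smooth_fun_add[of V f "\<lambda>q. (-1) * g q"] smooth_fun_mult[of V "\<lambda>q. -1" g] smooth_fun_const
  by simp

lemma smooth_fun_divide:
  assumes "open V" "smooth_fun A V f" "smooth_fun A V g" "\<And>q. q \<in> V \<Longrightarrow> g q \<noteq> 0"
  shows "smooth_fun A V (\<lambda>q. f q / g q)"
proof -
  have "smooth_fun A V (\<lambda>q. inverse (g q))"
    unfolding smooth_fun_def comp_def
  proof (intro ballI)
    fix c assume c: "c \<in> A"
    show "smooth_on (\<lambda>z. inverse (g (chart_inv c z))) (snd c ` (V \<inter> fst c))"
      by (rule smooth_on_inverse[OF open_chart_image[OF c assms(1)]])
        (use smooth_funD[OF assms(3) c] assms(4) chart_inv_left[OF c] in \<open>auto simp: comp_def\<close>)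
  qed
  from smooth_fun_mult[OF assms(1,2) this] show ?thesis by (simp add: divide_inverse)
qed

lemma section_rep_add:
  "c \<in> A \<Longrightarrow> q \<in> fst c \<Longrightarrow>
    section_rep A c (\<lambda>q. X q + Y q) (snd c q) = section_rep A c X (snd c q) + section_rep A c Y (snd c q)"
  by (simp add: section_rep_chart complex_linear_add[OF tangent_coord_complex_linear])

lemma section_rep_scale:
  "c \<in> A \<Longrightarrow> q \<in> fst c \<Longrightarrow>
    section_rep A c (\<lambda>q. f q *s X q) (snd c q) = (f \<circ> chart_inv c) (snd c q) *s section_rep A c X (snd c q)"
  by (simp add: section_rep_chart chart_inv_left complex_linear_scale[OF tangent_coord_complex_linear])

lemma smooth_section_add:
  assumes "open V" "smooth_section A V X" "smooth_section A V Y"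
  shows "smooth_section A V (\<lambda>q. X q + Y q)"
  unfolding smooth_section_def
proof (intro ballI)
  fix c assume c: "c \<in> A"
  note o = open_chart_image[OF c assms(1)]
  show "smooth_on (section_rep A c (\<lambda>q. X q + Y q)) (snd c ` (V \<inter> fst c))"
    by (rule smooth_on_cong[OF o smooth_on_add[OF o smooth_sectionD[OF assms(2) c] smooth_sectionD[OF assms(3) c]]])
      (use c section_rep_add[OF c] in auto)
qed

lemma smooth_section_scale:
  assumes "open V" "smooth_fun A V f" "smooth_section A V X"
  shows "smooth_section A V (\<lambda>q. f q *s X q)"
  unfolding smooth_section_def
proof (intro ballI)
  fix c assume c: "c \<in> A"
  note o = open_chart_image[OF c assms(1)]
  show "smooth_on (section_rep A c (\<lambda>q. f q *s X q)) (snd c ` (V \<inter> fst c))"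
    by (rule smooth_on_cong[OF o smooth_on_bounded_bilinear[OF bounded_bilinear_vector_scalar o
        smooth_funD[OF assms(2) c] smooth_sectionD[OF assms(3) c]]])
      (use c section_rep_scale[OF c] in auto)
qed

lemma smooth_section_scale_const: "open V \<Longrightarrow> smooth_section A V X \<Longrightarrow> smooth_section A V (\<lambda>q. a *s X q)"
  by (rule smooth_section_scale[OF _ smooth_fun_const])

lemma section_rep_coord_field: "c \<in> A \<Longrightarrow> q \<in> fst c \<Longrightarrow> section_rep A c (coord_field A c v) (snd c q) = v"
  by (simp add: section_rep_chart tangent_coord_coord_field)

lemma smooth_coord_field:
  assumes "c \<in> A"
  shows "smooth_section A (fst c) (coord_field A c v)"
proof (rule smooth_section_chartI[OF chart_homeomorphism(1)[OF assms] assms])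
  show "smooth_on (section_rep A c (coord_field A c v)) (snd c ` fst c)"
    by (rule smooth_on_cong[OF chart_homeomorphism(2)[OF assms] smooth_on_const[of v]])
      (use section_rep_coord_field[OF assms] in auto)
qed simp

lemma smooth_section_near_chart:
  assumes "smooth_section_near A q X" "c \<in> A" "q \<in> fst c"
  obtains Z where "open Z" "snd c q \<in> Z" "Z \<subseteq> snd c ` fst c" "smooth_on (section_rep A c X) Z"
proof -
  obtain V where V: "open V" "q \<in> V" "smooth_section A V X"
    using assms(1) unfolding smooth_section_near_def by blast
  show thesis
    using that[OF open_chart_image[OF assms(2) V(1)]] V(2) assms(3) smooth_sectionD[OF V(3) assms(2)]
    by auto
qed

lemma smooth_fun_near_chart:
  assumes "smooth_fun_near A q f" "c \<in> A" "q \<in> fst c"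
  obtains Z where "open Z" "snd c q \<in> Z" "Z \<subseteq> snd c ` fst c" "smooth_on (f \<circ> chart_inv c) Z"
proof -
  obtain V where V: "open V" "q \<in> V" "smooth_fun A V f"
    using assms(1) unfolding smooth_fun_near_def by blast
  show thesis
    using that[OF open_chart_image[OF assms(2) V(1)]] V(2) assms(3) smooth_funD[OF V(3) assms(2)]
    by auto
qed

lemma section_rep_has_derivative:
  assumes "smooth_section_near A q X" "c \<in> A" "q \<in> fst c"
  shows "(section_rep A c X has_derivative frechet_derivative (section_rep A c X) (at (snd c q))) (at (snd c q))"
  using smooth_section_near_chart[OF assms] smooth_on_has_derivative by metis

lemma fun_rep_has_derivative:
  assumes "smooth_fun_near A q f" "c \<in> A" "q \<in> fst c"
  shows "((f \<circ> chart_inv c) has_derivative frechet_derivative (f \<circ> chart_inv c) (at (snd c q))) (at (snd c q))"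
  using smooth_fun_near_chart[OF assms] smooth_on_has_derivative by metis

section \<open>Derivatives in coordinates\<close>

text \<open>\<open>fun_deriv\<close> differentiates in the chart chosen at q. The chain rule moves
  this to a fixed chart, at the price of \<open>tangent_coord\<close> on the direction.\<close>

lemma fun_deriv_chartI:
  assumes "((f \<circ> chart_inv c) has_derivative d) (at (snd c q))" "c \<in> A" "q \<in> fst c"
  shows "fun_deriv A f q v = d (tangent_coord A c q v)"
proof -
  note c0 = chart_at[of q]
  have "((\<lambda>z. (f \<circ> chart_inv c) ((snd c \<circ> chart_inv (chart_at A q)) z)) has_derivative
      (\<lambda>v. d (jacobi (chart_at A q) c q v))) (at (snd (chart_at A q) q))"
    by (rule has_derivative_compose[OF transition_has_derivative[OF c0(1) assms(2) c0(2) assms(3)]])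
      (use assms(1) chart_inv_left[OF c0] in \<open>simp add: comp_def\<close>)
  then have "((f \<circ> chart_inv (chart_at A q)) has_derivative (\<lambda>v. d (jacobi (chart_at A q) c q v)))
      (at (snd (chart_at A q) q))"
    by (rule has_derivative_transform_within_open[OF _ transition_open[OF c0(1) assms(2)]])
      (use c0 assms(3) chart_inv_left[OF c0(1)] chart_inv_left[OF assms(2)] in auto)
  from frechet_derivativeI[OF this] show ?thesis
    unfolding fun_deriv_def tangent_coord_eq by simp
qed

lemma fun_deriv_chart:
  assumes "smooth_fun_near A q f" "c \<in> A" "q \<in> fst c"
  shows "fun_deriv A f q v = frechet_derivative (f \<circ> chart_inv c) (at (snd c q)) (tangent_coord A c q v)"
  by (rule fun_deriv_chartI[OF fun_rep_has_derivative[OF assms] assms(2,3)])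

lemma section_deriv_linear: "smooth_section_near A q X \<Longrightarrow> linear (section_deriv A X q)"
  using has_derivative_linear[OF section_rep_has_derivative[OF _ chart_at]]
  by (simp add: section_deriv_def[abs_def])

lemma fun_del_plus_delbar: "fun_del A f q v + fun_delbar A f q v = fun_deriv A f q v"
  by (simp add: fun_del_def fun_delbar_def field_simps)

lemma section_deriv_add:
  assumes "smooth_section_near A q X" "smooth_section_near A q Y"
  shows "section_deriv A (\<lambda>r. X r + Y r) q v = section_deriv A X q v + section_deriv A Y q v"
proof -
  let ?c = "chart_at A q"
  have "(section_rep A ?c (\<lambda>r. X r + Y r) has_derivative
      (\<lambda>v. frechet_derivative (section_rep A ?c X) (at (snd ?c q)) v
        + frechet_derivative (section_rep A ?c Y) (at (snd ?c q)) v)) (at (snd ?c q))"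
    by (rule has_derivative_transform_within_open[OF has_derivative_add[OF
          section_rep_has_derivative[OF assms(1) chart_at] section_rep_has_derivative[OF assms(2) chart_at]]
          chart_homeomorphism(2)[OF chart_at(1)]])
      (use chart_at section_rep_add[OF chart_at(1)] in auto)
  from frechet_derivativeI[OF this] show ?thesis by (simp add: section_deriv_def)
qed

lemma section_deriv_scale:
  assumes "smooth_fun_near A q f" "smooth_section_near A q X"
  shows "section_deriv A (\<lambda>r. f r *s X r) q v = fun_deriv A f q v *s X q + f q *s section_deriv A X q v"
proof -
  let ?c = "chart_at A q"
  have "(section_rep A ?c (\<lambda>r. f r *s X r) has_derivative
      (\<lambda>v. (f \<circ> chart_inv ?c) (snd ?c q) *s frechet_derivative (section_rep A ?c X) (at (snd ?c q)) v
        + frechet_derivative (f \<circ> chart_inv ?c) (at (snd ?c q)) v *s section_rep A ?c X (snd ?c q))) (at (snd ?c q))"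
    by (rule has_derivative_transform_within_open[OF bounded_bilinear.FDERIV[OF bounded_bilinear_vector_scalar
          fun_rep_has_derivative[OF assms(1) chart_at] section_rep_has_derivative[OF assms(2) chart_at]]
          chart_homeomorphism(2)[OF chart_at(1)]])
      (use chart_at section_rep_scale[OF chart_at(1)] in auto)
  from frechet_derivativeI[OF this] show ?thesis
    by (simp add: section_deriv_def fun_deriv_def chart_inv_left chart_at section_rep_chart)
qed

lemma section_deriv_cong:
  assumes "\<forall>\<^sub>F r in nhds q. X r = Y r"
  shows "section_deriv A X q v = section_deriv A Y q v"
proof -
  let ?c = "chart_at A q"
  obtain V where V: "open V" "q \<in> V" "\<And>r. r \<in> V \<Longrightarrow> X r = Y r"
    using assms unfolding eventually_nhds by blast
  have "frechet_derivative (section_rep A ?c X) (at (snd ?c q)) = frechet_derivative (section_rep A ?c Y) (at (snd ?c q))"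
    by (rule frechet_derivative_cong_open[OF open_chart_image[OF chart_at(1) V(1)]])
      (use V chart_at section_rep_chart[OF chart_at(1)] in auto)
  then show ?thesis by (simp add: section_deriv_def)
qed

lemma delbar_add:
  assumes "smooth_section_near A q X" "smooth_section_near A q Y"
  shows "delbar A (\<lambda>r. X r + Y r) q v = delbar A X q v + delbar A Y q v"
  unfolding delbar_def section_deriv_add[OF assms] by (simp add: vec_eq_iff algebra_simps)

lemma delbar_scale:
  assumes "smooth_fun_near A q f" "smooth_section_near A q X"
  shows "delbar A (\<lambda>r. f r *s X r) q v = fun_delbar A f q v *s X q + f q *s delbar A X q v"
  unfolding delbar_def fun_delbar_def section_deriv_scale[OF assms]
  by (simp add: vec_eq_iff field_simps)

lemma delbar_cong:
  "\<forall>\<^sub>F r in nhds q. X r = Y r \<Longrightarrow> delbar A X q v = delbar A Y q v"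
  unfolding delbar_def by (simp add: section_deriv_cong)

text \<open>\<open>section_deriv\<close> is only real linear in the direction. Replacing v by \<i> v
  multiplies d v + \<i> d (\<i> v) by - \<i>, and every complex scalar is a real combination of 1
  and \<i>.\<close>

lemma delbar_antilinear:
  assumes "smooth_section_near A q X"
  shows "complex_antilinear (delbar A X q)"
proof -
  note lin = section_deriv_linear[OF assms]
  have add: "delbar A X q (v + w) = delbar A X q v + delbar A X q w" for v w
    by (simp add: delbar_def linear_add[OF lin] vec_eq_iff algebra_simps)
  have real: "delbar A X q (complex_of_real r *s v) = complex_of_real r *s delbar A X q v" for r v
  proof -
    have comm: "\<i> *s (complex_of_real r *s v) = complex_of_real r *s (\<i> *s v)"
      by (simp only: vector_smult_assoc mult.commute)
    have lin': "section_deriv A X q (complex_of_real r *s u) = complex_of_real r *s section_deriv A X q u" for u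
      using linear_cmul[OF lin, of r u] by (simp add: scaleR_eq_vector_scalar)
    show ?thesis
      unfolding delbar_def comm lin' by (simp add: vec_eq_iff algebra_simps)
  qed
  have imag: "delbar A X q (\<i> *s v) = - (\<i> *s delbar A X q v)" for v
    by (simp add: delbar_def linear_neg[OF lin] vec_eq_iff algebra_simps)
  have "delbar A X q (a *s v) = cnj a *s delbar A X q v" for a v
  proof -
    have a: "a *s v = complex_of_real (Re a) *s v + complex_of_real (Im a) *s (\<i> *s v)"
      by (subst complex_eq[of a]) (simp add: vec_eq_iff algebra_simps)
    have "delbar A X q (a *s v) = complex_of_real (Re a) *s delbar A X q v
        + complex_of_real (Im a) *s - (\<i> *s delbar A X q v)"
      by (subst a) (simp only: add real imag)
    also have "\<dots> = (complex_of_real (Re a) - \<i> * complex_of_real (Im a)) *s delbar A X q v"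
      by (simp add: vec_eq_iff algebra_simps)
    also have "complex_of_real (Re a) - \<i> * complex_of_real (Im a) = cnj a" by (simp add: complex_eq_iff)
    finally show ?thesis .
  qed
  then show ?thesis using add unfolding complex_antilinear_def by blast
qed

text \<open>The Jacobian is complex linear at every point, hence so is its derivative in a fixed
  direction. Symmetry carries this from the vector acted on over to the direction of
  differentiation.\<close>

lemma transition_second_derivative_complex:
  assumes "c \<in> A" "c' \<in> A" "q \<in> fst c" "q \<in> fst c'"
  shows "frechet_derivative (\<lambda>z. frechet_derivative (snd c' \<circ> chart_inv c) (at z) x) (at (snd c q)) (\<i> *s w)
    = \<i> *s frechet_derivative (\<lambda>z. frechet_derivative (snd c' \<circ> chart_inv c) (at z) x) (at (snd c q)) w"
proof -
  define T where "T = snd c' \<circ> chart_inv c"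
  define S where "S = snd c ` (fst c \<inter> fst c')"
  define z where "z = snd c q"
  have S: "open S" "z \<in> S" and T: "smooth_on T S"
    unfolding S_def T_def z_def using transition_open transition_smooth assms by auto
  have sym: "frechet_derivative (\<lambda>z. frechet_derivative T (at z) u) (at z) v
    = frechet_derivative (\<lambda>z. frechet_derivative T (at z) v) (at z) u" for u v
    by (rule symmetric_second_derivative[OF S T])
  have "((\<lambda>z. \<i> *s frechet_derivative T (at z) w) has_derivative
      (\<lambda>v. \<i> *s frechet_derivative (\<lambda>z. frechet_derivative T (at z) w) (at z) v)) (at z)"
    by (rule bounded_linear.has_derivative[OF bounded_bilinear.bounded_linear_right[OF bounded_bilinear_vector_scalar]
          smooth_on_has_derivative[OF smooth_on_deriv[OF T] S(2)]])
  then have "((\<lambda>z. frechet_derivative T (at z) (\<i> *s w)) has_derivative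
      (\<lambda>v. \<i> *s frechet_derivative (\<lambda>z. frechet_derivative T (at z) w) (at z) v)) (at z)"
    by (rule has_derivative_transform_within_open[OF _ S])
      (use jacobi_complex_linear[OF assms(1,2)] in
        \<open>auto simp: S_def T_def jacobi_def complex_linear_scale\<close>)
  from frechet_derivativeI[OF this]
  have "frechet_derivative (\<lambda>z. frechet_derivative T (at z) (\<i> *s w)) (at z) x
    = \<i> *s frechet_derivative (\<lambda>z. frechet_derivative T (at z) w) (at z) x" by simp
  then show ?thesis using sym[of x w] sym[of x "\<i> *s w"] unfolding T_def z_def by simp
qed

text \<open>The components in the chart at q are the Jacobian times those in c, and both factors
  vary. The product rule adds a second derivative of the coordinate change, so
  \<open>section_deriv\<close> is not tensorial.\<close>

lemma section_deriv_chart: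
  assumes X: "smooth_section_near A q X" and c: "c \<in> A" "q \<in> fst c"
  shows "section_deriv A X q v =
    frechet_derivative (\<lambda>z. frechet_derivative (snd (chart_at A q) \<circ> chart_inv c) (at z)
      (section_rep A c X (snd c q))) (at (snd c q)) (tangent_coord A c q v)
    + jacobi c (chart_at A q) q
      (frechet_derivative (section_rep A c X) (at (snd c q)) (tangent_coord A c q v))"
proof -
  define c0 where "c0 = chart_at A q"
  define T where "T = snd c0 \<circ> chart_inv c"
  define S where "S = snd c ` (fst c \<inter> fst c0)"
  define D where "D = (\<lambda>v. frechet_derivative (\<lambda>z. frechet_derivative T (at z)
      (section_rep A c X (snd c q))) (at (snd c q)) v
    + frechet_derivative T (at (snd c q)) (frechet_derivative (section_rep A c X) (at (snd c q)) v))"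
  have c0: "c0 \<in> A" "q \<in> fst c0" unfolding c0_def by (rule chart_at)+
  have S: "open S" "snd c q \<in> S" and T: "smooth_on T S"
    unfolding S_def T_def using transition_open transition_smooth c c0 by auto
  have "((\<lambda>y. frechet_derivative T (at y) (section_rep A c X y)) has_derivative D) (at (snd c q))"
    unfolding D_def
    by (rule has_derivative_linear_apply[OF S smooth_on_linear_deriv[OF T]
          smooth_on_differentiable[OF smooth_on_deriv[OF T] S(2)] section_rep_has_derivative[OF X c]])
  then have "((\<lambda>y. frechet_derivative T (at y) (section_rep A c X y)) has_derivative D)
      (at ((snd c \<circ> chart_inv c0) (snd c0 q)))"
    using chart_inv_left[OF c0] by simp
  from has_derivative_compose[OF transition_has_derivative[OF c0(1) c(1) c0(2) c(2)] this]
  have "(section_rep A c0 X has_derivative (\<lambda>v. D (jacobi c0 c q v))) (at (snd c0 q))"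
  proof (rule has_derivative_transform_within_open[OF _ transition_open[OF c0(1) c(1)]])
    fix z assume "z \<in> snd c0 ` (fst c0 \<inter> fst c)"
    then obtain r where "r \<in> fst c0" "r \<in> fst c" "z = snd c0 r" by auto
    then show "frechet_derivative T (at ((snd c \<circ> chart_inv c0) z)) (section_rep A c X ((snd c \<circ> chart_inv c0) z))
      = section_rep A c0 X z"
      using section_rep_change[OF c(1) c0(1), of r X] chart_inv_left[OF c0(1)]
      by (simp add: T_def jacobi_def)
  qed (use c c0 in auto)
  from frechet_derivativeI[OF this] show ?thesis
    unfolding section_deriv_def c0_def[symmetric]
    by (simp add: D_def tangent_coord_eq jacobi_def T_def flip: c0_def)
qed

text \<open>The second derivatives of the coordinate change are complex linear in the direction, so they
  contribute nothing to \<open>delbar\<close>.\<close>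

lemma delbar_chart:
  fixes v :: "complex ^ 'n"
  assumes X: "smooth_section_near A q X" and c: "c \<in> A" "q \<in> fst c"
  defines "d \<equiv> frechet_derivative (section_rep A c X) (at (snd c q))"
    and "w \<equiv> tangent_coord A c q v"
  shows "tangent_coord A c q (delbar A X q v) = (1 / 2) *s (d w + \<i> *s d (\<i> *s w))"
proof -
  let ?J = "jacobi c (chart_at A q) q"
  define B where "B = frechet_derivative (\<lambda>z. frechet_derivative (snd (chart_at A q) \<circ> chart_inv c) (at z)
      (section_rep A c X (snd c q))) (at (snd c q))"
  have B: "B (\<i> *s w) = \<i> *s B w"
    unfolding B_def by (rule transition_second_derivative_complex[OF c(1) chart_at(1) c(2) chart_at(2)])
  note J = jacobi_complex_linear[OF c(1) chart_at(1) c(2) chart_at(2)]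
  have iw: "tangent_coord A c q (\<i> *s v) = \<i> *s w"
    unfolding w_def using complex_linear_scale[OF tangent_coord_complex_linear[OF c]] .
  have "section_deriv A X q v + \<i> *s section_deriv A X q (\<i> *s v)
      = (B w + ?J (d w)) + \<i> *s (\<i> *s B w + ?J (d (\<i> *s w)))"
    unfolding section_deriv_chart[OF X c] iw B_def[symmetric] B d_def[symmetric] w_def[symmetric] ..
  also have "\<dots> = ?J (d w + \<i> *s d (\<i> *s w))"
    by (simp add: complex_linear_add[OF J] complex_linear_scale[OF J] vec.scale_right_distrib)
  finally have "delbar A X q v = ?J ((1 / 2) *s (d w + \<i> *s d (\<i> *s w)))"
    unfolding delbar_def by (simp only: complex_linear_scale[OF J])
  then show ?thesis
    using jacobi_cocycle[of c "chart_at A q" c q] jacobi_same[OF c] c chart_at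
    by (simp add: tangent_coord_eq)
qed

lemma coord_field_near: "c \<in> A \<Longrightarrow> q \<in> fst c \<Longrightarrow> smooth_section_near A q (coord_field A c x)"
  by (rule smooth_section_nearI[OF chart_homeomorphism(1) _ smooth_coord_field])

lemma coord_field_chart_deriv:
  assumes "c \<in> A" "q \<in> fst c"
  shows "frechet_derivative (section_rep A c (coord_field A c x)) (at (snd c q)) v = 0"
proof -
  have "frechet_derivative (section_rep A c (coord_field A c x)) (at (snd c q))
    = frechet_derivative (\<lambda>z. x) (at (snd c q))"
    by (rule frechet_derivative_cong_open[OF chart_homeomorphism(2)[OF assms(1)]])
      (use assms section_rep_coord_field[OF assms(1)] in auto)
  then show ?thesis by simp
qed

lemma delbar_coord_field:
  assumes "c \<in> A" "q \<in> fst c"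
  shows "delbar A (coord_field A c x) q v = 0"
proof -
  have "tangent_coord A c q (delbar A (coord_field A c x) q v) = tangent_coord A c q 0"
    unfolding delbar_chart[OF coord_field_near[OF assms] assms]
    by (simp add: coord_field_chart_deriv[OF assms] complex_linear_zero[OF tangent_coord_complex_linear[OF assms]])
  then show ?thesis using tangent_coord_inject[OF assms] by blast
qed

lemma holomorphic_coord_field: "c \<in> A \<Longrightarrow> holomorphic_section A (fst c) (coord_field A c x)"
  unfolding holomorphic_section_def using smooth_coord_field delbar_coord_field by blast

text \<open>The bracket is computed in the chart at q, where these fields need not be constant. The
  derivatives of their components are second derivatives of the coordinate change, which cancel by
  symmetry.\<close>

lemma lie_bracket_coord_field:
  assumes "c \<in> A" "q \<in> fst c"
  shows "lie_bracket A (coord_field A c x) (coord_field A c y) q = 0"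
proof -
  have d: "section_deriv A (coord_field A c y) q (coord_field A c x q) =
    frechet_derivative (\<lambda>z. frechet_derivative (snd (chart_at A q) \<circ> chart_inv c) (at z) y) (at (snd c q)) x" for x y
    unfolding section_deriv_chart[OF coord_field_near[OF assms] assms]
    by (simp add: coord_field_chart_deriv[OF assms] section_rep_coord_field[OF assms]
        tangent_coord_coord_field[OF assms]
        complex_linear_zero[OF jacobi_complex_linear[OF assms(1) chart_at(1) assms(2) chart_at(2)]])
  show ?thesis
    unfolding lie_bracket_def d
    using symmetric_second_derivative[OF transition_open[OF assms(1) chart_at(1)] _
        transition_smooth[OF assms(1) chart_at(1)], of "snd c q" q] assms(2) chart_at(2)[of q]
    by auto
qed

text \<open>The definition of \<open>delbar\<close> uses a chart depending on the point, so its
  smoothness is not visible there. \<open>delbar_chart\<close> rewrites it in one fixed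
  chart.\<close>

lemma smooth_section_delbar:
  assumes V: "open V" and X: "smooth_section A V X" and \<eta>: "smooth_section A V \<eta>"
  shows "smooth_section A V (\<lambda>q. delbar A X q (\<eta> q))"
  unfolding smooth_section_def
proof (intro ballI)
  fix c assume c: "c \<in> A"
  define S where "S = snd c ` (V \<inter> fst c)"
  have S: "open S" unfolding S_def by (rule open_chart_image[OF c V])
  note smooth_intros = smooth_on_add[OF S] smooth_on_deriv_apply[OF S]
    smooth_on_bounded_linear[OF bounded_bilinear.bounded_linear_right[OF bounded_bilinear_vector_scalar] S]
    smooth_sectionD[OF X c, folded S_def] smooth_sectionD[OF \<eta> c, folded S_def]
  show "smooth_on (section_rep A c (\<lambda>q. delbar A X q (\<eta> q))) (snd c ` (V \<inter> fst c))"
    unfolding S_def[symmetric]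
  proof (rule smooth_on_cong[OF S])
    let ?d = "\<lambda>z. frechet_derivative (section_rep A c X) (at z)"
    let ?w = "section_rep A c \<eta>"
    show "smooth_on (\<lambda>z. (1 / 2) *s (?d z (?w z) + \<i> *s ?d z (\<i> *s ?w z))) S"
      by (intro smooth_intros)
    fix z assume "z \<in> S"
    then obtain q where q: "q \<in> V" "q \<in> fst c" "z = snd c q" unfolding S_def by auto
    then show "(1 / 2) *s (?d z (?w z) + \<i> *s ?d z (\<i> *s ?w z)) = section_rep A c (\<lambda>q. delbar A X q (\<eta> q)) z"
      using delbar_chart[OF smooth_section_nearI[OF V q(1) X] c q(2), of "\<eta> q"]
      by (simp add: section_rep_chart[OF c])
  qed
qed

lemma smooth_section_near_add:
  assumes "smooth_section_near A q X" "smooth_section_near A q Y"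
  shows "smooth_section_near A q (\<lambda>r. X r + Y r)"
proof -
  obtain V W where "open V" "q \<in> V" "smooth_section A V X" "open W" "q \<in> W" "smooth_section A W Y"
    using assms unfolding smooth_section_near_def by blast
  then show ?thesis
    by (intro smooth_section_nearI[of "V \<inter> W"] smooth_section_add) (auto intro: smooth_section_subset)
qed

lemma smooth_section_near_scale_const:
  "smooth_section_near A q X \<Longrightarrow> smooth_section_near A q (\<lambda>r. a *s X r)"
  unfolding smooth_section_near_def using smooth_section_scale_const by blast

lemma smooth_fun_near_const: "smooth_fun_near A q (\<lambda>r. a)"
  by (rule smooth_fun_nearI[OF open_UNIV UNIV_I smooth_fun_const])

lemma fun_deriv_const [simp]: "fun_deriv A (\<lambda>r. a) q v = 0"
  by (simp add: fun_deriv_def comp_def)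

lemma fun_del_const [simp]: "fun_del A (\<lambda>r. a) q v = 0"
  and fun_delbar_const [simp]: "fun_delbar A (\<lambda>r. a) q v = 0"
  by (simp_all add: fun_del_def fun_delbar_def)

lemma delbar_scale_const:
  "smooth_section_near A q X \<Longrightarrow> delbar A (\<lambda>r. a *s X r) q v = a *s delbar A X q v"
  by (simp add: delbar_scale[OF smooth_fun_near_const])

lemma holomorphic_section_subset: "holomorphic_section A V X \<Longrightarrow> W \<subseteq> V \<Longrightarrow> holomorphic_section A W X"
  unfolding holomorphic_section_def using smooth_section_subset by blast

lemma section_deriv_holomorphic:
  assumes X: "smooth_section_near A q X" and hol: "\<And>v. delbar A X q v = 0"
  shows "section_deriv A X q (a *s v) = a *s section_deriv A X q v"
proof -
  note lin = section_deriv_linear[OF X]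
  have imag: "section_deriv A X q (\<i> *s v) = \<i> *s section_deriv A X q v" for v
  proof -
    have "section_deriv A X q v + \<i> *s section_deriv A X q (\<i> *s v) = 0"
      using hol[of v] unfolding delbar_def vec.scale_eq_0_iff by simp
    then have "\<i> *s (section_deriv A X q v + \<i> *s section_deriv A X q (\<i> *s v)) = 0" by simp
    then show ?thesis by (simp add: vec.scale_right_distrib)
  qed
  have real: "section_deriv A X q (complex_of_real r *s u) = complex_of_real r *s section_deriv A X q u" for r u
    using linear_cmul[OF lin, of r u] by (simp add: scaleR_eq_vector_scalar)
  have split: "a *s x = complex_of_real (Re a) *s x + complex_of_real (Im a) *s (\<i> *s x)" for x :: "complex ^ 'n"
    by (subst complex_eq[of a]) (simp add: vec_eq_iff algebra_simps)
  show ?thesis unfolding split by (simp only: linear_add[OF lin] real imag)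
qed

text \<open>By the Cauchy-Riemann equations the derivatives are complex linear in the direction, so
  constants leave both slots without conjugation. The extraction of the mixed curvature rests on
  this.\<close>

lemma lie_bracket_holomorphic:
  assumes "smooth_section_near A q \<xi>" "\<And>v. delbar A \<xi> q v = 0"
    and "smooth_section_near A q \<eta>" "\<And>v. delbar A \<eta> q v = 0"
  shows "lie_bracket A (\<lambda>r. b *s \<xi> r) (\<lambda>r. a *s \<eta> r) q = (a * b) *s lie_bracket A \<xi> \<eta> q"
proof -
  have "section_deriv A (\<lambda>r. a *s X r) q v = a *s section_deriv A X q v" if "smooth_section_near A q X" for a X v
    by (simp add: section_deriv_scale[OF smooth_fun_near_const that])
  then show ?thesis
    unfolding lie_bracket_def
    by (simp add: assms section_deriv_holomorphic vec.scale_right_diff_distrib mult.commute)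
qed

end

section \<open>Coordinate frames in complex dimension two\<close>

locale complex_atlas_2 = complex_atlas A
  for A :: "('m::{t2_space, second_countable_topology}, 2) chart set"
begin

lemma coord_frame:
  assumes "c \<in> A" "open V" "V \<subseteq> fst c" "smooth_section A V X"
  obtains f g where "smooth_fun A V f" "smooth_fun A V g"
    "\<And>r. r \<in> V \<Longrightarrow> X r = f r *s coord_field A c (axis 1 1) r + g r *s coord_field A c (axis 2 1) r"
proof -
  define f where "f j r = tangent_coord A c r (X r) $ j" for j :: 2 and r
  have S: "open (snd c ` V)" using open_chart_image[OF assms(1,2)] assms(3) by (simp add: Int_absorb2)
  have X: "smooth_on (section_rep A c X) (snd c ` V)"
    using smooth_sectionD[OF assms(4,1)] assms(3) by (simp add: Int_absorb2)
  have "smooth_fun A V (f j)" for j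
  proof (rule smooth_fun_chartI[OF assms(2,1,3)])
    show "smooth_on (f j \<circ> chart_inv c) (snd c ` V)"
      by (rule smooth_on_cong[OF S smooth_on_bounded_linear[OF bounded_linear_vec_nth S X]])
        (simp add: f_def section_rep_def)
  qed
  moreover have "X r = f 1 r *s coord_field A c (axis 1 1) r + f 2 r *s coord_field A c (axis 2 1) r"
    if "r \<in> V" for r
  proof -
    have r: "r \<in> fst c" using that assms(3) by auto
    note J = jacobi_complex_linear[OF assms(1) chart_at(1) r chart_at(2)]
    have "X r = coord_field A c (tangent_coord A c r (X r)) r"
      using coord_field_tangent_coord[OF assms(1) r] by simp
    also have "\<dots> = coord_field A c (f 1 r *s axis 1 1 + f 2 r *s axis 2 1) r"
      by (subst complex_vec2_expand[of "tangent_coord A c r (X r)"]) (simp add: f_def)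
    also have "\<dots> = f 1 r *s coord_field A c (axis 1 1) r + f 2 r *s coord_field A c (axis 2 1) r"
      unfolding coord_field_def by (simp only: complex_linear_add[OF J] complex_linear_scale[OF J])
    finally show ?thesis .
  qed
  ultimately show thesis using that by blast
qed

lemma delbar_coord_frame:
  assumes "smooth_fun_near A q f" "smooth_fun_near A q g"
    and "smooth_section_near A q X" "\<And>v. delbar A X q v = 0"
    and "smooth_section_near A q Y" "\<And>v. delbar A Y q v = 0"
    and "smooth_section_near A q (\<lambda>r. f r *s X r)" "smooth_section_near A q (\<lambda>r. g r *s Y r)"
    and "\<forall>\<^sub>F r in nhds q. Z r = f r *s X r + g r *s Y r"
  shows "delbar A Z q v = fun_delbar A f q v *s X q + fun_delbar A g q v *s Y q"
  unfolding delbar_cong[OF assms(9)] delbar_add[OF assms(7,8)] delbar_scale[OF assms(1,3)] delbar_scale[OF assms(2,5)]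
  by (simp add: assms(4,6))

end

section \<open>Harmonic Higgs bundles\<close>

locale harmonic_higgs_2 = complex_atlas_2 A
  for A :: "('m::{t2_space, second_countable_topology}, 2) chart set" +
  fixes h :: "('m, 2) form_field" and D' :: "('m, 2) operator" and \<Phi> :: "('m, 2) end_form"
  assumes harmonic: "harmonic_higgs_bundle A h D' \<Phi>"
begin

abbreviation adj_higgs :: "('m, 2) end_form"
  where "adj_higgs q v \<equiv> adjoint_wrt (h q) (\<Phi> q v)"

lemma metric: "hermitian_metric A h" and chern: "chern_connection A h D'" and higgs: "higgs_field A \<Phi>"
  using harmonic unfolding harmonic_higgs_bundle_def by auto

lemma connection: "connection_10 A D'"
  using chern unfolding chern_connection_def by auto

sublocale h: hermitian_form "h q" for q
  using metric unfolding hermitian_metric_def by (intro hermitian_form.intro) blast+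

lemma smooth_metric:
  "open V \<Longrightarrow> smooth_section A V X \<Longrightarrow> smooth_section A V Y \<Longrightarrow> smooth_fun A V (\<lambda>q. h q (X q) (Y q))"
  using metric unfolding hermitian_metric_def by blast

lemma D_linear: "smooth_section_near A q X \<Longrightarrow> complex_linear (D' X q)"
  by (rule connection[unfolded connection_10_def, THEN conjunct1, rule_format])

lemma D_cong:
  "smooth_section_near A q X \<Longrightarrow> smooth_section_near A q Y \<Longrightarrow> (\<forall>\<^sub>F r in nhds q. X r = Y r) \<Longrightarrow> D' X q = D' Y q"
  by (rule connection[unfolded connection_10_def, THEN conjunct2, THEN conjunct1, rule_format])

lemma D_add:
  "smooth_section_near A q X \<Longrightarrow> smooth_section_near A q Y \<Longrightarrow> D' (\<lambda>r. X r + Y r) q v = D' X q v + D' Y q v"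
  by (rule connection[unfolded connection_10_def, THEN conjunct2, THEN conjunct2, THEN conjunct1, rule_format])

lemma D_scale:
  "smooth_fun_near A q f \<Longrightarrow> smooth_section_near A q X \<Longrightarrow>
    D' (\<lambda>r. f r *s X r) q v = fun_del A f q v *s X q + f q *s D' X q v"
  by (rule connection[unfolded connection_10_def, THEN conjunct2, THEN conjunct2, THEN conjunct2, THEN conjunct1, rule_format])

lemma D_scale_const: "smooth_section_near A q X \<Longrightarrow> D' (\<lambda>r. a *s X r) q v = a *s D' X q v"
  by (simp add: D_scale[OF smooth_fun_near_const])

lemma smooth_section_D:
  "open V \<Longrightarrow> smooth_section A V X \<Longrightarrow> smooth_section A V \<xi> \<Longrightarrow> smooth_section A V (\<lambda>q. D' X q (\<xi> q))"
  by (rule connection[unfolded connection_10_def, THEN conjunct2, THEN conjunct2, THEN conjunct2, THEN conjunct2, rule_format])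

lemma fun_del_metric:
  "smooth_section_near A q X \<Longrightarrow> smooth_section_near A q Y \<Longrightarrow>
    fun_del A (\<lambda>r. h r (X r) (Y r)) q v = h q (D' X q v) (Y q) + h q (X q) (delbar A Y q v)"
  and fun_delbar_metric:
  "smooth_section_near A q X \<Longrightarrow> smooth_section_near A q Y \<Longrightarrow>
    fun_delbar A (\<lambda>r. h r (X r) (Y r)) q v = h q (delbar A X q v) (Y q) + h q (X q) (D' Y q v)"
  using chern[unfolded chern_connection_def, THEN conjunct2, rule_format, of q X Y v] by simp_all

lemma higgs_linear: "complex_linear (\<Phi> q v)" and higgs_linear_direction: "complex_linear (\<lambda>v. \<Phi> q v x)"
  by (rule higgs[unfolded higgs_field_def, THEN conjunct1, rule_format],
      rule higgs[unfolded higgs_field_def, THEN conjunct2, THEN conjunct1, rule_format])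

lemma higgs_holomorphic:
  "open V \<Longrightarrow> holomorphic_section A V \<xi> \<Longrightarrow> holomorphic_section A V X \<Longrightarrow>
    holomorphic_section A V (\<lambda>q. \<Phi> q (\<xi> q) (X q))"
  by (rule higgs[unfolded higgs_field_def, THEN conjunct2, THEN conjunct2, THEN conjunct1, rule_format])

lemma adj_higgs_linear: "complex_linear (adj_higgs q v)"
  by (rule h.adjoint_linear[OF higgs_linear])

lemma adj_higgs_antilinear_direction: "complex_antilinear (\<lambda>v. adj_higgs q v x)"
proof -
  have "adj_higgs q (v + w) x = adj_higgs q v x + adj_higgs q w x" for v w
    by (rule h.eq_rightI[of q])
      (simp add: h.add_right complex_linear_add[OF higgs_linear_direction] h.add_left flip: h.adjoint[OF higgs_linear])
  moreover have "adj_higgs q (a *s v) x = cnj a *s adj_higgs q v x" for a v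
    by (rule h.eq_rightI[of q])
      (simp add: h.scale_right complex_linear_scale[OF higgs_linear_direction] h.scale_left flip: h.adjoint[OF higgs_linear])
  ultimately show ?thesis unfolding complex_antilinear_def by blast
qed

context
  fixes c :: "('m, 2) chart" and V :: "'m set"
  assumes c: "c \<in> A" and V: "open V" "V \<subseteq> fst c"
begin

lemma coord_field_hol: "holomorphic_section A V (coord_field A c x)"
  by (rule holomorphic_section_subset[OF holomorphic_coord_field[OF c] V(2)])

lemma hol_near:
  assumes "holomorphic_section A V X" "q \<in> V"
  shows "smooth_section_near A q X" "delbar A X q v = 0"
  using smooth_section_nearI[OF V(1) assms(2)] assms unfolding holomorphic_section_def by blast+

text \<open>\<Phi> is only known to preserve holomorphic sections. A smooth section is a smooth
  combination of the holomorphic coordinate frame; \<open>delbar\<close> differentiates only the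
  coefficients, and \<Phi> passes through these by linearity.\<close>

lemma smooth_higgs:
  assumes \<xi>: "holomorphic_section A V \<xi>" and X: "smooth_section A V X"
  shows "smooth_section A V (\<lambda>q. \<Phi> q (\<xi> q) (X q))"
    and "q \<in> V \<Longrightarrow> delbar A (\<lambda>q. \<Phi> q (\<xi> q) (X q)) q v = \<Phi> q (\<xi> q) (delbar A X q v)"
proof -
  define E1 E2 where "E1 = coord_field A c (axis 1 1)" and "E2 = coord_field A c (axis 2 1)"
  obtain f g where f: "smooth_fun A V f" and g: "smooth_fun A V g"
    and eq: "\<And>r. r \<in> V \<Longrightarrow> X r = f r *s E1 r + g r *s E2 r"
    using coord_frame[OF c V X] unfolding E1_def E2_def by blast
  have E: "holomorphic_section A V E1" "holomorphic_section A V E2"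
    unfolding E1_def E2_def by (rule coord_field_hol)+
  define F1 F2 where "F1 = (\<lambda>q. \<Phi> q (\<xi> q) (E1 q))" and "F2 = (\<lambda>q. \<Phi> q (\<xi> q) (E2 q))"
  have F: "holomorphic_section A V F1" "holomorphic_section A V F2"
    unfolding F1_def F2_def by (rule higgs_holomorphic[OF V(1) \<xi> E(1)] higgs_holomorphic[OF V(1) \<xi> E(2)])+
  have eq': "\<Phi> r (\<xi> r) (X r) = f r *s F1 r + g r *s F2 r" if "r \<in> V" for r
    unfolding eq[OF that] F1_def F2_def by (simp add: complex_linear_add[OF higgs_linear] complex_linear_scale[OF higgs_linear])
  have smooth: "smooth_section A V (\<lambda>r. f r *s Y r)" "smooth_section A V (\<lambda>r. g r *s Y r)"
    if "holomorphic_section A V Y" for Y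
    using smooth_section_scale[OF V(1) f] smooth_section_scale[OF V(1) g]
      that[unfolded holomorphic_section_def, THEN conjunct1] by blast+
  show "smooth_section A V (\<lambda>q. \<Phi> q (\<xi> q) (X q))"
    by (rule smooth_section_cong[OF V(1) smooth_section_add[OF V(1) smooth(1)[OF F(1)] smooth(2)[OF F(2)]]])
      (simp add: eq')
  assume q: "q \<in> V"
  have ev: "\<forall>\<^sub>F r in nhds q. r \<in> V" using V(1) q eventually_nhds by blast
  note near = smooth_section_nearI[OF V(1) q] smooth_fun_nearI[OF V(1) q]
  have frame: "delbar A Z q v = fun_delbar A f q v *s Y1 q + fun_delbar A g q v *s Y2 q"
    if "holomorphic_section A V Y1" "holomorphic_section A V Y2" "\<And>r. r \<in> V \<Longrightarrow> Z r = f r *s Y1 r + g r *s Y2 r"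
    for Y1 Y2 Z
    by (rule delbar_coord_frame[OF near(2)[OF f] near(2)[OF g] hol_near(1)[OF that(1) q] hol_near(2)[OF that(1) q]
          hol_near(1)[OF that(2) q] hol_near(2)[OF that(2) q] near(1)[OF smooth(1)[OF that(1)]]
          near(1)[OF smooth(2)[OF that(2)]] eventually_mono[OF ev that(3)]])
  have "delbar A X q v = fun_delbar A f q v *s E1 q + fun_delbar A g q v *s E2 q"
    by (rule frame[OF E eq])
  moreover have "delbar A (\<lambda>q. \<Phi> q (\<xi> q) (X q)) q v = fun_delbar A f q v *s F1 q + fun_delbar A g q v *s F2 q"
    by (rule frame[OF F eq'])
  ultimately show "delbar A (\<lambda>q. \<Phi> q (\<xi> q) (X q)) q v = \<Phi> q (\<xi> q) (delbar A X q v)"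
    by (simp add: F1_def F2_def complex_linear_add[OF higgs_linear] complex_linear_scale[OF higgs_linear])
qed

text \<open>By Cramer's rule for the Gram matrix of the coordinate frame.\<close>

lemma smooth_section_by_pairing:
  assumes "\<And>x. smooth_fun A V (\<lambda>q. h q (Y q) (coord_field A c x q))"
  shows "smooth_section A V Y"
proof -
  define E1 E2 where "E1 = coord_field A c (axis 1 1)" and "E2 = coord_field A c (axis 2 1)"
  have E: "smooth_section A V E1" "smooth_section A V E2"
    unfolding E1_def E2_def by (rule coord_field_hol[unfolded holomorphic_section_def, THEN conjunct1])+
  define b1 b2 where "b1 = (\<lambda>q. h q (Y q) (E1 q))" and "b2 = (\<lambda>q. h q (Y q) (E2 q))"
  have b: "smooth_fun A V b1" "smooth_fun A V b2"
    unfolding b1_def b2_def E1_def E2_def by (rule assms)+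
  define G11 G12 G21 G22 where "G11 = (\<lambda>q. h q (E1 q) (E1 q))" and "G12 = (\<lambda>q. h q (E1 q) (E2 q))"
    and "G21 = (\<lambda>q. h q (E2 q) (E1 q))" and "G22 = (\<lambda>q. h q (E2 q) (E2 q))"
  have G: "smooth_fun A V G11" "smooth_fun A V G12" "smooth_fun A V G21" "smooth_fun A V G22"
    unfolding G11_def G12_def G21_def G22_def by (intro smooth_metric V(1) E)+
  define d where "d = (\<lambda>q. G11 q * G22 q - G12 q * G21 q)"
  have span: "x = tangent_coord A c q x $ 1 *s E1 q + tangent_coord A c q x $ 2 *s E2 q" if "q \<in> V" for q x
  proof -
    have q: "q \<in> fst c" using that V(2) by auto
    note J = jacobi_complex_linear[OF c chart_at(1) q chart_at(2)]
    have "x = coord_field A c (tangent_coord A c q x) q" using coord_field_tangent_coord[OF c q] by simp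
    also have "\<dots> = tangent_coord A c q x $ 1 *s E1 q + tangent_coord A c q x $ 2 *s E2 q"
      by (subst complex_vec2_expand[of "tangent_coord A c q x"])
        (simp only: E1_def E2_def coord_field_def complex_linear_add[OF J] complex_linear_scale[OF J])
    finally show ?thesis .
  qed
  have zero: "x = 0" if "q \<in> V" "h q x (E1 q) = 0" "h q x (E2 q) = 0" for q x
  proof -
    have "h q x x = 0"
      by (subst (2) span[OF that(1)]) (simp add: h.add_right h.scale_right that(2,3))
    then show ?thesis using h.self_eq_zero by blast
  qed
  have E2_ne: "E2 q \<noteq> 0" if "q \<in> V" for q
  proof
    assume "E2 q = 0"
    moreover have q: "q \<in> fst c" using that V(2) by auto
    ultimately have "axis 2 1 = (0 :: complex ^ 2)"
      using tangent_coord_coord_field[OF c q, of "axis 2 1"] complex_linear_zero[OF tangent_coord_complex_linear[OF c q]]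
      by (simp add: E2_def)
    then show False by (simp add: axis_eq_0_iff)
  qed
  have d_ne: "d q \<noteq> 0" if q: "q \<in> V" for q
  proof
    assume "d q = 0"
    \<comment> \<open>With vanishing determinant this combination is orthogonal to both frame
      vectors. Independence of the frame then gives \<open>G22 q = 0\<close>, against
      positivity.\<close>
    then have "G22 q *s E1 q + (- G12 q) *s E2 q = 0"
      by (intro zero[OF q])
        (simp_all add: h.add_left h.diff_left h.scale_left d_def G11_def G12_def G21_def G22_def mult.commute)
    then have "tangent_coord A c q (G22 q *s E1 q + (- G12 q) *s E2 q) = tangent_coord A c q 0" by simp
    moreover have qc: "q \<in> fst c" using q V(2) by auto
    moreover note lin = tangent_coord_complex_linear[OF c qc]
    ultimately have "G22 q *s axis 1 1 + (- G12 q) *s axis 2 1 = (0 :: complex ^ 2)"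
      by (simp only: complex_linear_add[OF lin] complex_linear_scale[OF lin] complex_linear_zero[OF lin]
          E1_def E2_def tangent_coord_coord_field[OF c qc])
    then have "G22 q = 0" by (simp add: vec_eq_iff forall_2 axis_def)
    then show False using E2_ne[OF q] h.self_eq_zero by (simp add: G22_def)
  qed
  have cramer: "d q *s Y q = (b1 q * G22 q - b2 q * G21 q) *s E1 q + (b2 q * G11 q - b1 q * G12 q) *s E2 q"
    if q: "q \<in> V" for q
  proof -
    obtain y1 y2 where Y: "Y q = y1 *s E1 q + y2 *s E2 q" using span[OF q] by blast
    have "b1 q = y1 * G11 q + y2 * G21 q" "b2 q = y1 * G12 q + y2 * G22 q"
      by (simp_all add: b1_def b2_def Y h.add_left h.scale_left G11_def G12_def G21_def G22_def)
    then show ?thesis unfolding Y d_def by (simp add: vec_eq_iff algebra_simps)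
  qed
  have eq: "((b1 q * G22 q - b2 q * G21 q) / d q) *s E1 q + ((b2 q * G11 q - b1 q * G12 q) / d q) *s E2 q = Y q"
    if q: "q \<in> V" for q
  proof -
    have "Y q = inverse (d q) *s (d q *s Y q)" using d_ne[OF q] by (simp add: vector_smult_assoc)
    then show ?thesis unfolding cramer[OF q] by (simp add: vec_eq_iff divide_inverse algebra_simps)
  qed
  have d: "smooth_fun A V d"
    unfolding d_def by (intro smooth_fun_diff smooth_fun_mult V(1) G)
  show ?thesis
    by (rule smooth_section_cong[OF V(1) _ eq])
      (intro smooth_section_add smooth_section_scale smooth_fun_divide smooth_fun_diff smooth_fun_mult
        V(1) b G E d_ne d)
qed

end

text \<open>The adjoint is only described pointwise, so smoothness is read off from its pairings: on
  the other side of h it becomes \<Phi> acting on a coordinate field, a holomorphic section.\<close>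

lemma smooth_adj_higgs:
  assumes c: "c \<in> A" and V: "open V" "V \<subseteq> fst c"
    and \<eta>: "holomorphic_section A V \<eta>" and X: "smooth_section A V X"
  shows "smooth_section A V (\<lambda>q. adj_higgs q (\<eta> q) (X q))"
proof (rule smooth_section_by_pairing[OF c V])
  fix x
  have "holomorphic_section A V (\<lambda>q. \<Phi> q (\<eta> q) (coord_field A c x q))"
    by (rule higgs_holomorphic[OF V(1) \<eta> coord_field_hol[OF c V]])
  then have "smooth_fun A V (\<lambda>q. h q (X q) (\<Phi> q (\<eta> q) (coord_field A c x q)))"
    unfolding holomorphic_section_def by (intro smooth_metric V(1) X) blast
  then show "smooth_fun A V (\<lambda>q. h q (adj_higgs q (\<eta> q) (X q)) (coord_field A c x q))"
    by (simp only: h.adjoint_right[OF higgs_linear])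
qed

text \<open>The metric adjoint of the fact that \<open>delbar\<close> commutes with \<Phi>. The test
  field E and its image under \<Phi> are holomorphic, so metric compatibility loses its
  \<open>delbar\<close> term and the adjoint can be moved across \<open>D'\<close>.\<close>

lemma D_adj_higgs:
  assumes c: "c \<in> A" and V: "open V" "V \<subseteq> fst c"
    and \<eta>: "holomorphic_section A V \<eta>" and Y: "smooth_section A V Y" and q: "q \<in> V"
  shows "D' (\<lambda>r. adj_higgs r (\<eta> r) (Y r)) q v = adj_higgs q (\<eta> q) (D' Y q v)"
proof (rule h.eq_leftI[of q])
  fix x
  have qc: "q \<in> fst c" using q V(2) by auto
  define E where "E = coord_field A c (tangent_coord A c q x)"
  have E: "holomorphic_section A V E" unfolding E_def by (rule coord_field_hol[OF c V])
  have Eq: "E q = x" unfolding E_def by (rule coord_field_tangent_coord[OF c qc])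
  have F: "holomorphic_section A V (\<lambda>r. \<Phi> r (\<eta> r) (E r))" by (rule higgs_holomorphic[OF V(1) \<eta> E])
  note near = smooth_section_nearI[OF V(1) q]
  note hol_near = hol_near[OF c V]
  have "h q (D' (\<lambda>r. adj_higgs r (\<eta> r) (Y r)) q v) x
      = fun_del A (\<lambda>r. h r (adj_higgs r (\<eta> r) (Y r)) (E r)) q v"
    by (simp add: fun_del_metric[OF near[OF smooth_adj_higgs[OF c V \<eta> Y]] hol_near(1)[OF E q]]
        hol_near(2)[OF E q] h.zero_right Eq)
  also have "\<dots> = fun_del A (\<lambda>r. h r (Y r) (\<Phi> r (\<eta> r) (E r))) q v"
    by (simp only: h.adjoint_right[OF higgs_linear])
  also have "\<dots> = h q (D' Y q v) (\<Phi> q (\<eta> q) x)"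
    by (simp add: fun_del_metric[OF near[OF Y] hol_near(1)[OF F q]] hol_near(2)[OF F q] h.zero_right Eq)
  also have "\<dots> = h q (adj_higgs q (\<eta> q) (D' Y q v)) x"
    by (simp only: h.adjoint_right[OF higgs_linear])
  finally show "h q (D' (\<lambda>r. adj_higgs r (\<eta> r) (Y r)) q v) x = h q (adj_higgs q (\<eta> q) (D' Y q v)) x" .
qed

section \<open>The flat connection split by type, and its curvature of type (1,1)\<close>

definition higgs_10 :: "('m, 2) operator"
  where "higgs_10 X q v = D' X q v + \<Phi> q v (X q)"

definition higgs_01 :: "('m, 2) operator"
  where "higgs_01 X q v = delbar A X q v + adj_higgs q v (X q)"

definition higgs_conn :: "('m, 2) operator"
  where "higgs_conn X q v = D' X q v + delbar A X q v + \<Phi> q v (X q) + adj_higgs q v (X q)"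

lemma higgs_conn_eq: "higgs_conn X q v = higgs_10 X q v + higgs_01 X q v"
  by (simp add: higgs_conn_def higgs_10_def higgs_01_def)

lemma higgs_conn_flat: "flat_connection A higgs_conn"
  using harmonic unfolding harmonic_higgs_bundle_def higgs_conn_def[abs_def] by blast

lemma higgs_10_scale: "smooth_section_near A q X \<Longrightarrow> higgs_10 X q (a *s v) = a *s higgs_10 X q v"
  by (simp add: higgs_10_def complex_linear_scale[OF D_linear] complex_linear_scale[OF higgs_linear_direction]
      vec.scale_right_distrib)

lemma higgs_01_scale: "smooth_section_near A q X \<Longrightarrow> higgs_01 X q (a *s v) = cnj a *s higgs_01 X q v"
  by (simp add: higgs_01_def complex_antilinear_scale[OF delbar_antilinear]
      complex_antilinear_scale[OF adj_higgs_antilinear_direction] vec.scale_right_distrib)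

lemma higgs_conn_combination:
  assumes "smooth_section_near A q X" "smooth_section_near A q Y" "smooth_section_near A q Z"
    and "\<forall>\<^sub>F r in nhds q. Z r = a *s X r + b *s Y r"
  shows "higgs_conn Z q v = a *s higgs_conn X q v + b *s higgs_conn Y q v"
proof -
  note aX = smooth_section_near_scale_const[OF assms(1), of a]
  note bY = smooth_section_near_scale_const[OF assms(2), of b]
  have "D' Z q v = a *s D' X q v + b *s D' Y q v"
    by (simp add: D_cong[OF assms(3) smooth_section_near_add[OF aX bY] assms(4)] D_add[OF aX bY]
        D_scale_const assms(1,2))
  moreover have "delbar A Z q v = a *s delbar A X q v + b *s delbar A Y q v"
    by (simp add: delbar_cong[OF assms(4)] delbar_add[OF aX bY] delbar_scale_const assms(1,2))
  moreover have "Z q = a *s X q + b *s Y q" using eventually_nhds_x_imp_x[OF assms(4)] .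
  ultimately show ?thesis
    by (simp add: higgs_conn_def complex_linear_add[OF higgs_linear] complex_linear_scale[OF higgs_linear]
        complex_linear_add[OF adj_higgs_linear] complex_linear_scale[OF adj_higgs_linear] vec.scale_right_distrib)
qed

text \<open>The curvature of the flat connection at \<open>b \<xi>\<close>, \<open>a \<eta>\<close> splits into its four types, which scale
  by different characters of \<open>(a, b)\<close>; taking \<open>a, b \<in> {1, \<i>}\<close> isolates the mixed one.\<close>

lemma curvature_mixed_type:
  assumes c: "c \<in> A" and V: "open V" "V \<subseteq> fst c"
    and \<xi>: "holomorphic_section A V \<xi>" and \<eta>: "holomorphic_section A V \<eta>" and X: "smooth_section A V X"
    and q: "q \<in> V"
  shows "higgs_10 (\<lambda>r. higgs_01 X r (\<eta> r)) q (\<xi> q) = higgs_01 (\<lambda>r. higgs_10 X r (\<xi> r)) q (\<eta> q)"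
proof -
  note near = smooth_section_nearI[OF V(1)]
  have ev: "\<forall>\<^sub>F r in nhds q. r \<in> V" using V(1) q eventually_nhds by blast
  have s10: "smooth_section A V (\<lambda>r. higgs_10 X r (\<zeta> r))" and s01: "smooth_section A V (\<lambda>r. higgs_01 X r (\<zeta> r))"
    if "holomorphic_section A V \<zeta>" for \<zeta>
    using that unfolding higgs_10_def higgs_01_def holomorphic_section_def
    by (intro smooth_section_add smooth_section_D smooth_section_delbar smooth_higgs[OF c V that X]
        smooth_adj_higgs[OF c V that X] V(1) X; blast)+
  have scaled: "smooth_section A V (\<lambda>r. a *s \<zeta> r)" if "holomorphic_section A V \<zeta>" for a \<zeta>
    using that smooth_section_scale_const[OF V(1)] unfolding holomorphic_section_def by blast
  have pointwise: "higgs_conn X r (a *s v) = a *s higgs_10 X r v + cnj a *s higgs_01 X r v" if "r \<in> V" for r a v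
    using near[OF that X] by (simp add: higgs_conn_eq higgs_10_scale higgs_01_scale)
  define LL where "LL \<zeta> v = higgs_10 (\<lambda>r. higgs_10 X r (\<zeta> r)) q v" for \<zeta> v
  define LB where "LB \<zeta> v = higgs_10 (\<lambda>r. higgs_01 X r (\<zeta> r)) q v" for \<zeta> v
  define BL where "BL \<zeta> v = higgs_01 (\<lambda>r. higgs_10 X r (\<zeta> r)) q v" for \<zeta> v
  define BB where "BB \<zeta> v = higgs_01 (\<lambda>r. higgs_01 X r (\<zeta> r)) q v" for \<zeta> v
  have second: "higgs_conn (\<lambda>r. higgs_conn X r (a *s \<zeta> r)) q (b *s v)
      = a *s (b *s LL \<zeta> v + cnj b *s BL \<zeta> v) + cnj a *s (b *s LB \<zeta> v + cnj b *s BB \<zeta> v)"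
    if \<zeta>: "holomorphic_section A V \<zeta>" for a b \<zeta> v
  proof -
    have sm: "smooth_section A V (\<lambda>r. higgs_conn X r (a *s \<zeta> r))"
      by (rule smooth_section_cong[OF V(1) smooth_section_add[OF V(1) smooth_section_scale_const[OF V(1) s10[OF \<zeta>], of a]
            smooth_section_scale_const[OF V(1) s01[OF \<zeta>], of "cnj a"]]]) (simp add: pointwise)
    have "higgs_conn (\<lambda>r. higgs_conn X r (a *s \<zeta> r)) q (b *s v)
      = a *s higgs_conn (\<lambda>r. higgs_10 X r (\<zeta> r)) q (b *s v) + cnj a *s higgs_conn (\<lambda>r. higgs_01 X r (\<zeta> r)) q (b *s v)"
      by (rule higgs_conn_combination[OF near[OF q s10[OF \<zeta>]] near[OF q s01[OF \<zeta>]] near[OF q sm]])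
        (rule eventually_mono[OF ev], rule pointwise)
    then show ?thesis
      by (simp add: higgs_conn_eq higgs_10_scale higgs_01_scale near[OF q s10[OF \<zeta>]] near[OF q s01[OF \<zeta>]]
          LL_def LB_def BL_def BB_def)
  qed
  define l where "l = lie_bracket A \<xi> \<eta> q"
  have bracket: "lie_bracket A (\<lambda>r. b *s \<xi> r) (\<lambda>r. a *s \<eta> r) q = (a * b) *s l" for a b
    unfolding l_def by (rule lie_bracket_holomorphic) (rule hol_near[OF c V \<xi> q] hol_near[OF c V \<eta> q])+
  \<comment> \<open>The four types of curvature. For holomorphic fields the bracket scales by a * b,
    so its two parts join the types (2,0) and (0,2); the mixed types carry none.\<close>
  define \<alpha> where "\<alpha> = LL \<eta> (\<xi> q) - LL \<xi> (\<eta> q) - higgs_10 X q l"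
  define \<beta> where "\<beta> = LB \<eta> (\<xi> q) - BL \<xi> (\<eta> q)"
  define \<gamma> where "\<gamma> = BL \<eta> (\<xi> q) - LB \<xi> (\<eta> q)"
  define \<delta> where "\<delta> = BB \<eta> (\<xi> q) - BB \<xi> (\<eta> q) - higgs_01 X q l"
  have eq: "(a * b) *s \<alpha> + (cnj a * b) *s \<beta> + (a * cnj b) *s \<gamma> + (cnj a * cnj b) *s \<delta> = 0" for a b
  proof -
    have "higgs_conn (\<lambda>r. higgs_conn X r (a *s \<eta> r)) q (b *s \<xi> q)
        - higgs_conn (\<lambda>r. higgs_conn X r (b *s \<xi> r)) q (a *s \<eta> q)
        - higgs_conn X q (lie_bracket A (\<lambda>r. b *s \<xi> r) (\<lambda>r. a *s \<eta> r) q) = 0"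
      using higgs_conn_flat[unfolded flat_connection_def, rule_format, OF V(1) scaled[OF \<xi>] scaled[OF \<eta>] X q] .
    then show ?thesis
      unfolding second[OF \<xi>] second[OF \<eta>] bracket pointwise[OF q] \<alpha>_def \<beta>_def \<gamma>_def \<delta>_def
      by (simp add: vec_eq_iff algebra_simps)
  qed
  \<comment> \<open>The equation is used at (a, b) = (1, 1), (\<i>, \<i>), (\<i>, 1), (1, \<i>). The
    weights 1, 1, \<i>, - \<i> are the conjugates of the character \<open>cnj a * b\<close> there,
    so \<beta> is counted four times and the other types cancel.\<close>
  have "4 *s \<beta> = ((1 * 1) *s \<alpha> + (cnj 1 * 1) *s \<beta> + (1 * cnj 1) *s \<gamma> + (cnj 1 * cnj 1) *s \<delta>)
      + ((\<i> * \<i>) *s \<alpha> + (cnj \<i> * \<i>) *s \<beta> + (\<i> * cnj \<i>) *s \<gamma> + (cnj \<i> * cnj \<i>) *s \<delta>)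
      + \<i> *s ((\<i> * 1) *s \<alpha> + (cnj \<i> * 1) *s \<beta> + (\<i> * cnj 1) *s \<gamma> + (cnj \<i> * cnj 1) *s \<delta>)
      - \<i> *s ((1 * \<i>) *s \<alpha> + (cnj 1 * \<i>) *s \<beta> + (1 * cnj \<i>) *s \<gamma> + (cnj 1 * cnj \<i>) *s \<delta>)"
    by (simp add: vec_eq_iff algebra_simps)
  also have "\<dots> = 0" unfolding eq by simp
  finally have "\<beta> = 0" by (simp add: vec_eq_iff)
  then show ?thesis by (simp add: \<beta>_def LB_def BL_def)
qed

text \<open>Expanding the mixed curvature, the cross terms cancel because \<open>D'\<close> commutes
  with the adjoint of \<Phi> and \<open>delbar\<close> with \<Phi>. On \<xi> and the conjugate of
  \<eta>, the anticommutator of the two forms becomes a commutator of endomorphisms.\<close>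

lemma pluriharmonic:
  assumes c: "c \<in> A" and V: "open V" "V \<subseteq> fst c"
    and \<xi>: "holomorphic_section A V \<xi>" and \<eta>: "holomorphic_section A V \<eta>" and X: "smooth_section A V X"
    and q: "q \<in> V"
  shows "D' (\<lambda>r. delbar A X r (\<eta> r)) q (\<xi> q) - delbar A (\<lambda>r. D' X r (\<xi> r)) q (\<eta> q)
    = adj_higgs q (\<eta> q) (\<Phi> q (\<xi> q) (X q)) - \<Phi> q (\<xi> q) (adj_higgs q (\<eta> q) (X q))"
proof -
  note near = smooth_section_nearI[OF V(1) q]
  have sm: "smooth_section A V \<xi>" "smooth_section A V \<eta>" using \<xi> \<eta> unfolding holomorphic_section_def by blast+
  have "D' (\<lambda>r. delbar A X r (\<eta> r)) q (\<xi> q) + adj_higgs q (\<eta> q) (D' X q (\<xi> q))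
      + \<Phi> q (\<xi> q) (delbar A X q (\<eta> q) + adj_higgs q (\<eta> q) (X q))
    = delbar A (\<lambda>r. D' X r (\<xi> r)) q (\<eta> q) + \<Phi> q (\<xi> q) (delbar A X q (\<eta> q))
      + adj_higgs q (\<eta> q) (D' X q (\<xi> q) + \<Phi> q (\<xi> q) (X q))"
    using curvature_mixed_type[OF assms] unfolding higgs_10_def higgs_01_def
    by (simp only: D_add[OF near[OF smooth_section_delbar[OF V(1) X sm(2)]] near[OF smooth_adj_higgs[OF c V \<eta> X]]]
        delbar_add[OF near[OF smooth_section_D[OF V(1) X sm(1)]] near[OF smooth_higgs(1)[OF c V \<xi> X]]]
        D_adj_higgs[OF c V \<eta> X q] smooth_higgs(2)[OF c V \<xi> X q])
  then show ?thesis
    by (simp add: complex_linear_add[OF higgs_linear] complex_linear_add[OF adj_higgs_linear] algebra_simps)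
qed

lemma holomorphic_connection_if_higgs_vanishes:
  assumes "higgs_vanishes_on \<Phi> W"
  shows "holomorphic_connection_on A W D'"
  unfolding holomorphic_connection_on_def
proof (intro allI impI ballI)
  fix V \<xi> \<eta> X q
  assume V: "open V" "V \<subseteq> W" and \<xi>: "holomorphic_section A V \<xi>" and \<eta>: "holomorphic_section A V \<eta>"
    and X: "smooth_section A V X" and q: "q \<in> V"
  let ?c = "chart_at A q" and ?V = "V \<inter> fst (chart_at A q)"
  have \<Phi>: "\<Phi> q v x = 0" for v x using assms V(2) q unfolding higgs_vanishes_on_def by blast
  have "open ?V" "?V \<subseteq> fst ?c" "q \<in> ?V" "?V \<subseteq> V"
    using V(1) q chart_homeomorphism(1)[OF chart_at(1)] chart_at(2) by auto
  then have "D' (\<lambda>r. delbar A X r (\<eta> r)) q (\<xi> q) - delbar A (\<lambda>r. D' X r (\<xi> r)) q (\<eta> q)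
    = adj_higgs q (\<eta> q) (\<Phi> q (\<xi> q) (X q)) - \<Phi> q (\<xi> q) (adj_higgs q (\<eta> q) (X q))"
    by (intro pluriharmonic[OF chart_at(1)[of q], of ?V] holomorphic_section_subset[OF \<xi>] holomorphic_section_subset[OF \<eta>]
        smooth_section_subset[OF X])
  then show "D' (\<lambda>r. delbar A X r (\<eta> r)) q (\<xi> q) - delbar A (\<lambda>r. D' X r (\<xi> r)) q (\<eta> q) = 0"
    unfolding \<Phi> complex_linear_zero[OF adj_higgs_linear] by simp
qed

text \<open>The same coordinate field in both slots of \<open>pluriharmonic\<close> makes its
  right-hand side the commutator of \<Phi> q v with its own adjoint.\<close>

lemma higgs_normal_if_holomorphic_connection:
  assumes "holomorphic_connection_on A UNIV D'"
  shows "\<Phi> q v (adj_higgs q v x) = adj_higgs q v (\<Phi> q v x)"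
proof -
  let ?c = "chart_at A q"
  let ?v = "coord_field A ?c v" and ?x = "coord_field A ?c x"
  have V: "open (fst ?c)" by (rule chart_homeomorphism(1)[OF chart_at(1)])
  note hol = holomorphic_coord_field[OF chart_at(1)[of q]]
  have sm: "smooth_section A (fst ?c) ?x" by (rule smooth_coord_field[OF chart_at(1)])
  have "D' (\<lambda>r. delbar A ?x r (?v r)) q (?v q) - delbar A (\<lambda>r. D' ?x r (?v r)) q (?v q) = 0"
    using assms[unfolded holomorphic_connection_on_def, rule_format, OF V subset_UNIV hol hol sm chart_at(2)] .
  then show ?thesis
    using pluriharmonic[OF chart_at(1) V subset_refl hol hol sm chart_at(2), of v v] by simp
qed

end

section \<open>tt*-bundles of rank two\<close>

locale tt_bundle_2 = harmonic_higgs_2 A h D' \<Phi>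
  for A :: "('m::{t2_space, second_countable_topology}, 2) chart set"
    and h :: "('m, 2) form_field" and D' :: "('m, 2) operator" and \<Phi> :: "('m, 2) end_form" +
  fixes \<kappa> U Q :: "('m, 2) end_field"
  assumes tt: "tt_star_bundle A h D' \<Phi> \<kappa> U Q" and parallel_U: "parallel_end A D' U"
begin

lemma integrable: "integrable_harmonic_higgs_bundle A h D' \<Phi> U Q"
  and real_structure: "real_structure A h D' \<kappa>"
  and Q_skew: "adjoint_wrt (real_pairing h \<kappa> q) (Q q) x + Q q x = 0"
  using tt unfolding tt_star_bundle_def by auto

lemma U_linear: "complex_linear (U q)"
  and Q_linear: "complex_linear (Q q)" and Q_maps_smooth: "maps_smooth_sections A Q"
  and Q_adjoint: "adjoint_wrt (h q) (Q q) = Q q"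
  and D_U: "smooth_section_near A q X \<Longrightarrow>
    deriv_end D' U X q v - (\<Phi> q v (Q q (X q)) - Q q (\<Phi> q v (X q))) + \<Phi> q v (X q) = 0"
  and D_Q: "smooth_section_near A q X \<Longrightarrow>
    deriv_end D' Q X q v + (\<Phi> q v (adjoint_wrt (h q) (U q) (X q)) - adjoint_wrt (h q) (U q) (\<Phi> q v (X q))) = 0"
proof -
  note * = integrable[unfolded integrable_harmonic_higgs_bundle_def smooth_endomorphism_def]
  show "complex_linear (U q)" using * by blast
  show "complex_linear (Q q)" using * by blast
  show "maps_smooth_sections A Q" using * by blast
  show "adjoint_wrt (h q) (Q q) = Q q" using * by blast
  assume X: "smooth_section_near A q X"
  show "deriv_end D' U X q v - (\<Phi> q v (Q q (X q)) - Q q (\<Phi> q v (X q))) + \<Phi> q v (X q) = 0"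
    by (rule *[THEN conjunct2, THEN conjunct2, THEN conjunct2, THEN conjunct2, THEN conjunct2, THEN conjunct2,
          THEN conjunct1, rule_format, OF X])
  show "deriv_end D' Q X q v + (\<Phi> q v (adjoint_wrt (h q) (U q) (X q)) - adjoint_wrt (h q) (U q) (\<Phi> q v (X q))) = 0"
    by (rule *[THEN conjunct2, THEN conjunct2, THEN conjunct2, THEN conjunct2, THEN conjunct2, THEN conjunct2,
          THEN conjunct2, rule_format, OF X])
qed

lemma kappa_antilinear: "complex_antilinear (\<kappa> q)" and kappa_maps_smooth: "maps_smooth_sections A \<kappa>"
  and kappa_kappa: "\<kappa> q (\<kappa> q x) = x" and kappa_isometry: "h q (\<kappa> q x) (\<kappa> q y) = cnj (h q x y)"
  and kappa_parallel: "parallel_end A (\<lambda>X q v. D' X q v + delbar A X q v) \<kappa>"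
  using real_structure unfolding real_structure_def by blast+

lemma Q_selfadjoint: "h q (Q q x) y = h q x (Q q y)"
  by (metis h.adjoint Q_linear Q_adjoint)

text \<open>As Q equals its h-adjoint, its adjoint for the bilinear pairing is \<kappa> Q \<kappa>;
  skewness and \<kappa> \<kappa> = Id give the sign.\<close>

lemma Q_kappa: "Q q (\<kappa> q x) = - \<kappa> q (Q q x)"
proof -
  have "adjoint_wrt (real_pairing h \<kappa> q) (Q q) x = \<kappa> q (Q q (\<kappa> q x))"
    unfolding real_pairing_def[abs_def]
    by (subst h.adjoint_real_pairing[OF Q_linear kappa_kappa kappa_isometry]) (simp only: Q_adjoint)
  then have "\<kappa> q (Q q (\<kappa> q x)) = - Q q x" using Q_skew[of q x] by (simp add: eq_neg_iff_add_eq_0)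
  then have "Q q (\<kappa> q x) = \<kappa> q (- Q q x)" by (metis kappa_kappa)
  also have "\<dots> = - \<kappa> q (Q q x)"
    using complex_antilinear_scale[OF kappa_antilinear, of q "-1" "Q q x"] by simp
  finally show ?thesis .
qed

lemma kappa_zero: "\<kappa> q 0 = 0"
  by (rule complex_antilinear_zero[OF kappa_antilinear])

text \<open>The scalar of \<open>skew_square_scalar\<close>, chosen point by point. Its smoothness
  is recovered in \<open>smooth_Q_square\<close> from a quotient of pairings with a nowhere
  vanishing coordinate field.\<close>

definition Q_square :: "'m \<Rightarrow> complex"
  where "Q_square q = (SOME \<mu>. \<forall>x. Q q (Q q x) = \<mu> *s x)"

lemma Q_Q: "Q q (Q q x) = Q_square q *s x"
proof -
  have "\<exists>\<mu>. \<forall>x. Q q (Q q x) = \<mu> *s x"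
    by (rule skew_square_scalar[where b = "h q" and Q = "Q q" and \<kappa> = "\<kappa> q", OF h.hermitian_form_axioms Q_linear kappa_antilinear kappa_kappa
          kappa_isometry Q_selfadjoint Q_kappa])
  from someI_ex[OF this] have "\<forall>x. Q q (Q q x) = Q_square q *s x" unfolding Q_square_def .
  then show ?thesis by (rule spec)
qed

lemma eigenvalue_imp_Q_square:
  assumes "is_eigenvalue (Q q) a"
  shows "Q_square q = a * a"
proof -
  obtain x where x: "x \<noteq> 0" "Q q x = a *s x" using assms unfolding is_eigenvalue_def by blast
  have "Q_square q *s x = (a * a) *s x"
    unfolding Q_Q[symmetric] x(2) complex_linear_scale[OF Q_linear] by (simp add: vector_smult_assoc)
  then show ?thesis using x(1) by (metis vec.scale_right_imp_eq)
qed

text \<open>Since (Q - a) (Q + a) = 0, a nonzero value of Q + a is an eigenvector for a; if Q + a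
  vanishes identically, every nonzero vector is one for - a.\<close>

lemma Q_square_imp_eigenvalue:
  assumes "Q_square q = a * a"
  shows "is_eigenvalue (Q q) a \<or> is_eigenvalue (Q q) (- a)"
proof (cases "\<forall>x. Q q x = - a *s x")
  case True
  then show ?thesis unfolding is_eigenvalue_def by (metis axis_eq_0_iff zero_neq_one)
next
  case False
  then obtain x where "Q q x \<noteq> - a *s x" by blast
  then have "Q q x + a *s x \<noteq> 0" by (simp add: add_eq_0_iff2)
  moreover have "Q q (Q q x + a *s x) = a *s (Q q x + a *s x)"
    by (simp add: complex_linear_add[OF Q_linear] complex_linear_scale[OF Q_linear] Q_Q assms vec_eq_iff algebra_simps)
  ultimately show ?thesis unfolding is_eigenvalue_def by blast
qed

lemma smooth_section_Q: "open V \<Longrightarrow> smooth_section A V X \<Longrightarrow> smooth_section A V (\<lambda>q. Q q (X q))"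
  using Q_maps_smooth unfolding maps_smooth_sections_def by blast

lemma smooth_section_near_Q: "smooth_section_near A q X \<Longrightarrow> smooth_section_near A q (\<lambda>q. Q q (X q))"
  unfolding smooth_section_near_def using smooth_section_Q by blast

lemma coord_field_nonzero:
  assumes "c \<in> A" "q \<in> fst c" "x \<noteq> 0"
  shows "coord_field A c x q \<noteq> 0"
  by (metis assms tangent_coord_coord_field complex_linear_zero tangent_coord_complex_linear)

lemma smooth_Q_square:
  assumes "c \<in> A"
  shows "smooth_fun A (fst c) Q_square"
proof -
  note V = chart_homeomorphism(1)[OF assms]
  let ?E = "coord_field A c (axis 1 1)"
  note E = smooth_coord_field[OF assms, of "axis 1 1"]
  have E_ne: "h q (?E q) (?E q) \<noteq> 0" if "q \<in> fst c" for q
    using coord_field_nonzero[OF assms that, of "axis 1 1"] h.self_eq_zero by (simp add: axis_eq_0_iff)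
  have "smooth_fun A (fst c) (\<lambda>q. h q (Q q (Q q (?E q))) (?E q) / h q (?E q) (?E q))"
    by (intro smooth_fun_divide smooth_metric smooth_section_Q V E E_ne)
  then show ?thesis
    by (rule smooth_fun_cong[OF V]) (simp add: Q_Q h.scale_left E_ne)
qed

lemma higgs_commutator: "\<Phi> q v (Q q x) - Q q (\<Phi> q v x) = \<Phi> q v x"
proof -
  let ?X = "coord_field A (chart_at A q) x"
  have X: "smooth_section_near A q ?X" by (rule coord_field_near[OF chart_at])
  have "deriv_end D' U ?X q v = 0" using parallel_U X unfolding parallel_end_def by blast
  then show ?thesis using D_U[OF X, of v] by (simp add: algebra_simps)
qed

lemma higgs_nonzero:
  assumes "\<Phi> q v x \<noteq> 0"
  shows "Q_square q = 1 / 4" "\<Phi> q v (\<Phi> q v x) = 0"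
  using lowering_operator[OF higgs_linear Q_linear higgs_commutator Q_Q assms] by auto

lemma higgs_vanishes_near:
  assumes "\<not> is_eigenvalue (Q p) (1 / 2)" "\<not> is_eigenvalue (Q p) (- 1 / 2)"
  shows "\<exists>V. open V \<and> p \<in> V \<and> higgs_vanishes_on \<Phi> V"
proof -
  let ?c = "chart_at A p"
  define Z where "Z = snd ?c ` fst ?c \<inter> (Q_square \<circ> chart_inv ?c) -` (- {1 / 4})"
  have "smooth_on (Q_square \<circ> chart_inv ?c) (snd ?c ` fst ?c)"
    using smooth_funD[OF smooth_Q_square[OF chart_at(1)] chart_at(1), of p p] by simp
  then have "open Z" unfolding Z_def
    by (intro continuous_open_preimage smooth_on_continuous chart_homeomorphism(2)[OF chart_at(1)]) auto
  then have "open {q \<in> fst ?c. snd ?c q \<in> Z}" by (rule open_chart_preimage[OF chart_at(1)])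
  moreover have "Q_square p \<noteq> 1 / 4" using Q_square_imp_eigenvalue[of p "1 / 2"] assms by auto
  then have "p \<in> {q \<in> fst ?c. snd ?c q \<in> Z}" using chart_at[of p] chart_inv_left[OF chart_at] by (simp add: Z_def)
  moreover have "\<Phi> q v x = 0" if "q \<in> {q \<in> fst ?c. snd ?c q \<in> Z}" for q v x
    using higgs_nonzero(1)[of q v x] that chart_inv_left[OF chart_at(1)[of p], of q] by (auto simp: Z_def)
  ultimately show ?thesis unfolding higgs_vanishes_on_def by blast
qed

lemma higgs_vanishes_if_holomorphic_connection:
  assumes "holomorphic_connection_on A UNIV D'"
  shows "\<Phi> q v x = 0"
proof (cases "\<Phi> q v x = 0")
  case False
  show ?thesis
    by (rule h.normal_square_zero[OF higgs_linear higgs_normal_if_holomorphic_connection[OF assms]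
          higgs_nonzero(2)[OF False]])
qed

lemma eigenvectors_frame:
  assumes x: "x \<noteq> 0" "Q q x = (1 / 2) *s x" and y: "y \<noteq> 0" "Q q y = - (1 / 2) *s y"
  shows "x \<noteq> y" "vec.independent {x, y}" "vec.span {x, y} = UNIV"
proof -
  have no: "x \<noteq> k *s y" for k
  proof
    assume eq: "x = k *s y"
    have "(1 / 2) *s x = - (1 / 2) *s (k *s y)"
      unfolding x(2)[symmetric] by (simp add: eq complex_linear_scale[OF Q_linear] y(2) vector_smult_assoc)
    then have "(1 / 2) *s x = - (1 / 2) *s x" using eq by simp
    then show False using x(1) by (simp add: vec_eq_iff)
  qed
  then show ne: "x \<noteq> y" using vector_smult_lid[of y] by metis
  show ind: "vec.independent {x, y}"
    using no y(1) ne by (auto simp: vec.independent_insert vec.span_singleton)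
  have "UNIV \<subseteq> vec.span {x, y}"
    by (rule vec.card_ge_dim_independent[OF subset_UNIV ind]) (simp only: vec_dim_card, simp add: ne)
  then show "vec.span {x, y} = UNIV" by blast
qed

lemma kappa_eigenvector:
  assumes "x \<noteq> 0" "Q q x = (1 / 2) *s x"
  shows "\<kappa> q x \<noteq> 0" "Q q (\<kappa> q x) = - (1 / 2) *s \<kappa> q x"
  using assms kappa_kappa[of q x] kappa_zero
  by (auto simp: Q_kappa complex_antilinear_scale[OF kappa_antilinear])

text \<open>Subtracting from y its projection to x leaves an eigenvector z for 1/2, orthogonal to x
  and, by self-adjointness of Q, to \<kappa> x, which has eigenvalue -1/2. As x and \<kappa> x span,
  z = 0.\<close>

lemma eigenline:
  assumes x: "x \<noteq> 0" "Q q x = (1 / 2) *s x" and y: "Q q y = (1 / 2) *s y"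
  shows "y = (h q y x / h q x x) *s x"
proof -
  define z where "z = y - (h q y x / h q x x) *s x"
  have zx: "h q z x = 0"
    using x(1) h.self_eq_zero by (simp add: z_def h.diff_left h.scale_left)
  have Qz: "Q q z = (1 / 2) *s z"
    by (simp add: z_def complex_linear_diff[OF Q_linear] complex_linear_scale[OF Q_linear] x y
        vec.scale_right_diff_distrib vector_smult_assoc mult.commute)
  note k = kappa_eigenvector[OF x]
  have "(1 / 2) * h q z (\<kappa> q x) = - (1 / 2) * h q z (\<kappa> q x)"
    using Q_selfadjoint[of q z "\<kappa> q x"] unfolding Qz k(2) h.scale_left h.scale_right by simp
  then have zk: "h q z (\<kappa> q x) = 0" by simp
  have "z \<in> vec.span {x, \<kappa> q x}" using eigenvectors_frame(3)[OF x k] by simp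
  then obtain a b where ab: "z - a *s x = b *s \<kappa> q x"
    by (auto simp: vec.span_breakdown_eq[of _ x] vec.span_singleton)
  have "h q z z = h q z (a *s x + b *s \<kappa> q x)" using ab by (metis add.commute diff_add_cancel)
  then have "h q z z = 0" by (simp add: h.add_right h.scale_right zx zk)
  then show ?thesis using h.self_eq_zero by (simp add: z_def)
qed

section \<open>The Chern connection along real tangent vectors\<close>

definition nabla :: "('m, 2) operator"
  where "nabla X q v = D' X q v + delbar A X q v"

lemma nabla_cong:
  assumes "smooth_section_near A q X" "smooth_section_near A q Y" "\<forall>\<^sub>F r in nhds q. X r = Y r"
  shows "nabla X q v = nabla Y q v"
  unfolding nabla_def D_cong[OF assms] delbar_cong[OF assms(3)] ..

lemma nabla_scale:
  assumes "smooth_fun_near A q f" "smooth_section_near A q X"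
  shows "nabla (\<lambda>r. f r *s X r) q v = fun_deriv A f q v *s X q + f q *s nabla X q v"
  unfolding nabla_def D_scale[OF assms] delbar_scale[OF assms] fun_del_plus_delbar[of f q v, symmetric]
  by (simp add: vec_eq_iff algebra_simps)

lemma nabla_linear:
  assumes "smooth_section_near A q X"
  shows "linear (nabla X q)"
proof -
  note D = complex_linear_imp_linear[OF D_linear[OF assms]] and d = delbar_antilinear[OF assms]
  have "delbar A X q (r *\<^sub>R v) = r *\<^sub>R delbar A X q v" for r v
    by (simp add: scaleR_eq_vector_scalar complex_antilinear_scale[OF d])
  then show ?thesis unfolding nabla_def[abs_def]
    by (intro linearI) (simp_all add: linear_add[OF D] linear_cmul[OF D] complex_antilinear_add[OF d] scaleR_add_right)
qed

lemma smooth_section_nabla: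
  "open V \<Longrightarrow> smooth_section A V X \<Longrightarrow> smooth_section A V \<xi> \<Longrightarrow> smooth_section A V (\<lambda>q. nabla X q (\<xi> q))"
  unfolding nabla_def by (intro smooth_section_add smooth_section_D smooth_section_delbar)

text \<open>The values on v and \<i> v separate the part linear in the direction from the antilinear
  one. This is how flatness for the sum yields both \<open>D'\<close>-flatness and holomorphy of the
  frame.\<close>

lemma nabla_zero_types:
  assumes X: "smooth_section_near A q X" and zero: "\<And>v. nabla X q v = 0"
  shows "D' X q v = 0" "delbar A X q v = 0"
proof -
  have 1: "D' X q v + delbar A X q v = 0" using zero[of v] by (simp add: nabla_def)
  have "D' X q (\<i> *s v) + delbar A X q (\<i> *s v) = 0" using zero[of "\<i> *s v"] by (simp add: nabla_def)
  then have "\<i> *s (D' X q v - delbar A X q v) = 0"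
    by (simp add: complex_linear_scale[OF D_linear[OF X]] complex_antilinear_scale[OF delbar_antilinear[OF X]]
        vec.scale_right_diff_distrib)
  then have "D' X q v = delbar A X q v" by simp
  then show "delbar A X q v = 0" "D' X q v = 0" using 1 by (simp_all add: vec_eq_iff)
qed

lemma nabla_kappa:
  assumes "smooth_section_near A q X"
  shows "nabla (\<lambda>r. \<kappa> r (X r)) q v = \<kappa> q (nabla X q v)"
  using kappa_parallel assms unfolding parallel_end_def deriv_end_def nabla_def by simp

section \<open>Vanishing Higgs field: parallel Q and flat eigensections\<close>

context
  assumes higgs_zero: "\<And>q v x. \<Phi> q v x = 0"
begin

lemma D_Q_commute:
  assumes "smooth_section_near A q X"
  shows "D' (\<lambda>r. Q r (X r)) q v = Q q (D' X q v)"
  using D_Q[OF assms, of v] complex_linear_zero[OF h.adjoint_linear[OF U_linear]]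
  by (simp add: deriv_end_def higgs_zero)

text \<open>Q is its own h-adjoint, so metric compatibility converts commutation with
  \<open>D'\<close> into commutation with \<open>delbar\<close>. The field Y realises the test
  vector x at q.\<close>

lemma delbar_Q_commute:
  assumes X: "smooth_section_near A q X"
  shows "delbar A (\<lambda>r. Q r (X r)) q v = Q q (delbar A X q v)"
proof (rule h.eq_leftI[of q])
  fix x
  define Y where "Y = coord_field A (chart_at A q) x"
  have Y: "smooth_section_near A q Y" unfolding Y_def by (rule coord_field_near[OF chart_at])
  have Yq: "Y q = x" by (simp add: Y_def)
  have "h q (delbar A (\<lambda>r. Q r (X r)) q v) (Y q) + h q (Q q (X q)) (D' Y q v)
      = fun_delbar A (\<lambda>r. h r (Q r (X r)) (Y r)) q v"
    by (rule fun_delbar_metric[OF smooth_section_near_Q[OF X] Y, symmetric])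
  also have "\<dots> = fun_delbar A (\<lambda>r. h r (X r) (Q r (Y r))) q v" by (simp only: Q_selfadjoint)
  also have "\<dots> = h q (delbar A X q v) (Q q (Y q)) + h q (X q) (D' (\<lambda>r. Q r (Y r)) q v)"
    by (rule fun_delbar_metric[OF X smooth_section_near_Q[OF Y]])
  finally show "h q (delbar A (\<lambda>r. Q r (X r)) q v) x = h q (Q q (delbar A X q v)) x"
    by (simp add: Yq D_Q_commute[OF Y] Q_selfadjoint)
qed

lemma nabla_Q: "smooth_section_near A q X \<Longrightarrow> nabla (\<lambda>r. Q r (X r)) q v = Q q (nabla X q v)"
  by (simp add: nabla_def D_Q_commute delbar_Q_commute complex_linear_add[OF Q_linear])

lemma nabla_flat: "flat_connection A nabla"
proof -
  have "adj_higgs q v x = 0" for q v x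
    by (rule h.eq_leftI[of q]) (simp add: h.adjoint_right[OF higgs_linear] higgs_zero h.zero_left h.zero_right)
  then have "higgs_conn = nabla"
    by (simp add: fun_eq_iff higgs_conn_def nabla_def higgs_zero)
  then show ?thesis using higgs_conn_flat by simp
qed

text \<open>Q squared commutes with \<open>nabla\<close> and is multiplication by a function, so the
  Leibniz rule leaves the derivative of that function times X, and X q is not zero.\<close>

lemma Q_square_deriv: "fun_deriv A Q_square q v = 0"
proof -
  define X where "X = coord_field A (chart_at A q) (axis 1 1)"
  have X: "smooth_section_near A q X" unfolding X_def by (rule coord_field_near[OF chart_at])
  have mu: "smooth_fun_near A q Q_square"
    by (rule smooth_fun_nearI[OF chart_homeomorphism(1) chart_at(2) smooth_Q_square]; rule chart_at(1))
  have "nabla (\<lambda>r. Q r (Q r (X r))) q v = Q q (Q q (nabla X q v))"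
    by (simp only: nabla_Q[OF smooth_section_near_Q[OF X]] nabla_Q[OF X])
  then have "fun_deriv A Q_square q v *s X q = 0"
    unfolding Q_Q nabla_scale[OF mu X] by simp
  moreover have "X q \<noteq> 0" by (simp add: X_def axis_eq_0_iff)
  ultimately show ?thesis by simp
qed

lemma Q_square_locally_constant:
  assumes c: "c \<in> A" "p \<in> fst c" and B: "convex B" "open B" "snd c p \<in> B" "B \<subseteq> snd c ` fst c"
    and q: "q \<in> fst c" "snd c q \<in> B"
  shows "Q_square q = Q_square p"
proof -
  let ?f = "Q_square \<circ> chart_inv c"
  have "(?f has_derivative (\<lambda>v. 0)) (at z within B)" if z: "z \<in> B" for z
  proof -
    obtain r where r: "r \<in> fst c" "z = snd c r" using z B(4) by blast
    have near: "smooth_fun_near A r Q_square"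
      by (rule smooth_fun_nearI[OF chart_homeomorphism(1)[OF c(1)] r(1) smooth_Q_square[OF c(1)]])
    have "frechet_derivative ?f (at z) v = 0" for v
      using fun_deriv_chart[OF near c(1) r(1), of "coord_field A c v r"]
      by (simp add: Q_square_deriv tangent_coord_coord_field[OF c(1) r(1)] r(2))
    then have "frechet_derivative ?f (at z) = (\<lambda>v. 0)" by blast
    then show ?thesis
      using fun_rep_has_derivative[OF near c(1) r(1)] by (simp add: r(2) has_derivative_at_withinI)
  qed
  from has_derivative_zero_constant[OF B(1) this] obtain k where k: "\<forall>z\<in>B. ?f z = k" by blast
  from bspec[OF k B(3)] bspec[OF k q(2)] show ?thesis
    by (simp add: chart_inv_left[OF c(1)] c(2) q(1))
qed

text \<open>The eigenline bundle of \<open>1 / 2\<close> is flat, so the connection form of a local section \<open>X0\<close> is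
  closed; a primitive \<open>F\<close> of it turns \<open>exp (- F) X0\<close> into a flat section.\<close>

lemma flat_eigensection:
  assumes eig: "is_eigenvalue (Q p) (1 / 2)"
  obtains V X where "open V" "p \<in> V" "smooth_section A V X"
    "\<And>q v. q \<in> V \<Longrightarrow> nabla X q v = 0" "\<And>q. q \<in> V \<Longrightarrow> X q \<noteq> 0" "\<And>q. q \<in> V \<Longrightarrow> Q q (X q) = (1 / 2) *s X q"
proof -
  obtain x where x: "x \<noteq> 0" "Q p x = (1 / 2) *s x" using eig unfolding is_eigenvalue_def by blast
  define c where "c = chart_at A p"
  have c: "c \<in> A" "p \<in> fst c" unfolding c_def by (rule chart_at)+
  define E where "E v = coord_field A c v" for v
  have E: "smooth_section A (fst c) (E v)" for v unfolding E_def by (rule smooth_coord_field[OF c(1)])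
  \<comment> \<open>Where Q squared is 1/4, Q + 1/2 is the spectral projector onto the eigenspace of
    1/2. Applied to the coordinate field through x it gives a smooth section with value x at
    p.\<close>
  define X0 where "X0 q = Q q (E x q) + (1 / 2) *s E x q" for q
  note oc = chart_homeomorphism(1)[OF c(1)]
  have X0: "smooth_section A (fst c) X0" unfolding X0_def
    by (intro smooth_section_add smooth_section_Q smooth_section_scale_const oc E)
  have X0p: "X0 p = x" by (simp add: X0_def E_def c_def x(2) vec_eq_iff)
  have X0s: "smooth_on (section_rep A c X0) (snd c ` fst c)"
    using smooth_sectionD[OF X0 c(1)] by simp
  define Z where "Z = snd c ` fst c \<inter> section_rep A c X0 -` (- {0})"
  have "open Z" unfolding Z_def
    by (intro continuous_open_preimage smooth_on_continuous[OF X0s] chart_homeomorphism(2)[OF c(1)]) auto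
  moreover have "snd c p \<in> Z"
    using c x(1) section_rep_chart[OF c, of X0] X0p by (simp add: Z_def) (simp add: c_def)
  ultimately obtain \<epsilon> where \<epsilon>: "\<epsilon> > 0" "ball (snd c p) \<epsilon> \<subseteq> Z" using open_contains_ball by blast
  \<comment> \<open>A ball supplies the convexity used both for the constancy of
    \<open>Q_square\<close> and for the primitive of the connection form; inside Z the section
    \<open>X0\<close> has no zeros.\<close>
  define B where "B = ball (snd c p) \<epsilon>"
  have B: "open B" "convex B" "snd c p \<in> B" "B \<subseteq> snd c ` fst c" using \<epsilon> by (auto simp: B_def Z_def)
  define V where "V = {q \<in> fst c. snd c q \<in> B}"
  have V: "open V" "p \<in> V" "V \<subseteq> fst c" "snd c ` (V \<inter> fst c) = B" "snd c ` V = B"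
    using open_chart_preimage[OF c(1) B(1)] c(2) B by (auto simp: V_def)
  note near = smooth_section_nearI[OF V(1)] and fnear = smooth_fun_nearI[OF V(1)]
  have X0V: "smooth_section A V X0" and EV: "smooth_section A V (E v)" for v
    using smooth_section_subset[OF X0 V(3)] smooth_section_subset[OF E V(3)] by auto
  have X0_ne: "X0 q \<noteq> 0" if "q \<in> V" for q
  proof
    assume "X0 q = 0"
    moreover have "q \<in> fst c" "snd c q \<in> Z" using that \<epsilon>(2) by (auto simp: V_def B_def)
    ultimately show False
      using section_rep_chart[OF c(1), of q X0] complex_linear_zero[OF tangent_coord_complex_linear[OF c(1), of q]]
      by (simp add: Z_def)
  qed
  have mu: "Q_square q = 1 / 4" if "q \<in> V" for q
    using Q_square_locally_constant[OF c B(2,1,3,4), of q] that eigenvalue_imp_Q_square[OF eig] by (simp add: V_def)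
  have QX0: "Q q (X0 q) = (1 / 2) *s X0 q" if "q \<in> V" for q
    by (simp add: X0_def complex_linear_add[OF Q_linear] complex_linear_scale[OF Q_linear] Q_Q mu[OF that]
        vec_eq_iff algebra_simps)
  \<comment> \<open>The connection form relative to \<open>X0\<close>, written as the quotient
    occurring in \<open>eigenline\<close>, from which its smoothness is evident.\<close>
  define \<theta> where "\<theta> v q = h q (nabla X0 q (E v q)) (X0 q) / h q (X0 q) (X0 q)" for v q
  have \<theta>_smooth: "smooth_fun A V (\<theta> v)" for v
    unfolding \<theta>_def
    by (intro smooth_fun_divide smooth_metric smooth_section_nabla V(1) X0V EV)
      (use X0_ne h.self_eq_zero in blast)
  have nabla_X0: "nabla X0 q (E v q) = \<theta> v q *s X0 q" if q: "q \<in> V" for q v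
    unfolding \<theta>_def
  proof (rule eigenline[OF X0_ne[OF q] QX0[OF q]])
    have "Q q (nabla X0 q (E v q)) = nabla (\<lambda>r. Q r (X0 r)) q (E v q)"
      by (rule nabla_Q[OF near[OF q X0V], symmetric])
    also have "\<dots> = nabla (\<lambda>r. (1 / 2) *s X0 r) q (E v q)"
    proof (rule nabla_cong[OF smooth_section_near_Q[OF near[OF q X0V]]
          smooth_section_near_scale_const[OF near[OF q X0V]]])
      have "\<forall>\<^sub>F r in nhds q. r \<in> V" using V(1) q eventually_nhds by blast
      then show "\<forall>\<^sub>F r in nhds q. Q r (X0 r) = (1 / 2) *s X0 r"
        by (rule eventually_mono) (rule QX0)
    qed
    also have "\<dots> = (1 / 2) *s nabla X0 q (E v q)"
      by (simp add: nabla_scale[OF smooth_fun_near_const near[OF q X0V]])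
    finally show "Q q (nabla X0 q (E v q)) = (1 / 2) *s nabla X0 q (E v q)" .
  qed
  define \<omega> where "\<omega> z v = (\<theta> v \<circ> chart_inv c) z" for z v
  have \<omega>: "\<omega> (snd c q) v = \<theta> v q" if "q \<in> V" for q v
    using that V(3) chart_inv_left[OF c(1)] by (auto simp: \<omega>_def)
  have \<omega>_smooth: "smooth_on (\<lambda>z. \<omega> z v) B" for v
    using smooth_funD[OF \<theta>_smooth c(1), of v] unfolding V(4) \<omega>_def comp_def .
  have \<omega>_lin: "linear (\<omega> z)" if z: "z \<in> B" for z
  proof -
    obtain q where q: "q \<in> V" "z = snd c q" using z V(5) by blast
    have qc: "q \<in> fst c" using q(1) V(3) by blast
    note J = jacobi_complex_linear[OF c(1) chart_at(1) qc chart_at(2)]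
    note N = nabla_linear[OF near[OF q(1) X0V]]
    have "linear (\<theta>' q)" if "\<theta>' = (\<lambda>q v. \<theta> v q)" for \<theta>'
      unfolding that \<theta>_def E_def coord_field_def
      by (rule linearI)
        (simp_all add: linear_add[OF complex_linear_imp_linear[OF J]] linear_cmul[OF complex_linear_imp_linear[OF J]]
          linear_add[OF N] linear_cmul[OF N] h.add_left add_divide_distrib,
          simp add: scaleR_eq_vector_scalar h.scale_left scaleR_conv_of_real)
    moreover have "\<omega> z = (\<lambda>v. \<theta> v q)" using \<omega>[OF q(1)] q(2) by blast
    ultimately show ?thesis by simp
  qed
  have closed: "frechet_derivative (\<lambda>z. \<omega> z u) (at z) v = frechet_derivative (\<lambda>z. \<omega> z v) (at z) u"
    if z: "z \<in> B" for z u v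
  proof -
    obtain q where q: "q \<in> V" "z = snd c q" using z V(5) by blast
    have qc: "q \<in> fst c" using q(1) V(3) by blast
    have ev: "\<forall>\<^sub>F r in nhds q. r \<in> V" using V(1) q(1) eventually_nhds by blast
    have d: "fun_deriv A (\<theta> u) q (E v q) = frechet_derivative (\<lambda>z. \<omega> z u) (at z) v" for u v
      using fun_deriv_chart[OF fnear[OF q(1) \<theta>_smooth] c(1) qc, of u "E v q"]
      by (simp add: E_def tangent_coord_coord_field[OF c(1) qc] q(2) \<omega>_def comp_def)
    \<comment> \<open>In rank one the product of connection coefficients is symmetric in u and v, so
      only derivatives of \<theta> survive antisymmetrisation.\<close>
    have second: "nabla (\<lambda>r. nabla X0 r (E v r)) q (E u q)
      = (fun_deriv A (\<theta> v) q (E u q) + \<theta> v q * \<theta> u q) *s X0 q" for u v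
    proof -
      have "nabla (\<lambda>r. nabla X0 r (E v r)) q (E u q) = nabla (\<lambda>r. \<theta> v r *s X0 r) q (E u q)"
        by (rule nabla_cong[OF near[OF q(1) smooth_section_nabla[OF V(1) X0V EV]]
              near[OF q(1) smooth_section_scale[OF V(1) \<theta>_smooth X0V]] eventually_mono[OF ev nabla_X0]])
      then show ?thesis
        by (simp add: nabla_scale[OF fnear[OF q(1) \<theta>_smooth] near[OF q(1) X0V]] nabla_X0[OF q(1)]
            vector_smult_assoc vec.scale_left_distrib)
    qed
    have "nabla (\<lambda>r. nabla X0 r (E v r)) q (E u q) - nabla (\<lambda>r. nabla X0 r (E u r)) q (E v q)
        - nabla X0 q (lie_bracket A (E u) (E v) q) = 0"
      using nabla_flat[unfolded flat_connection_def, rule_format, OF V(1) EV EV X0V q(1)] .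
    moreover have "lie_bracket A (E u) (E v) q = 0" unfolding E_def by (rule lie_bracket_coord_field[OF c(1) qc])
    ultimately have "(fun_deriv A (\<theta> v) q (E u q) - fun_deriv A (\<theta> u) q (E v q)) *s X0 q = 0"
      unfolding second by (simp add: linear_0[OF nabla_linear[OF near[OF q(1) X0V]]] vec_eq_iff algebra_simps)
    then show ?thesis using X0_ne[OF q(1)] by (simp add: d)
  qed
  obtain F where "\<forall>z\<in>B. (F has_derivative \<omega> z) (at z)"
    using closed_form_primitive[where \<omega> = \<omega> and S = B, OF B(1,2,3) \<omega>_lin \<omega>_smooth closed] ..
  then have F: "(F has_derivative \<omega> z) (at z)" if "z \<in> B" for z using that by (rule bspec)
  \<comment> \<open>The primitive is so far only differentiable; having the smooth form \<omega> as
    derivative makes it smooth to all orders.\<close>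
  have F_smooth: "smooth_on F B"
  proof (subst smooth_on_iff_deriv, intro conjI ballI allI)
    show "F differentiable at z" if "z \<in> B" for z by (rule differentiableI[OF F[OF that]])
    show "smooth_on (\<lambda>z. frechet_derivative F (at z) v) B" for v
      by (rule smooth_on_cong[OF B(1) \<omega>_smooth[of v]]) (simp add: frechet_derivativeI[OF F])
  qed
  define \<phi> where "\<phi> q = exp (- F (snd c q))" for q
  have \<phi>_rep: "exp (- F z) = (\<phi> \<circ> chart_inv c) z" if "z \<in> B" for z
    using that V(3,5) chart_inv_left[OF c(1)] by (auto simp: \<phi>_def)
  have \<phi>_smooth: "smooth_fun A V \<phi>"
  proof (rule smooth_fun_chartI[OF V(1) c(1) V(3)], unfold V(5))
    show "smooth_on (\<phi> \<circ> chart_inv c) B"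
      by (rule smooth_on_cong[OF B(1) smooth_on_exp[OF B(1)
            smooth_on_bounded_linear[OF bounded_linear_minus[OF bounded_linear_ident] B(1) F_smooth]] \<phi>_rep])
  qed
  have \<phi>_deriv: "fun_deriv A \<phi> q (E v q) = - \<phi> q * \<theta> v q" if q: "q \<in> V" for q v
  proof -
    have z: "snd c q \<in> B" and qc: "q \<in> fst c" using q V(3,5) by auto
    have "((\<lambda>z. exp (- F z)) has_derivative (\<lambda>v. exp (- F (snd c q)) * - \<omega> (snd c q) v)) (at (snd c q))"
      using has_derivative_compose[OF has_derivative_minus[OF F[OF z]]
          DERIV_exp[of "- F (snd c q)", unfolded has_field_derivative_def]] .
    from has_derivative_transform_within_open[OF this B(1) z \<phi>_rep]
    have "((\<phi> \<circ> chart_inv c) has_derivative (\<lambda>v. exp (- F (snd c q)) * - \<omega> (snd c q) v)) (at (snd c q))" .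
    from fun_deriv_chartI[OF this c(1) qc, of "E v q"] show ?thesis
      by (simp add: E_def tangent_coord_coord_field[OF c(1) qc] \<omega>[OF q] \<phi>_def)
  qed
  have flat: "nabla (\<lambda>r. \<phi> r *s X0 r) q v = 0" if q: "q \<in> V" for q v
  proof -
    have qc: "q \<in> fst c" using q V(3) by blast
    \<comment> \<open>\<open>nabla_X0\<close> and \<open>\<phi>_deriv\<close> hold along coordinate
      fields; at q every direction is the value of one.\<close>
    have v: "v = E (tangent_coord A c q v) q" unfolding E_def using coord_field_tangent_coord[OF c(1) qc] by simp
    show ?thesis
      unfolding nabla_scale[OF fnear[OF q \<phi>_smooth] near[OF q X0V]]
      by (subst (1 2) v) (simp only: nabla_X0[OF q] \<phi>_deriv[OF q], simp add: vec_eq_iff)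
  qed
  have ne: "\<phi> q *s X0 q \<noteq> 0" if "q \<in> V" for q
    using X0_ne[OF that] by (simp add: \<phi>_def)
  have eigen: "Q q (\<phi> q *s X0 q) = (1 / 2) *s (\<phi> q *s X0 q)" if "q \<in> V" for q
    by (simp only: complex_linear_scale[OF Q_linear] QX0[OF that] vector_smult_assoc mult.commute)
  show thesis
    by (rule that[of V "\<lambda>r. \<phi> r *s X0 r", OF V(1,2) smooth_section_scale[OF V(1) \<phi>_smooth X0V] flat ne eigen])
qed

lemma flat_eigenframe:
  assumes "is_eigenvalue (Q p) (1 / 2)"
  shows "\<exists>V X. open V \<and> p \<in> V \<and> holomorphic_frame A V X \<and> (\<forall>j. flat_section_on D' V (X j))
    \<and> (\<forall>q\<in>V. has_matrix_in_frame (Q q) (\<lambda>j. X j q) (vector [vector [1 / 2, 0], vector [0, - 1 / 2]]))"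
proof -
  obtain V X1 where V: "open V" "p \<in> V" and X1: "smooth_section A V X1"
    and flat1: "\<And>q v. q \<in> V \<Longrightarrow> nabla X1 q v = 0" and ne: "\<And>q. q \<in> V \<Longrightarrow> X1 q \<noteq> 0"
    and Q1: "\<And>q. q \<in> V \<Longrightarrow> Q q (X1 q) = (1 / 2) *s X1 q"
    using flat_eigensection[OF assms] by blast
  \<comment> \<open>\<kappa> is parallel and anticommutes with Q, so the second eigensection comes
    without another integration.\<close>
  define X2 where "X2 q = \<kappa> q (X1 q)" for q
  define X where "X j = (if j = 1 then X1 else X2)" for j :: 2
  note near = smooth_section_nearI[OF V(1)]
  have X2: "smooth_section A V X2"
    using kappa_maps_smooth V(1) X1 unfolding maps_smooth_sections_def X2_def by blast
  have flat2: "nabla X2 q v = 0" if "q \<in> V" for q v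
    unfolding X2_def nabla_kappa[OF near[OF that X1]] flat1[OF that] by (rule kappa_zero)
  have X: "smooth_section A V (X j)" "q \<in> V \<Longrightarrow> nabla (X j) q v = 0" for j q v
    using X1 X2 flat1 flat2 by (auto simp: X_def)
  have types: "D' (X j) q v = 0" "delbar A (X j) q v = 0" if "q \<in> V" for j q v
    using nabla_zero_types[OF near[OF that X(1)] X(2)[OF that]] by auto
  have range: "range (\<lambda>j. X j q) = {X1 q, X2 q}" for q
    by (auto simp: X_def UNIV_2)
  note Q2 = kappa_eigenvector[OF ne Q1, folded X2_def]
  have frame: "holomorphic_frame A V X"
    unfolding holomorphic_frame_def holomorphic_section_def
  proof (intro conjI allI ballI X(1) types(2))
    fix q assume q: "q \<in> V"
    note fr = eigenvectors_frame[OF ne[OF q] Q1[OF q] Q2[OF q q]]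
    show "inj (\<lambda>j. X j q)" using fr(1) by (auto simp: inj_def X_def forall_2)
    show "vec.independent (range (\<lambda>j. X j q))" "vec.span (range (\<lambda>j. X j q)) = UNIV"
      unfolding range by (rule fr)+
  qed
  have flat: "flat_section_on D' V (X j)" for j
    unfolding flat_section_on_def using types(1) by blast
  have matrix: "has_matrix_in_frame (Q q) (\<lambda>j. X j q) (vector [vector [1 / 2, 0], vector [0, - 1 / 2]])"
    if q: "q \<in> V" for q
    unfolding has_matrix_in_frame_def forall_2 sum_2 X_def using Q1[OF q] Q2(2)[OF q q] by simp
  show ?thesis
    by (intro exI[of _ V] exI[of _ X] conjI allI ballI V frame flat matrix)
qed

end

end

theorem corollary3:
  fixes A :: "('m::{t2_space, second_countable_topology}, 2) chart set"
    and h :: "('m, 2) form_field"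
    and D' :: "('m, 2) operator"
    and \<Phi> :: "('m, 2) end_form"
    and \<kappa> U Q :: "('m, 2) end_field"
    and p :: 'm
  assumes "complex_manifold A"
    and "tt_star_bundle A h D' \<Phi> \<kappa> U Q"
    and "parallel_end A D' U"
  shows "(\<not> is_eigenvalue (Q p) (1 / 2) \<and> \<not> is_eigenvalue (Q p) (- 1 / 2) \<longrightarrow>
            (\<exists>V. open V \<and> p \<in> V \<and> higgs_vanishes_on \<Phi> V \<and> holomorphic_connection_on A V D'))
       \<and> (is_eigenvalue (Q p) (1 / 2) \<and> holomorphic_connection_on A UNIV D' \<longrightarrow>
            (\<exists>V X. open V \<and> p \<in> V \<and> holomorphic_frame A V X
               \<and> (\<forall>j. flat_section_on D' V (X j))
               \<and> (\<forall>q\<in>V. has_matrix_in_frame (Q q) (\<lambda>j. X j q)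
                           (vector [vector [1 / 2, 0], vector [0, - 1 / 2]]))
               \<and> higgs_vanishes_on \<Phi> V))"
proof -
  have "harmonic_higgs_bundle A h D' \<Phi>"
    using assms(2) unfolding tt_star_bundle_def integrable_harmonic_higgs_bundle_def by blast
  then interpret tt_bundle_2 A h D' \<Phi> \<kappa> U Q
    using assms by unfold_locales
  show ?thesis
  proof (intro conjI impI)
    assume "\<not> is_eigenvalue (Q p) (1 / 2) \<and> \<not> is_eigenvalue (Q p) (- 1 / 2)"
    then show "\<exists>V. open V \<and> p \<in> V \<and> higgs_vanishes_on \<Phi> V \<and> holomorphic_connection_on A V D'"
      using higgs_vanishes_near holomorphic_connection_if_higgs_vanishes by blast
  next
    assume *: "is_eigenvalue (Q p) (1 / 2) \<and> holomorphic_connection_on A UNIV D'"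
    \<comment> \<open>Holomorphy of \<open>D'\<close> is assumed on \<open>UNIV\<close>, so \<Phi>
      vanishes on all of M; this global form discharges the assumption behind
      \<open>flat_eigenframe\<close>.\<close>
    then have zero: "\<Phi> q v x = 0" for q v x
      using higgs_vanishes_if_holomorphic_connection by blast
    then have vanishes: "higgs_vanishes_on \<Phi> V" for V unfolding higgs_vanishes_on_def by blast
    obtain V X where VX: "open V" "p \<in> V" "holomorphic_frame A V X" "\<forall>j. flat_section_on D' V (X j)"
      "\<forall>q\<in>V. has_matrix_in_frame (Q q) (\<lambda>j. X j q) (vector [vector [1 / 2, 0], vector [0, - 1 / 2]])"
      using flat_eigenframe[OF zero conjunct1[OF *]] by (elim exE conjE)
    show "\<exists>V X. open V \<and> p \<in> V \<and> holomorphic_frame A V X \<and> (\<forall>j. flat_section_on D' V (X j))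
        \<and> (\<forall>q\<in>V. has_matrix_in_frame (Q q) (\<lambda>j. X j q) (vector [vector [1 / 2, 0], vector [0, - 1 / 2]]))
        \<and> higgs_vanishes_on \<Phi> V"
      by (intro exI[of _ V] exI[of _ X] conjI VX vanishes)
  qed
qed

end
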